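(* Fix $n \in \mathbb{N} = \{0,1,2,\ldots\}$. Let $\mathcal{Z} = \mathbb{Z}[D, D_L, D_R, K_L, K_R, K]$ and $\mathcal{A} = \mathbb{Z}[a^{\pm 1},b^{\pm 1},c^{\pm 1},d^{\pm 1},x^{\pm 1},y^{\pm 1},z^{\pm 1},w^{\pm 1}]$. Fix a unital ring homomorphism $\theta : \mathcal{Z} \to \mathcal{A}$, regard $\mathcal{A}$ as a $\mathcal{Z}$-algebra via $\theta$, and let $b_n^{\prime,\mathcal{A}} := \mathcal{A} \otimes_{\mathcal{Z}} b'_n$, where $b'_n$ is the symplectic blob algebra over $\mathcal{Z}$ with generators $\mathcal{G}_n = \{e, U_1, \ldots, U_{n-1}, f\}$. Let $V$ be the free $\mathcal{A}$-module with basis $\{v_1,v_2\}$, and let $R^q_i \in \mathrm{End}_{\mathcal{A}}(V^{\otimes 4n})$ (for $q \in \mathcal{A}^\times$, $i \in I_n = \{-2n+1, -2n+2, \ldots, 2n\}$) be the operators defined in the context. Define a map $\mathcal{R} : \mathcal{G}_n \to \mathrm{End}_{\mathcal{A}}(V^{\otimes 4n})$ by $$\mathcal{R}(U_i) = R^a_{-n-i} R^b_{-n+i} R^c_{n-i} R^d_{n+i}, \qquad \mathcal{R}(e) = R^x_{-n} R^y_{n}, \qquad \mathcal{R}(f) = R^z_0 R^w_{2n}.$$ Then $\mathcal{R}$ extends to a unique representation of $b_n^{\prime,\mathcal{A}}$ on $V^{\otimes 4n}$, also called $\mathcal{R}$, if and only if the action of $\mathcal{Z}$ on $\mathcal{A}$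 is such that: \begin{align*} \theta(D) &= \left(a+\tfrac1a\right)\left(b+\tfrac1b\right)\left(c+\tfrac1c\right)\left(d+\tfrac1d\right),\\ \theta(D_L) &= \left(x+\tfrac1x\right)\left(y+\tfrac1y\right),\\ \theta(D_R) &= \left(z+\tfrac1z\right)\left(w+\tfrac1w\right),\\ \theta(K_L) &= \left(\tfrac{ab}{x}+\tfrac{x}{ab}\right)\left(\tfrac{cd}{y}+\tfrac{y}{cd}\right),\\ \theta(K_R) &= \left(\tfrac{ad}{w}+\tfrac{w}{ad}\right)\left(\tfrac{bc}{z}+\tfrac{z}{bc}\right),\\ \theta(K) &= \begin{cases} \frac{xy}{zw}+2+\frac{zw}{xy} & \text{if } n \text{ is odd},\\[2pt] \frac{abcd}{xyzw}+2+\frac{xyzw}{abcd} & \text{if } n \text{ is even}.\end{cases} \end{align*}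
   Context: Symplectic blob algebra. For $n\in\mathbb{N}$, $b'_n$ is the associative unital algebra over $\mathcal{Z} = \mathbb{Z}[D, D_L, D_R, K_L, K_R, K]$ with generators $\mathcal{G}_n = \{e, U_1,\ldots,U_{n-1}, f\}$ and relations: - $U_i^2 = D\,U_i$ for all $i$; - $U_iU_jU_i = U_i$ if $|i-j|=1$; - $U_iU_j = U_jU_i$ if $|i-j| \neq 1$; - $e^2 = D_L e$; $f^2 = D_R f$; - $U_1 e U_1 = K_L U_1$; $U_{n-1} f U_{n-1} = K_R U_{n-1}$; - $eU_i = U_i e$ if $i \neq 1$; $fU_i = U_i f$ if $i \neq n-1$; - $ef = fe$ if $n>1$; - $IJI = K I$ and $JIJ = K J$, where $I = U_1U_3\cdots U_{n-2} f$ and $J = e U_2 U_4\cdots U_{n-1}$ if $n$ is odd, and $I = U_1U_3\cdots U_{n-1}$ and $J = eU_2U_4\cdots U_{n-2} f$ if $n$ is even. Operators. $V$ is the free $\mathcal{A}$-module with basis $\{v_1,v_2\}$, and $V^{\otimes 4n}$ is the $4n$-fold tensor product over $\mathcal{A}$. Its tensor factors are indexed, from left to right, by $I_n = \{-2n+1, -2n+2, \ldots, 2n\}$. It has a basis of elements $\underline{\alpha_{-2n+1}\alpha_{-2n+2}\cdots\alpha_{2n}} := v_{\alpha_{-2n+1}}\otimes v_{\alpha_{-2n+2}} \otimes\cdots\otimes v_{\alpha_{2n}}$ with each $\alpha_j\in\{1,2\}$. $\mathcal{A}^\times$ denotes the group of units of $\mathcal{A}$. For $q \in \mathcal{A}^\times$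 and $i \in I_n$, $R^q_i \in \mathrm{End}_{\mathcal{A}}(V^{\otimes 4n})$ is defined on basis elements $\alpha = \underline{\alpha_{-2n+1}\cdots\alpha_{2n}}$ as follows. - For $i \neq 2n$: if $\alpha_i = \alpha_{i+1}$ then $R^q_i\alpha = 0$; if $\alpha_i\neq\alpha_{i+1}$ then $R^q_i \alpha = q^{2-\alpha_i}\,\underline{\cdots 12\cdots} + q^{1-\alpha_i}\,\underline{\cdots 21\cdots}$, where the displayed two entries replace those in positions $i,i+1$ and all other entries are those of $\alpha$. - For $i=2n$: if $\alpha_{2n} = \alpha_{-2n+1}$ then $R^q_{2n}\alpha = 0$; otherwise $R^q_{2n}\alpha = q^{2-\alpha_{2n}}\,\underline{2\,\alpha_{-2n+2}\cdots\alpha_{2n-1}\,1} + q^{1-\alpha_{2n}}\,\underline{1\,\alpha_{-2n+2}\cdots\alpha_{2n-1}\,2}$.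
   Formalization: Proved for n ≥ 1 (for n = 0 the set I_0 is empty and the operators are undefined); for n = 1 the equations for θ(D), θ(K_L), θ(K_R) are dropped, since no U_i exists and these parameters occur in no relation, so the literal "only if" fails. *)

theory Defs
  imports "HOL-Library.Poly_Mapping" "HOL-Algebra.Algebraic_Closure_Type"
begin

section \<open>Algebras over a commutative ring\<close>

text \<open>Scalars form a type \<open>'r\<close> of class \<^class>\<open>comm_ring_1\<close>; modules and (not necessarily
  commutative) algebras are HOL-Algebra records of type \<open>('r, 'b) module\<close>, where for mere modules
  the ring multiplication and the one are irrelevant.\<close>

definition algebra_via :: "('b, 'm) ring_scheme \<Rightarrow> ('r \<Rightarrow> 'b) \<Rightarrow> ('r, 'b) module" where
  "algebra_via B \<eta> = \<lparr>carrier = carrier B, monoid.mult = monoid.mult B, one = one B,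
     zero = zero B, add = add B, module.smult = (\<lambda>r x. \<eta> r \<otimes>\<^bsub>B\<^esub> x)\<rparr>"

definition algebra_hom ::
  "('r, 'b, 'm) module_scheme \<Rightarrow> ('r, 'c, 'n) module_scheme \<Rightarrow> ('b \<Rightarrow> 'c) set" where
  "algebra_hom B C =
     {h \<in> ring_hom B C. \<forall>r. \<forall>x\<in>carrier B. h (r \<odot>\<^bsub>B\<^esub> x) = r \<odot>\<^bsub>C\<^esub> h x}"

definition endo_algebra :: "('r, 'v, 'm) module_scheme \<Rightarrow> ('r, 'v \<Rightarrow> 'v) module" where
  "endo_algebra M =
     \<lparr>carrier = {f \<in> carrier M \<rightarrow>\<^sub>E carrier M.
         (\<forall>u\<in>carrier M. \<forall>v\<in>carrier M. f (u \<oplus>\<^bsub>M\<^esub> v) = f u \<oplus>\<^bsub>M\<^esub> f v) \<and>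
         (\<forall>r. \<forall>v\<in>carrier M. f (r \<odot>\<^bsub>M\<^esub> v) = r \<odot>\<^bsub>M\<^esub> f v)},
      monoid.mult = compose (carrier M),
      one = (\<lambda>v\<in>carrier M. v),
      zero = (\<lambda>v\<in>carrier M. \<zero>\<^bsub>M\<^esub>),
      add = (\<lambda>f g. \<lambda>v\<in>carrier M. f v \<oplus>\<^bsub>M\<^esub> g v),
      module.smult = (\<lambda>r f. \<lambda>v\<in>carrier M. r \<odot>\<^bsub>M\<^esub> f v)\<rparr>"

definition representations ::
  "('r, 'b, 'm) module_scheme \<Rightarrow> ('r, 'v, 'n) module_scheme \<Rightarrow> ('b \<Rightarrow> 'v \<Rightarrow> 'v) set" where
  "representations B M = algebra_hom B (endo_algebra M) \<inter> extensional (carrier B)"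

text \<open>The product on \<^typ>\<open>'a \<Rightarrow>\<^sub>0 'r\<close> from \<^theory>\<open>HOL-Library.Poly_Mapping\<close> extends the addition of
  the type \<^typ>\<open>'a\<close>; here the operation extended is that of a monoid record.\<close>

definition monoid_algebra :: "('a, 'm) monoid_scheme \<Rightarrow> ('a \<Rightarrow>\<^sub>0 'r::comm_ring_1) ring" where
  "monoid_algebra M =
     \<lparr>carrier = {p. Poly_Mapping.keys p \<subseteq> carrier M},
      monoid.mult = (\<lambda>p q. \<Sum>s\<in>Poly_Mapping.keys p. \<Sum>t\<in>Poly_Mapping.keys q.
        Poly_Mapping.single (s \<otimes>\<^bsub>M\<^esub> t) (Poly_Mapping.lookup p s * Poly_Mapping.lookup q t)),
      one = Poly_Mapping.single \<one>\<^bsub>M\<^esub> 1, zero = 0, add = (+)\<rparr>"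

definition free_monoid :: "'g set \<Rightarrow> 'g list monoid" where
  "free_monoid G = \<lparr>carrier = lists G, monoid.mult = (@), one = []\<rparr>"

text \<open>The tensor product of two algebras is the quotient of the free abelian group on the pairs
  \<open>(a, b)\<close> by the bilinearity relations. The free abelian group is taken with the multiplication
  \<open>(a, b) (a', b') = (a a', b b')\<close>; as the relations are stable under multiplication by pairs, the
  subgroup they generate coincides with the ideal they generate.\<close>

inductive_set tensor_relations ::
  "('r, 'a, 'm) module_scheme \<Rightarrow> ('r, 'b, 'n) module_scheme \<Rightarrow> ('a \<times> 'b \<Rightarrow>\<^sub>0 int) set"
  for A B where
  add_left: "a \<in> carrier A \<Longrightarrow> a' \<in> carrier A \<Longrightarrow> b \<in> carrier B \<Longrightarrow>
     Poly_Mapping.single (a \<oplus>\<^bsub>A\<^esub> a', b) 1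
       - (Poly_Mapping.single (a, b) 1 + Poly_Mapping.single (a', b) 1) \<in> tensor_relations A B"
| add_right: "a \<in> carrier A \<Longrightarrow> b \<in> carrier B \<Longrightarrow> b' \<in> carrier B \<Longrightarrow>
     Poly_Mapping.single (a, b \<oplus>\<^bsub>B\<^esub> b') 1
       - (Poly_Mapping.single (a, b) 1 + Poly_Mapping.single (a, b') 1) \<in> tensor_relations A B"
| balanced: "a \<in> carrier A \<Longrightarrow> b \<in> carrier B \<Longrightarrow>
     Poly_Mapping.single (r \<odot>\<^bsub>A\<^esub> a, b) 1
       - Poly_Mapping.single (a, r \<odot>\<^bsub>B\<^esub> b) 1 \<in> tensor_relations A B"

definition tensor_ideal ::
  "('r, 'a, 'm) module_scheme \<Rightarrow> ('r, 'b, 'n) module_scheme \<Rightarrow> ('a \<times> 'b \<Rightarrow>\<^sub>0 int) set" where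
  "tensor_ideal A B = genideal (monoid_algebra (A \<times>\<times> B)) (tensor_relations A B)"

definition tensor_algebra ::
  "('r, 'a, 'm) module_scheme \<Rightarrow> ('r, 'b, 'n) module_scheme \<Rightarrow> ('a \<times> 'b \<Rightarrow>\<^sub>0 int) set ring" where
  "tensor_algebra A B = monoid_algebra (A \<times>\<times> B) Quot tensor_ideal A B"

definition pure_tensor :: "('r, 'a, 'm) module_scheme \<Rightarrow> ('r, 'b, 'n) module_scheme \<Rightarrow>
    'a \<Rightarrow> 'b \<Rightarrow> ('a \<times> 'b \<Rightarrow>\<^sub>0 int) set" where
  "pure_tensor A B a b =
     tensor_ideal A B +>\<^bsub>monoid_algebra (A \<times>\<times> B)\<^esub> Poly_Mapping.single (a, b) 1"

abbreviation ring_via :: "('r \<Rightarrow> 'a::comm_ring_1) \<Rightarrow> ('r, 'a) module" where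
  "ring_via \<theta> \<equiv> algebra_via ring_of_type_algebra \<theta>"

definition base_change :: "('r \<Rightarrow> 'a::comm_ring_1) \<Rightarrow> ('r, 'b, 'n) module_scheme \<Rightarrow>
    ('a, ('a \<times> 'b \<Rightarrow>\<^sub>0 int) set) module" where
  "base_change \<theta> B =
     algebra_via (tensor_algebra (ring_via \<theta>) B) (\<lambda>a. pure_tensor (ring_via \<theta>) B a \<one>\<^bsub>B\<^esub>)"


section \<open>The symplectic blob algebra\<close>

datatype param = \<D> | \<D>\<^sub>L | \<D>\<^sub>R | \<K>\<^sub>L | \<K>\<^sub>R | \<K>

type_synonym param_ring = "(param \<Rightarrow>\<^sub>0 nat) \<Rightarrow>\<^sub>0 int"

definition par :: "param \<Rightarrow> param_ring" where
  "par p = Poly_Mapping.single (Poly_Mapping.single p 1) 1"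

datatype blob_gen = Gen_e | Gen_U nat | Gen_f

definition blob_gens :: "nat \<Rightarrow> blob_gen set" where
  "blob_gens n = {Gen_e, Gen_f} \<union> Gen_U ` {1..<n}"

definition blob_I :: "nat \<Rightarrow> blob_gen list" where
  "blob_I n = map Gen_U (filter odd [1..<n]) @ (if odd n then [Gen_f] else [])"

definition blob_J :: "nat \<Rightarrow> blob_gen list" where
  "blob_J n = Gen_e # map Gen_U (filter even [1..<n]) @ (if even n then [Gen_f] else [])"

abbreviation blob_term :: "param_ring \<Rightarrow> blob_gen list \<Rightarrow> (blob_gen list \<Rightarrow>\<^sub>0 param_ring)"
  (infix \<open>\<cdot>\<close> 75) where
  "r \<cdot> w \<equiv> Poly_Mapping.single w r"

text \<open>A relation \<open>l = r\<close> is encoded as the element \<open>l - r\<close>. Relations mentioning a \<open>U\<^sub>i\<close> that is not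
  a generator (which only happens for \<open>n \<le> 1\<close>) are absent.\<close>

inductive_set blob_relations :: "nat \<Rightarrow> (blob_gen list \<Rightarrow>\<^sub>0 param_ring) set" for n where
  "i \<in> {1..<n} \<Longrightarrow>
     1 \<cdot> [Gen_U i, Gen_U i] - par \<D> \<cdot> [Gen_U i] \<in> blob_relations n"
| "i \<in> {1..<n} \<Longrightarrow> j \<in> {1..<n} \<Longrightarrow> \<bar>int i - int j\<bar> = 1 \<Longrightarrow>
     1 \<cdot> [Gen_U i, Gen_U j, Gen_U i] - 1 \<cdot> [Gen_U i] \<in> blob_relations n"
| "i \<in> {1..<n} \<Longrightarrow> j \<in> {1..<n} \<Longrightarrow> \<bar>int i - int j\<bar> \<noteq> 1 \<Longrightarrow>
     1 \<cdot> [Gen_U i, Gen_U j] - 1 \<cdot> [Gen_U j, Gen_U i] \<in> blob_relations n"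
| "1 \<cdot> [Gen_e, Gen_e] - par \<D>\<^sub>L \<cdot> [Gen_e] \<in> blob_relations n"
| "1 \<cdot> [Gen_f, Gen_f] - par \<D>\<^sub>R \<cdot> [Gen_f] \<in> blob_relations n"
| "n > 1 \<Longrightarrow>
     1 \<cdot> [Gen_U 1, Gen_e, Gen_U 1] - par \<K>\<^sub>L \<cdot> [Gen_U 1] \<in> blob_relations n"
| "n > 1 \<Longrightarrow>
     1 \<cdot> [Gen_U (n - 1), Gen_f, Gen_U (n - 1)] - par \<K>\<^sub>R \<cdot> [Gen_U (n - 1)] \<in> blob_relations n"
| "i \<in> {1..<n} \<Longrightarrow> i \<noteq> 1 \<Longrightarrow>
     1 \<cdot> [Gen_e, Gen_U i] - 1 \<cdot> [Gen_U i, Gen_e] \<in> blob_relations n"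
| "i \<in> {1..<n} \<Longrightarrow> i \<noteq> n - 1 \<Longrightarrow>
     1 \<cdot> [Gen_f, Gen_U i] - 1 \<cdot> [Gen_U i, Gen_f] \<in> blob_relations n"
| "n > 1 \<Longrightarrow>
     1 \<cdot> [Gen_e, Gen_f] - 1 \<cdot> [Gen_f, Gen_e] \<in> blob_relations n"
| "1 \<cdot> (blob_I n @ blob_J n @ blob_I n) - par \<K> \<cdot> blob_I n \<in> blob_relations n"
| "1 \<cdot> (blob_J n @ blob_I n @ blob_J n) - par \<K> \<cdot> blob_J n \<in> blob_relations n"

abbreviation blob_free :: "nat \<Rightarrow> (blob_gen list \<Rightarrow>\<^sub>0 param_ring) ring" where
  "blob_free n \<equiv> monoid_algebra (free_monoid (blob_gens n))"

definition blob_ideal :: "nat \<Rightarrow> (blob_gen list \<Rightarrow>\<^sub>0 param_ring) set" where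
  "blob_ideal n = genideal (blob_free n) (blob_relations n)"

definition blob_class ::
  "nat \<Rightarrow> (blob_gen list \<Rightarrow>\<^sub>0 param_ring) \<Rightarrow> (blob_gen list \<Rightarrow>\<^sub>0 param_ring) set" where
  "blob_class n p = blob_ideal n +>\<^bsub>blob_free n\<^esub> p"

definition symplectic_blob ::
  "nat \<Rightarrow> (param_ring, (blob_gen list \<Rightarrow>\<^sub>0 param_ring) set) module" where
  "symplectic_blob n = algebra_via (blob_free n Quot blob_ideal n) (\<lambda>r. blob_class n (r \<cdot> []))"

definition blob_base_change :: "nat \<Rightarrow> (param_ring \<Rightarrow> 'a::comm_ring_1) \<Rightarrow>
    ('a, ('a \<times> (blob_gen list \<Rightarrow>\<^sub>0 param_ring) set \<Rightarrow>\<^sub>0 int) set) module" where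
  "blob_base_change n \<theta> = base_change \<theta> (symplectic_blob n)"

definition blob_gen_image :: "nat \<Rightarrow> (param_ring \<Rightarrow> 'a::comm_ring_1) \<Rightarrow> blob_gen \<Rightarrow>
    ('a \<times> (blob_gen list \<Rightarrow>\<^sub>0 param_ring) set \<Rightarrow>\<^sub>0 int) set" where
  "blob_gen_image n \<theta> g =
     pure_tensor (ring_via \<theta>) (symplectic_blob n) 1 (blob_class n (1 \<cdot> [g]))"


section \<open>Laurent polynomials and the operators on tensor space\<close>

datatype laurent_var = Var_a | Var_b | Var_c | Var_d | Var_x | Var_y | Var_z | Var_w

type_synonym laurent = "(laurent_var \<Rightarrow>\<^sub>0 int) \<Rightarrow>\<^sub>0 int"

definition laurent_gen :: "laurent_var \<Rightarrow> laurent" where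
  "laurent_gen v = Poly_Mapping.single (Poly_Mapping.single v 1) 1"

definition "\<a> = laurent_gen Var_a"
definition "\<b> = laurent_gen Var_b"
definition "\<c> = laurent_gen Var_c"
definition "\<d> = laurent_gen Var_d"
definition "\<x> = laurent_gen Var_x"
definition "\<y> = laurent_gen Var_y"
definition "\<z> = laurent_gen Var_z"
definition "\<w> = laurent_gen Var_w"

text \<open>Division by units; it is unspecified when the denominator is not a unit.\<close>

definition unit_div :: "'a::comm_ring_1 \<Rightarrow> 'a \<Rightarrow> 'a" (infixl \<open>'/\<^sub>u\<close> 70) where
  "p /\<^sub>u q = p * inv\<^bsub>ring_of_type_algebra\<^esub> q"

definition I_idx :: "nat \<Rightarrow> int set" where
  "I_idx n = {- 2 * int n + 1 .. 2 * int n}"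

definition words :: "nat \<Rightarrow> (int \<Rightarrow> int) set" where
  "words n = I_idx n \<rightarrow>\<^sub>E {1, 2}"

text \<open>The tensor power of the free module on \<open>v\<^sub>1, v\<^sub>2\<close>, as the free module on the words
  \<open>\<alpha>\<close>, where \<open>\<alpha>\<close> stands for the tensor product of the \<open>v\<^bsub>\<alpha> i\<^esub>\<close> with \<open>i \<in> I_idx n\<close>.\<close>

definition tensor_space :: "nat \<Rightarrow> ('a::comm_ring_1, (int \<Rightarrow> int) \<Rightarrow>\<^sub>0 'a) module" where
  "tensor_space n =
     \<lparr>carrier = {v. Poly_Mapping.keys v \<subseteq> words n},
      monoid.mult = undefined, one = undefined, zero = 0, add = (+),
      module.smult = (\<lambda>r. Poly_Mapping.map ((*) r))\<rparr>"

definition linear_extension ::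
  "nat \<Rightarrow> ((int \<Rightarrow> int) \<Rightarrow> ((int \<Rightarrow> int) \<Rightarrow>\<^sub>0 'a)) \<Rightarrow>
    ((int \<Rightarrow> int) \<Rightarrow>\<^sub>0 'a::comm_ring_1) \<Rightarrow> ((int \<Rightarrow> int) \<Rightarrow>\<^sub>0 'a)" where
  "linear_extension n F =
     (\<lambda>v\<in>carrier (tensor_space n).
        \<Sum>\<alpha>\<in>Poly_Mapping.keys v. Poly_Mapping.lookup v \<alpha> \<odot>\<^bsub>tensor_space n\<^esub> F \<alpha>)"

definition cyc_succ :: "nat \<Rightarrow> int \<Rightarrow> int" where
  "cyc_succ n i = (if i = 2 * int n then - 2 * int n + 1 else i + 1)"

text \<open>Meaningful for a unit \<open>q\<close> and \<open>i \<in> I_idx n\<close> only (so in particular \<open>n \<ge> 1\<close>).\<close>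

definition R_op :: "nat \<Rightarrow> 'a::comm_ring_1 \<Rightarrow> int \<Rightarrow>
    ((int \<Rightarrow> int) \<Rightarrow>\<^sub>0 'a) \<Rightarrow> ((int \<Rightarrow> int) \<Rightarrow>\<^sub>0 'a)" where
  "R_op n q i = linear_extension n (\<lambda>\<alpha>. let j = cyc_succ n i in
     if \<alpha> i = \<alpha> j then 0
     else Poly_Mapping.single (\<alpha>(i := 1, j := 2)) (q [^]\<^bsub>ring_of_type_algebra\<^esub> (2 - \<alpha> i))
        + Poly_Mapping.single (\<alpha>(i := 2, j := 1)) (q [^]\<^bsub>ring_of_type_algebra\<^esub> (1 - \<alpha> i)))"

abbreviation End_V :: "nat \<Rightarrow> (laurent, ((int \<Rightarrow> int) \<Rightarrow>\<^sub>0 laurent) \<Rightarrow> ((int \<Rightarrow> int) \<Rightarrow>\<^sub>0 laurent)) module" where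
  "End_V n \<equiv> endo_algebra (tensor_space n)"

fun R_gen :: "nat \<Rightarrow> blob_gen \<Rightarrow> ((int \<Rightarrow> int) \<Rightarrow>\<^sub>0 laurent) \<Rightarrow> ((int \<Rightarrow> int) \<Rightarrow>\<^sub>0 laurent)" where
  "R_gen n (Gen_U i) =
     R_op n \<a> (- int n - int i) \<otimes>\<^bsub>End_V n\<^esub> R_op n \<b> (- int n + int i) \<otimes>\<^bsub>End_V n\<^esub>
     R_op n \<c> (int n - int i) \<otimes>\<^bsub>End_V n\<^esub> R_op n \<d> (int n + int i)"
| "R_gen n Gen_e = R_op n \<x> (- int n) \<otimes>\<^bsub>End_V n\<^esub> R_op n \<y> (int n)"
| "R_gen n Gen_f = R_op n \<z> 0 \<otimes>\<^bsub>End_V n\<^esub> R_op n \<w> (2 * int n)"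

end

theory Submission
  imports Defs
begin

text \<open>
  A representation of the base change sending the generators to given endomorphisms is unique and
  exists iff these endomorphisms satisfy the defining relations, by the universal properties of
  monoid algebras, quotients and tensor products. The operators \<open>R\<^sub>i\<close> all have rank one on the two
  tensor factors concerned, so that all relations but \<open>IJI = \<K> I\<close> and \<open>JIJ = \<K> J\<close> are checked on
  at most four neighbouring factors. For these two, \<open>I\<close> and \<open>J\<close> are products of the \<open>R\<^sub>i\<close> over the
  two perfect matchings of the cycle of \<open>4n\<close> positions into neighbours, hence of rank one; a word
  alternating on both matchings is one of the two words \<open>1212\<dots>\<close> and \<open>2121\<dots>\<close>, which leaves two
  terms for each of the two scalar products involved. Conversely, every right-hand side of a relation
  has a matrix entry \<open>1\<close>, so that the relations determine the parameters.
\<close>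

section \<open>Monoid algebras\<close>

text \<open>An operator P of rank one satisfies P X P = tr(P X) P, and every parameter is such a
  trace. For X = 1 each \<open>R\<^sub>i\<close> contributes q + 1/q. In U_1 e U_1 the trace lives
  on four neighbouring factors; only the words 1212 and 2121 count, each through diagonal entries
  alone. On the whole cycle the off-diagonal entries between the two alternating words count as
  well, since flipping every pair of one matching turns one word into the other; they are the
  summand 2. If t is the product of the parameters in I divided by that in J, this gives t + 2 + 1/t
  = (1 + t)(1 + 1/t). For odd n there are as many U_i in I as in J, for even n there is one more in
  I; hence the two cases for \<K>. The Laurent ring is a type without division, so a unit q is
  always accompanied by some q' with q q' = 1. Instead of summing over all words, the proof uses
  coefficient functions on boolean words, and expresses rank one by the condition
  \<open>balanced\<close>, under which one coefficient determines all those at words alternating on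
  the matching.\<close>

lemma type_ring_simps [simp]:
  "carrier ring_of_type_algebra = UNIV"
  "x \<otimes>\<^bsub>ring_of_type_algebra\<^esub> y = x * y"
  "x \<oplus>\<^bsub>ring_of_type_algebra\<^esub> y = x + y"
  "\<one>\<^bsub>ring_of_type_algebra\<^esub> = 1"
  "\<zero>\<^bsub>ring_of_type_algebra\<^esub> = 0"
  by (simp_all add: ring_of_type_algebra_def)

lemma algebra_via_simps [simp]:
  "carrier (algebra_via B \<eta>) = carrier B"
  "x \<otimes>\<^bsub>algebra_via B \<eta>\<^esub> y = x \<otimes>\<^bsub>B\<^esub> y"
  "\<one>\<^bsub>algebra_via B \<eta>\<^esub> = \<one>\<^bsub>B\<^esub>"
  "x \<oplus>\<^bsub>algebra_via B \<eta>\<^esub> y = x \<oplus>\<^bsub>B\<^esub> y"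
  "\<zero>\<^bsub>algebra_via B \<eta>\<^esub> = \<zero>\<^bsub>B\<^esub>"
  "r \<odot>\<^bsub>algebra_via B \<eta>\<^esub> x = \<eta> r \<otimes>\<^bsub>B\<^esub> x"
  by (simp_all add: algebra_via_def)

lemma ring_algebra_via: "ring B \<Longrightarrow> ring (algebra_via B \<eta>)"
  apply (rule ringI)
     apply (rule abelian_groupI)
  subgoal by (simp add: ring.ring_simprules)
  subgoal by (simp add: ring.ring_simprules)
  subgoal by (simp add: ring.ring_simprules)
  subgoal by (simp add: ring.ring_simprules)
  subgoal by (simp add: ring.ring_simprules)
  subgoal by (auto intro: ring.ring_simprules(9) bexI[of _ "\<ominus>\<^bsub>B\<^esub> x" for x] simp: ring.ring_simprules)
    apply (rule monoidI)
  by (simp_all add: ring.ring_simprules monoid.r_one[OF ring.is_monoid])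

text \<open>Writes \<open>p\<close> as the sum of its monomials. The key bounds are handed to the
  step for sums because the statements proved in this way concern elements supported in
  \<open>C\<close>.\<close>

lemma poly_mapping_keys_induct [consumes 1, case_names zero single add]:
  fixes p :: "'a \<Rightarrow>\<^sub>0 'b::comm_monoid_add"
  assumes "Poly_Mapping.keys p \<subseteq> C"
    and "P 0"
    and "\<And>s r. s \<in> C \<Longrightarrow> P (Poly_Mapping.single s r)"
    and "\<And>p q. Poly_Mapping.keys p \<subseteq> C \<Longrightarrow> Poly_Mapping.keys q \<subseteq> C \<Longrightarrow> P p \<Longrightarrow> P q \<Longrightarrow> P (p + q)"
  shows "P p"
proof -
  define S where "S T = sum (\<lambda>s. Poly_Mapping.single s (Poly_Mapping.lookup p s)) T" for T
  have sum_single: "S (Poly_Mapping.keys p) = p"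
    unfolding S_def
    by (rule poly_mapping_eqI)
      (simp add: lookup_sum lookup_single when_def in_keys_iff sum.delta)
  have "P (S T) \<and> Poly_Mapping.keys (S T) \<subseteq> C"
    if "finite T" "T \<subseteq> C" for T
    using that
  proof (induction T rule: finite_induct)
    case empty
    then show ?case by (simp add: S_def assms(2))
  next
    case (insert x T)
    have k: "Poly_Mapping.keys (Poly_Mapping.single x (Poly_Mapping.lookup p x)) \<subseteq> C"
      using insert.prems by simp
    then show ?case
      using insert assms(3,4) unfolding S_def
      by (simp add: order.trans[OF keys_add])
  qed
  from this[of "Poly_Mapping.keys p"] show ?thesis
    using assms(1) sum_single by simp
qed

lemma monoid_algebra_simps [simp]:
  "carrier (monoid_algebra M) = {p. Poly_Mapping.keys p \<subseteq> carrier M}"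
  "\<one>\<^bsub>monoid_algebra M\<^esub> = Poly_Mapping.single \<one>\<^bsub>M\<^esub> 1"
  "\<zero>\<^bsub>monoid_algebra M\<^esub> = 0"
  "p \<oplus>\<^bsub>monoid_algebra M\<^esub> q = p + q"
  by (simp_all add: monoid_algebra_def)

lemma monoid_algebra_mult:
  "p \<otimes>\<^bsub>monoid_algebra M\<^esub> q = (\<Sum>s\<in>Poly_Mapping.keys p. \<Sum>t\<in>Poly_Mapping.keys q.
     Poly_Mapping.single (s \<otimes>\<^bsub>M\<^esub> t) (Poly_Mapping.lookup p s * Poly_Mapping.lookup q t))"
  by (simp add: monoid_algebra_def)

lemma monoid_algebra_mult_single [simp]:
  "Poly_Mapping.single s a \<otimes>\<^bsub>monoid_algebra M\<^esub> Poly_Mapping.single t b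
    = Poly_Mapping.single (s \<otimes>\<^bsub>M\<^esub> t) (a * b)"
  by (simp add: monoid_algebra_mult)

lemma monoid_algebra_distrib:
  "(p + p') \<otimes>\<^bsub>monoid_algebra M\<^esub> q = p \<otimes>\<^bsub>monoid_algebra M\<^esub> q + p' \<otimes>\<^bsub>monoid_algebra M\<^esub> q"
  "p \<otimes>\<^bsub>monoid_algebra M\<^esub> (q + q') = p \<otimes>\<^bsub>monoid_algebra M\<^esub> q + p \<otimes>\<^bsub>monoid_algebra M\<^esub> q'"
proof -
  show "(p + p') \<otimes>\<^bsub>monoid_algebra M\<^esub> q = p \<otimes>\<^bsub>monoid_algebra M\<^esub> q + p' \<otimes>\<^bsub>monoid_algebra M\<^esub> q"
    unfolding monoid_algebra_mult
    by (rule setsum_keys_plus_distrib)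
      (simp_all add: distrib_right single_add sum.distrib)
  show "p \<otimes>\<^bsub>monoid_algebra M\<^esub> (q + q') = p \<otimes>\<^bsub>monoid_algebra M\<^esub> q + p \<otimes>\<^bsub>monoid_algebra M\<^esub> q'"
    unfolding monoid_algebra_mult sum.distrib[symmetric]
    by (intro sum.cong refl setsum_keys_plus_distrib)
      (simp_all add: distrib_left single_add)
qed

lemma monoid_algebra_mult_zero [simp]:
  "0 \<otimes>\<^bsub>monoid_algebra M\<^esub> q = 0" "q \<otimes>\<^bsub>monoid_algebra M\<^esub> 0 = 0"
  by (simp_all add: monoid_algebra_mult)

lemma ring_monoid_algebra:
  assumes "Group.monoid M"
  shows "ring (monoid_algebra M :: ('a \<Rightarrow>\<^sub>0 'r::comm_ring_1) ring)"
proof -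
  interpret M: Group.monoid M by fact
  let ?R = "monoid_algebra M :: ('a \<Rightarrow>\<^sub>0 'r) ring"
  have closed: "Poly_Mapping.keys (p \<otimes>\<^bsub>?R\<^esub> q) \<subseteq> carrier M"
    if "Poly_Mapping.keys p \<subseteq> carrier M" "Poly_Mapping.keys q \<subseteq> carrier M" for p q :: "'a \<Rightarrow>\<^sub>0 'r"
    using that unfolding monoid_algebra_mult
    by (intro order.trans[OF keys_sum] UN_least) (auto split: if_splits)
  have assoc: "(p \<otimes>\<^bsub>?R\<^esub> q) \<otimes>\<^bsub>?R\<^esub> r = p \<otimes>\<^bsub>?R\<^esub> (q \<otimes>\<^bsub>?R\<^esub> r)"
    if p: "Poly_Mapping.keys p \<subseteq> carrier M" and q: "Poly_Mapping.keys q \<subseteq> carrier M"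
      and r: "Poly_Mapping.keys r \<subseteq> carrier M" for p q r :: "'a \<Rightarrow>\<^sub>0 'r"
    using p
  proof (induction p rule: poly_mapping_keys_induct)
    case (single s a)
    show ?case using q
    proof (induction q rule: poly_mapping_keys_induct)
      case (single t b)
      show ?case using r
        by (induction r rule: poly_mapping_keys_induct)
          (use \<open>s \<in> carrier M\<close> \<open>t \<in> carrier M\<close> in \<open>simp_all add: monoid_algebra_distrib M.m_assoc mult.assoc\<close>)
    qed (simp_all add: monoid_algebra_distrib)
  qed (simp_all add: monoid_algebra_distrib)
  have one: "Poly_Mapping.single \<one>\<^bsub>M\<^esub> 1 \<otimes>\<^bsub>?R\<^esub> p = p" "p \<otimes>\<^bsub>?R\<^esub> Poly_Mapping.single \<one>\<^bsub>M\<^esub> 1 = p"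
    if "Poly_Mapping.keys p \<subseteq> carrier M" for p :: "'a \<Rightarrow>\<^sub>0 'r"
    using that
    by (induction p rule: poly_mapping_keys_induct) (simp_all add: monoid_algebra_distrib)
  show ?thesis
  proof (rule ringI)
    show "abelian_group ?R"
    proof (rule abelian_groupI)
      show "\<exists>y\<in>carrier ?R. y \<oplus>\<^bsub>?R\<^esub> x = \<zero>\<^bsub>?R\<^esub>" if "x \<in> carrier ?R" for x
        using that by (intro bexI[of _ "- x"]) (auto simp: in_keys_iff)
    qed (use keys_add in \<open>fastforce simp: add.assoc add.commute\<close>)+
    show "Group.monoid ?R"
      by (rule monoidI) (simp_all add: closed assoc one)
  qed (simp_all add: monoid_algebra_distrib)
qed

section \<open>Universal properties of monoid algebras and of quotients\<close>

definition monoid_algebra_ext ::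
  "('b, 'm) ring_scheme \<Rightarrow> ('r::comm_ring_1 \<Rightarrow> 'b) \<Rightarrow> ('a \<Rightarrow> 'b) \<Rightarrow> ('a \<Rightarrow>\<^sub>0 'r) \<Rightarrow> 'b" where
  "monoid_algebra_ext S \<eta> \<phi> p =
     (\<Oplus>\<^bsub>S\<^esub>s\<in>Poly_Mapping.keys p. \<eta> (Poly_Mapping.lookup p s) \<otimes>\<^bsub>S\<^esub> \<phi> s)"

text \<open>Multiplicativity on monomials amounts to moving \<open>\<eta> b\<close> past
  \<open>\<phi> s\<close>, which \<open>comm\<close> allows. The lemma serves twice: for words in
  the generators with scalar endomorphisms as \<eta>, and for pairs of algebra elements with integer
  coefficients.\<close>

lemma monoid_algebra_ext_hom:
  fixes S (structure) and \<eta> :: "'r::comm_ring_1 \<Rightarrow> 'b"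
  assumes M: "Group.monoid M" and S: "ring S"
    and \<eta>: "\<eta> \<in> ring_hom ring_of_type_algebra S"
    and \<phi>_closed: "\<And>s. s \<in> carrier M \<Longrightarrow> \<phi> s \<in> carrier S"
    and \<phi>_one: "\<phi> \<one>\<^bsub>M\<^esub> = \<one>"
    and \<phi>_mult: "\<And>s t. s \<in> carrier M \<Longrightarrow> t \<in> carrier M \<Longrightarrow> \<phi> (s \<otimes>\<^bsub>M\<^esub> t) = \<phi> s \<otimes> \<phi> t"
    and comm: "\<And>r s. s \<in> carrier M \<Longrightarrow> \<phi> s \<otimes> \<eta> r = \<eta> r \<otimes> \<phi> s"
  shows "monoid_algebra_ext S \<eta> \<phi> \<in> ring_hom (monoid_algebra M) S"
    and "\<And>s r. s \<in> carrier M \<Longrightarrow> monoid_algebra_ext S \<eta> \<phi> (Poly_Mapping.single s r) = \<eta> r \<otimes> \<phi> s"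
proof -
  interpret M: Group.monoid M by fact
  interpret S: ring S by fact
  interpret R: ring "monoid_algebra M :: ('a \<Rightarrow>\<^sub>0 'r) ring" by (rule ring_monoid_algebra[OF M])
  interpret Ty: ring "ring_of_type_algebra :: 'r ring" ..
  interpret \<eta>: ring_hom_ring "ring_of_type_algebra :: 'r ring" S \<eta>
    by (rule ring_hom_ringI2) (unfold_locales, fact \<eta>)
  let ?h = "monoid_algebra_ext S \<eta> \<phi>"
  have \<eta>_zero [simp]: "\<eta> 0 = \<zero>"
    using \<eta>.hom_zero by simp
  have \<eta>_closed [simp]: "\<eta> r \<in> carrier S" for r
    using \<eta>.hom_closed by simp
  have \<eta>_add: "\<eta> (a + b) = \<eta> a \<oplus> \<eta> b" for a b
    using \<eta>.hom_add[of a b] by simp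
  have \<eta>_mult: "\<eta> (a * b) = \<eta> a \<otimes> \<eta> b" for a b
    using \<eta>.hom_mult[of a b] by simp
  have \<eta>_one: "\<eta> 1 = \<one>"
    using \<eta>.hom_one by simp
  \<comment> \<open>Terms may cancel in \<open>p + q\<close>, so its keys need not be the union of
    the keys of \<open>p\<close> and \<open>q\<close>. Summing over a common superset makes the sums
    comparable term by term.\<close>
  have ext_superset: "?h p = (\<Oplus>s\<in>T. \<eta> (Poly_Mapping.lookup p s) \<otimes> \<phi> s)"
    if "finite T" "Poly_Mapping.keys p \<subseteq> T" "T \<subseteq> carrier M" for p T
    unfolding monoid_algebra_ext_def using that \<phi>_closed
    by (intro S.add.finprod_mono_neutral_cong_left) (auto simp: in_keys_iff)
  show h_single: "?h (Poly_Mapping.single s r) = \<eta> r \<otimes> \<phi> s" if "s \<in> carrier M" for s r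
    using that ext_superset[of "{s}" "Poly_Mapping.single s r"] \<phi>_closed by (simp split: if_splits)
  have h_add: "?h (p + q) = ?h p \<oplus> ?h q"
    if "Poly_Mapping.keys p \<subseteq> carrier M" "Poly_Mapping.keys q \<subseteq> carrier M" for p q
  proof -
    let ?T = "Poly_Mapping.keys p \<union> Poly_Mapping.keys q"
    have "?h (p + q) = (\<Oplus>s\<in>?T. \<eta> (Poly_Mapping.lookup (p + q) s) \<otimes> \<phi> s)"
      using that keys_add[of p q] by (intro ext_superset) auto
    also have "\<dots> = (\<Oplus>s\<in>?T. \<eta> (Poly_Mapping.lookup p s) \<otimes> \<phi> s \<oplus> \<eta> (Poly_Mapping.lookup q s) \<otimes> \<phi> s)"
      using that \<phi>_closed
      by (intro S.add.finprod_cong') (auto simp: lookup_add \<eta>_add S.l_distr subsetD)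
    also have "\<dots> = (\<Oplus>s\<in>?T. \<eta> (Poly_Mapping.lookup p s) \<otimes> \<phi> s) \<oplus>
        (\<Oplus>s\<in>?T. \<eta> (Poly_Mapping.lookup q s) \<otimes> \<phi> s)"
      using that \<phi>_closed by (intro S.finsum_addf) auto
    also have "\<dots> = ?h p \<oplus> ?h q"
      using that by (intro arg_cong2[of _ _ _ _ "add S"] ext_superset[symmetric]) auto
    finally show ?thesis .
  qed
  have h_zero: "?h 0 = \<zero>"
    by (simp add: monoid_algebra_ext_def)
  have closed: "?h p \<in> carrier S" if "Poly_Mapping.keys p \<subseteq> carrier M" for p
    unfolding monoid_algebra_ext_def using that \<phi>_closed by (intro S.finsum_closed) auto
  have mult_closed: "Poly_Mapping.keys (p \<otimes>\<^bsub>monoid_algebra M\<^esub> q) \<subseteq> carrier M"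
    if "Poly_Mapping.keys p \<subseteq> carrier M" "Poly_Mapping.keys q \<subseteq> carrier M" for p q :: "'a \<Rightarrow>\<^sub>0 'r"
    using R.m_closed[of p q] that by simp
  have mult_single: "?h (Poly_Mapping.single s a \<otimes>\<^bsub>monoid_algebra M\<^esub> q) = ?h (Poly_Mapping.single s a) \<otimes> ?h q"
    if s: "s \<in> carrier M" and q: "Poly_Mapping.keys q \<subseteq> carrier M" for s a q
    using q
  proof (induction q rule: poly_mapping_keys_induct)
    case zero
    then show ?case using s by (simp add: h_zero h_single \<phi>_closed)
  next
    case (single t b)
    have "\<eta> a \<otimes> \<eta> b \<otimes> (\<phi> s \<otimes> \<phi> t) = \<eta> a \<otimes> (\<eta> b \<otimes> \<phi> s) \<otimes> \<phi> t"
      using s single \<phi>_closed by (simp add: S.m_assoc)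
    also have "\<dots> = \<eta> a \<otimes> (\<phi> s \<otimes> \<eta> b) \<otimes> \<phi> t"
      by (simp add: comm[OF s])
    also have "\<dots> = \<eta> a \<otimes> \<phi> s \<otimes> (\<eta> b \<otimes> \<phi> t)"
      using s single \<phi>_closed by (simp add: S.m_assoc)
    finally show ?case
      using s single by (simp add: h_single \<phi>_mult \<eta>_mult)
  next
    case (add p q)
    have k: "Poly_Mapping.keys (Poly_Mapping.single s a) \<subseteq> carrier M"
      using s by simp
    show ?case
      using add s
      by (simp add: monoid_algebra_distrib h_add mult_closed[OF k] closed S.r_distr)
  qed
  have mult: "?h (p \<otimes>\<^bsub>monoid_algebra M\<^esub> q) = ?h p \<otimes> ?h q"
    if p: "Poly_Mapping.keys p \<subseteq> carrier M" and q: "Poly_Mapping.keys q \<subseteq> carrier M" for p q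
    using p
  proof (induction p rule: poly_mapping_keys_induct)
    case zero
    then show ?case using q by (simp add: h_zero closed)
  next
    case (single s a)
    then show ?case using q by (simp add: mult_single)
  next
    case (add p p')
    then show ?case using q
      by (simp add: monoid_algebra_distrib h_add mult_closed closed S.l_distr)
  qed
  show "?h \<in> ring_hom (monoid_algebra M) S"
    using h_single[of "\<one>\<^bsub>M\<^esub>" 1]
    by (intro ring_hom_memI) (simp_all add: closed mult h_add \<phi>_one \<eta>_one)
qed

lemma monoid_algebra_minus:
  assumes "Group.monoid M" "Poly_Mapping.keys p \<subseteq> carrier M" "Poly_Mapping.keys q \<subseteq> carrier M"
  shows "p \<ominus>\<^bsub>monoid_algebra M\<^esub> q = p - q"
proof -
  interpret R: ring "monoid_algebra M" by (rule ring_monoid_algebra[OF assms(1)])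
  have "\<ominus>\<^bsub>monoid_algebra M\<^esub> q = - q"
    using assms(3) by (intro R.minus_equality) (auto simp: in_keys_iff)
  then show ?thesis by (simp add: a_minus_def)
qed

lemma carrier_Quot: "carrier (R Quot I) = (+>\<^bsub>R\<^esub>) I ` carrier R"
  by (auto simp: FactRing_simps)

text \<open>The kernel of \<open>h\<close> is an ideal containing \<open>rel\<close>; hence it
  contains the generated ideal, and \<open>h\<close> is constant on its cosets.\<close>

lemma quotient_hom_ext:
  fixes S (structure)
  assumes R: "ring R" and S: "ring S" and h: "h \<in> ring_hom R S"
    and rel: "rel \<subseteq> carrier R" "\<And>x. x \<in> rel \<Longrightarrow> h x = \<zero>"
  obtains k where "k \<in> ring_hom (R Quot genideal R rel) S"
    and "\<And>x. x \<in> carrier R \<Longrightarrow> k (genideal R rel +>\<^bsub>R\<^esub> x) = h x"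
proof -
  interpret hom: ring_hom_ring R S h by (rule ring_hom_ringI2[OF R S h])
  let ?I = "genideal R rel"
  interpret I: ideal ?I R by (rule hom.R.genideal_ideal[OF rel(1)])
  have "?I \<subseteq> a_kernel R S h"
    using rel unfolding a_kernel_def' by (intro hom.R.genideal_minimal hom.kernel_is_ideal[unfolded a_kernel_def']) blast
  then have ker: "h i = \<zero>" if "i \<in> ?I" for i
    using that unfolding a_kernel_def' by blast
  \<comment> \<open>Any representative of a coset serves, since two of them differ by an element of
    the kernel of \<open>h\<close>.\<close>
  define k where "k = (\<lambda>T. h (SOME x. x \<in> T))"
  have k: "k (?I +>\<^bsub>R\<^esub> x) = h x" if x: "x \<in> carrier R" for x
  proof -
    obtain y where y: "y = (SOME y. y \<in> ?I +>\<^bsub>R\<^esub> x)" by blast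
    have "y \<in> ?I +>\<^bsub>R\<^esub> x"
      unfolding y by (rule someI[where P = "\<lambda>y. y \<in> ?I +>\<^bsub>R\<^esub> x"]) (rule I.a_rcos_self[OF x])
    then obtain i where "i \<in> ?I" "y = i \<oplus>\<^bsub>R\<^esub> x"
      unfolding a_r_coset_def' by blast
    have "h (i \<oplus>\<^bsub>R\<^esub> x) = h x"
      using x \<open>i \<in> ?I\<close> I.a_Hcarr by (simp add: ker)
    then show ?thesis
      by (simp add: k_def y[symmetric] \<open>y = i \<oplus>\<^bsub>R\<^esub> x\<close>)
  qed
  have "k \<in> ring_hom (R Quot ?I) S"
  proof (rule ring_hom_memI)
    show "k \<one>\<^bsub>R Quot ?I\<^esub> = \<one>"
      by (simp add: FactRing_def k)
    show "k x \<in> carrier S" if "x \<in> carrier (R Quot ?I)" for x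
      using that by (auto simp: carrier_Quot k)
    fix x y
    assume "x \<in> carrier (R Quot ?I)" "y \<in> carrier (R Quot ?I)"
    then obtain a b where ab: "a \<in> carrier R" "b \<in> carrier R"
        "x = ?I +>\<^bsub>R\<^esub> a" "y = ?I +>\<^bsub>R\<^esub> b"
      unfolding carrier_Quot by blast
    show "k (x \<otimes>\<^bsub>R Quot ?I\<^esub> y) = k x \<otimes> k y"
      using ab by (simp add: FactRing_def I.rcoset_mult_add k)
    show "k (x \<oplus>\<^bsub>R Quot ?I\<^esub> y) = k x \<oplus> k y"
      using ab by (simp add: FactRing_def I.a_rcos_sum k)
  qed
  then show ?thesis using k by (rule that)
qed

section \<open>Tensor products of algebras\<close>

text \<open>The structure map of \<open>S\<close> as a ring over the integers. It is the scalar map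
  in \<open>monoid_algebra_ext\<close> for the tensor product, which is a quotient of a monoid
  algebra with integer coefficients.\<close>

definition int_scalar :: "('a, 'm) ring_scheme \<Rightarrow> int \<Rightarrow> 'a" where
  "int_scalar S z = [z] \<cdot>\<^bsub>S\<^esub> \<one>\<^bsub>S\<^esub>"

lemma int_scalar_hom:
  assumes "ring S"
  shows "int_scalar S \<in> ring_hom ring_of_type_algebra S"
proof -
  interpret S: ring S by fact
  show ?thesis
  proof (rule ring_hom_memI)
    show "int_scalar S (x \<otimes>\<^bsub>ring_of_type_algebra\<^esub> y) = int_scalar S x \<otimes>\<^bsub>S\<^esub> int_scalar S y" for x y
    proof -
      have "[x] \<cdot>\<^bsub>S\<^esub> ([y] \<cdot>\<^bsub>S\<^esub> \<one>\<^bsub>S\<^esub>) = [(x * y)] \<cdot>\<^bsub>S\<^esub> \<one>\<^bsub>S\<^esub>"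
        using S.add.int_pow_pow[OF S.one_closed, of y x] S.add.int_pow_pow[OF S.one_closed, of x y]
        by (simp add: mult.commute)
      then show ?thesis
        by (simp add: int_scalar_def S.add_pow_ldistr_int)
    qed
  qed (simp_all add: int_scalar_def S.add.int_pow_mult)
qed

lemma int_scalar_commute:
  assumes "ring S" "x \<in> carrier S"
  shows "x \<otimes>\<^bsub>S\<^esub> int_scalar S z = int_scalar S z \<otimes>\<^bsub>S\<^esub> x"
proof -
  interpret S: ring S by fact
  show ?thesis
    using assms by (simp add: int_scalar_def S.add_pow_ldistr_int S.add_pow_rdistr_int)
qed

lemma (in ring_hom_ring) hom_minus:
  "x \<in> carrier R \<Longrightarrow> y \<in> carrier R \<Longrightarrow> h (x \<ominus> y) = h x \<ominus>\<^bsub>S\<^esub> h y"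
  by (simp add: a_minus_def)

text \<open>Closure of the two scalar actions puts the balancing relations into the carrier of the
  free abelian group on the pairs.\<close>

locale tensor_of_algebras =
  A: ring A + B: ring B
  for A :: "('r, 'a, 'm) module_scheme" and B :: "('r, 'b, 'n) module_scheme" +
  assumes smult_closed_A: "a \<in> carrier A \<Longrightarrow> r \<odot>\<^bsub>A\<^esub> a \<in> carrier A"
    and smult_closed_B: "b \<in> carrier B \<Longrightarrow> r \<odot>\<^bsub>B\<^esub> b \<in> carrier B"
begin

abbreviation P where "P \<equiv> monoid_algebra (A \<times>\<times> B) :: ('a \<times> 'b \<Rightarrow>\<^sub>0 int) ring"

lemma monoid_AB: "Group.monoid (A \<times>\<times> B)"
  by (intro DirProd_monoid A.is_monoid B.is_monoid)

sublocale P: ring P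
  by (rule ring_monoid_algebra[OF monoid_AB])

lemma tensor_relations_closed: "tensor_relations A B \<subseteq> carrier P"
proof
  fix p assume "p \<in> tensor_relations A B"
  then show "p \<in> carrier P"
    by (induction rule: tensor_relations.induct)
      (use smult_closed_A smult_closed_B in
        \<open>auto dest!: subsetD[OF keys_diff] subsetD[OF keys_add]\<close>)
qed

sublocale I: ideal "tensor_ideal A B" P
  unfolding tensor_ideal_def by (rule P.genideal_ideal[OF tensor_relations_closed])

lemma ring_tensor_algebra: "ring (tensor_algebra A B)"
  unfolding tensor_algebra_def by (rule I.quotient_is_ring)

lemma relation_imp_coset_eq:
  assumes "p - q \<in> tensor_relations A B" "p \<in> carrier P" "q \<in> carrier P"
  shows "tensor_ideal A B +>\<^bsub>P\<^esub> p = tensor_ideal A B +>\<^bsub>P\<^esub> q"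
proof -
  have "p \<ominus>\<^bsub>P\<^esub> q \<in> tensor_ideal A B"
    using assms P.genideal_self[OF tensor_relations_closed]
    by (auto simp: monoid_algebra_minus[OF monoid_AB] tensor_ideal_def)
  then show ?thesis
    using P.quotient_eq_iff_same_a_r_cos[OF I.is_ideal] assms by blast
qed

lemma pure_tensor_closed:
  "a \<in> carrier A \<Longrightarrow> b \<in> carrier B \<Longrightarrow> pure_tensor A B a b \<in> carrier (tensor_algebra A B)"
  by (simp add: pure_tensor_def tensor_algebra_def carrier_Quot)

lemma pure_tensor_mult:
  assumes "a \<in> carrier A" "b \<in> carrier B" "a' \<in> carrier A" "b' \<in> carrier B"
  shows "pure_tensor A B a b \<otimes>\<^bsub>tensor_algebra A B\<^esub> pure_tensor A B a' b'
    = pure_tensor A B (a \<otimes>\<^bsub>A\<^esub> a') (b \<otimes>\<^bsub>B\<^esub> b')"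
  using assms by (simp add: pure_tensor_def tensor_algebra_def FactRing_def I.rcoset_mult_add)

lemma pure_tensor_one: "pure_tensor A B \<one>\<^bsub>A\<^esub> \<one>\<^bsub>B\<^esub> = \<one>\<^bsub>tensor_algebra A B\<^esub>"
  by (simp add: pure_tensor_def tensor_algebra_def FactRing_def)

lemma coset_add:
  assumes "p \<in> carrier P" "q \<in> carrier P"
  shows "(tensor_ideal A B +>\<^bsub>P\<^esub> p) \<oplus>\<^bsub>tensor_algebra A B\<^esub> (tensor_ideal A B +>\<^bsub>P\<^esub> q)
    = tensor_ideal A B +>\<^bsub>P\<^esub> (p + q)"
  using assms I.a_rcos_sum[of p q] by (simp add: tensor_algebra_def FactRing_def)

lemma pure_tensor_add_right:
  assumes "a \<in> carrier A" "b \<in> carrier B" "b' \<in> carrier B"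
  shows "pure_tensor A B a (b \<oplus>\<^bsub>B\<^esub> b')
    = pure_tensor A B a b \<oplus>\<^bsub>tensor_algebra A B\<^esub> pure_tensor A B a b'"
proof -
  have "frag_of (a, b) + frag_of (a, b') \<in> carrier P"
    using assms by (auto dest!: subsetD[OF keys_add])
  then show ?thesis
    using assms coset_add[of "frag_of (a, b)" "frag_of (a, b')"]
      relation_imp_coset_eq[OF tensor_relations.add_right[of a A b B b']]
    by (simp add: pure_tensor_def)
qed

lemma pure_tensor_balanced:
  assumes "a \<in> carrier A" "b \<in> carrier B"
  shows "pure_tensor A B (r \<odot>\<^bsub>A\<^esub> a) b = pure_tensor A B a (r \<odot>\<^bsub>B\<^esub> b)"
  unfolding pure_tensor_def
  using assms smult_closed_A smult_closed_B
  by (intro relation_imp_coset_eq tensor_relations.balanced) auto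

text \<open>The map sending a pair (a, b) to \<open>\<alpha> a \<otimes> \<beta> b\<close> is
  multiplicative because the two images commute, so it extends to the integral monoid algebra.
  Distributivity kills the additivity relations, \<open>bal\<close> kills the balancing
  ones.\<close>

lemma tensor_algebra_hom_ext:
  fixes S (structure)
  assumes S: "ring S" and \<alpha>: "\<alpha> \<in> ring_hom A S" and \<beta>: "\<beta> \<in> ring_hom B S"
    and comm: "\<And>a b. a \<in> carrier A \<Longrightarrow> b \<in> carrier B \<Longrightarrow> \<beta> b \<otimes> \<alpha> a = \<alpha> a \<otimes> \<beta> b"
    and bal: "\<And>r a b. a \<in> carrier A \<Longrightarrow> b \<in> carrier B \<Longrightarrow>
      \<alpha> (r \<odot>\<^bsub>A\<^esub> a) \<otimes> \<beta> b = \<alpha> a \<otimes> \<beta> (r \<odot>\<^bsub>B\<^esub> b)"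
  obtains k where "k \<in> ring_hom (tensor_algebra A B) S"
    and "\<And>a b. a \<in> carrier A \<Longrightarrow> b \<in> carrier B \<Longrightarrow> k (pure_tensor A B a b) = \<alpha> a \<otimes> \<beta> b"
proof -
  interpret S: ring S by fact
  interpret \<alpha>: ring_hom_ring A S \<alpha> by (rule ring_hom_ringI2[OF A.ring_axioms S \<alpha>])
  interpret \<beta>: ring_hom_ring B S \<beta> by (rule ring_hom_ringI2[OF B.ring_axioms S \<beta>])
  define \<phi> where "\<phi> = (\<lambda>(a, b). \<alpha> a \<otimes> \<beta> b)"
  define h where "h = monoid_algebra_ext S (int_scalar S) \<phi>"
  have \<phi>_closed: "\<phi> s \<in> carrier S" if "s \<in> carrier (A \<times>\<times> B)" for s
    using that by (auto simp: \<phi>_def)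
  have \<phi>_mult: "\<phi> (s \<otimes>\<^bsub>A \<times>\<times> B\<^esub> t) = \<phi> s \<otimes> \<phi> t"
    if st: "s \<in> carrier (A \<times>\<times> B)" "t \<in> carrier (A \<times>\<times> B)" for s t
  proof -
    obtain a b a' b' where [simp]: "s = (a, b)" "t = (a', b')"
      by (cases s, cases t)
    have [simp]: "a \<in> carrier A" "a' \<in> carrier A" "b \<in> carrier B" "b' \<in> carrier B"
      using st by auto
    have "\<phi> (s \<otimes>\<^bsub>A \<times>\<times> B\<^esub> t) = \<alpha> a \<otimes> (\<alpha> a' \<otimes> \<beta> b) \<otimes> \<beta> b'"
      by (simp add: \<phi>_def S.m_assoc)
    also have "\<dots> = \<alpha> a \<otimes> (\<beta> b \<otimes> \<alpha> a') \<otimes> \<beta> b'"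
      by (simp add: comm)
    also have "\<dots> = \<phi> s \<otimes> \<phi> t"
      by (simp add: \<phi>_def S.m_assoc)
    finally show ?thesis .
  qed
  have h: "h \<in> ring_hom P S"
    and h_single: "\<And>s r. s \<in> carrier (A \<times>\<times> B) \<Longrightarrow> h (Poly_Mapping.single s r) = int_scalar S r \<otimes> \<phi> s"
    unfolding h_def
    using monoid_algebra_ext_hom[OF monoid_AB S int_scalar_hom[OF S], of \<phi>] \<phi>_closed \<phi>_mult
      int_scalar_commute[OF S]
    by (auto simp: \<phi>_def)
  interpret h: ring_hom_ring P S h by (rule ring_hom_ringI2[OF P.ring_axioms S h])
  have h_pure: "h (Poly_Mapping.single (a, b) 1) = \<alpha> a \<otimes> \<beta> b" if "a \<in> carrier A" "b \<in> carrier B" for a b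
    using that h_single[of "(a, b)" 1] by (simp add: \<phi>_def int_scalar_def)
  have h_minus: "h (p - q) = h p \<ominus> h q"
    if "p \<in> carrier P" "q \<in> carrier P" for p q
    using that h.hom_minus[of p q] monoid_algebra_minus[OF monoid_AB, of p q] by simp
  have h_rel: "h p = \<zero>" if "p \<in> tensor_relations A B" for p
    using that
  proof (induction rule: tensor_relations.induct)
    case (add_left a a' b)
    let ?s = "Poly_Mapping.single (a, b) 1" and ?s' = "Poly_Mapping.single (a', b) 1"
    have "?s \<in> carrier P" "?s' \<in> carrier P"
      using add_left by auto
    moreover from this have "?s + ?s' \<in> carrier P" "h (?s + ?s') = h ?s \<oplus> h ?s'"
      using h.hom_add P.a_closed by fastforce+
    ultimately show ?case
      using add_left by (simp add: h_minus h_pure S.l_distr S.r_right_minus_eq)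
  next
    case (add_right a b b')
    let ?s = "Poly_Mapping.single (a, b) 1" and ?s' = "Poly_Mapping.single (a, b') 1"
    have "?s \<in> carrier P" "?s' \<in> carrier P"
      using add_right by auto
    moreover from this have "?s + ?s' \<in> carrier P" "h (?s + ?s') = h ?s \<oplus> h ?s'"
      using h.hom_add P.a_closed by fastforce+
    ultimately show ?case
      using add_right by (simp add: h_minus h_pure S.r_distr S.r_right_minus_eq)
  next
    case (balanced a b r)
    then show ?case
      using smult_closed_A smult_closed_B by (simp add: h_minus h_pure bal S.r_right_minus_eq)
  qed
  obtain k where "k \<in> ring_hom (P Quot genideal P (tensor_relations A B)) S"
    and "\<And>p. p \<in> carrier P \<Longrightarrow> k (genideal P (tensor_relations A B) +>\<^bsub>P\<^esub> p) = h p"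
    using quotient_hom_ext[OF P.ring_axioms S h tensor_relations_closed h_rel] by metis
  then show ?thesis
    by (intro that[of k]) (simp_all add: tensor_algebra_def tensor_ideal_def pure_tensor_def h_pure)
qed

lemma tensor_algebra_hom_eqI:
  assumes S: "ring S" and h: "h \<in> ring_hom (tensor_algebra A B) S" and h': "h' \<in> ring_hom (tensor_algebra A B) S"
    and pure: "\<And>a b. a \<in> carrier A \<Longrightarrow> b \<in> carrier B \<Longrightarrow> h (pure_tensor A B a b) = h' (pure_tensor A B a b)"
    and x: "x \<in> carrier (tensor_algebra A B)"
  shows "h x = h' x"
proof -
  interpret S: ring S by fact
  interpret T: ring "tensor_algebra A B" by (rule ring_tensor_algebra)
  interpret h: ring_hom_ring "tensor_algebra A B" S h by (rule ring_hom_ringI2[OF T.ring_axioms S h])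
  interpret h': ring_hom_ring "tensor_algebra A B" S h' by (rule ring_hom_ringI2[OF T.ring_axioms S h'])
  let ?c = "\<lambda>p. tensor_ideal A B +>\<^bsub>P\<^esub> p"
  interpret c: ring_hom_ring P "tensor_algebra A B" ?c
    unfolding tensor_algebra_def by (rule I.rcos_ring_hom_ring)
  obtain p where p: "p \<in> carrier P" "x = ?c p"
    using x by (auto simp: tensor_algebra_def carrier_Quot)
  from p(1) have "Poly_Mapping.keys p \<subseteq> carrier A \<times> carrier B" by simp
  \<comment> \<open>\<open>frag_induction\<close> builds \<open>p\<close> from pairs by differences,
    so the homomorphisms are compared through subtraction; membership in the carrier is carried
    along for that step.\<close>
  then have "p \<in> carrier P \<and> h (?c p) = h' (?c p)"
  proof (induction p rule: frag_induction)
    case zero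
    then show ?case using c.hom_zero by simp
  next
    case (one s)
    then show ?case using pure[of "fst s" "snd s"] by (auto simp: pure_tensor_def)
  next
    case (diff p q)
    have "p - q \<in> carrier P" "?c (p - q) = ?c p \<ominus>\<^bsub>tensor_algebra A B\<^esub> ?c q"
      using diff P.minus_closed[of p q] c.hom_minus[of p q] monoid_algebra_minus[OF monoid_AB, of p q] by auto
    then show ?case
      using diff h.hom_minus[of "?c p" "?c q"] h'.hom_minus[of "?c p" "?c q"] c.hom_closed by auto
  qed
  with p show ?thesis by simp
qed

end

section \<open>Endomorphism algebras\<close>

lemma endo_algebra_simps [simp]:
  "F \<otimes>\<^bsub>endo_algebra M\<^esub> G = compose (carrier M) F G"
  "\<one>\<^bsub>endo_algebra M\<^esub> = (\<lambda>v\<in>carrier M. v)"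
  "\<zero>\<^bsub>endo_algebra M\<^esub> = (\<lambda>v\<in>carrier M. \<zero>\<^bsub>M\<^esub>)"
  "F \<oplus>\<^bsub>endo_algebra M\<^esub> G = (\<lambda>v\<in>carrier M. F v \<oplus>\<^bsub>M\<^esub> G v)"
  "r \<odot>\<^bsub>endo_algebra M\<^esub> F = (\<lambda>v\<in>carrier M. r \<odot>\<^bsub>M\<^esub> F v)"
  by (simp_all add: endo_algebra_def)

lemma endo_algebra_carrierI:
  assumes "\<And>v. v \<in> carrier M \<Longrightarrow> F v \<in> carrier M" "F \<in> extensional (carrier M)"
    and "\<And>u v. u \<in> carrier M \<Longrightarrow> v \<in> carrier M \<Longrightarrow> F (u \<oplus>\<^bsub>M\<^esub> v) = F u \<oplus>\<^bsub>M\<^esub> F v"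
    and "\<And>r v. v \<in> carrier M \<Longrightarrow> F (r \<odot>\<^bsub>M\<^esub> v) = r \<odot>\<^bsub>M\<^esub> F v"
  shows "F \<in> carrier (endo_algebra M)"
  using assms by (auto simp: endo_algebra_def PiE_def)

lemma endo_algebra_carrierD:
  assumes "F \<in> carrier (endo_algebra M)"
  shows "v \<in> carrier M \<Longrightarrow> F v \<in> carrier M" "F \<in> extensional (carrier M)"
    and "u \<in> carrier M \<Longrightarrow> v \<in> carrier M \<Longrightarrow> F (u \<oplus>\<^bsub>M\<^esub> v) = F u \<oplus>\<^bsub>M\<^esub> F v"
    and "v \<in> carrier M \<Longrightarrow> F (r \<odot>\<^bsub>M\<^esub> v) = r \<odot>\<^bsub>M\<^esub> F v"
  using assms by (auto simp: endo_algebra_def PiE_def)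

lemma endo_algebra_eqI:
  assumes "F \<in> carrier (endo_algebra M)" "G \<in> carrier (endo_algebra M)"
    and "\<And>v. v \<in> carrier M \<Longrightarrow> F v = G v"
  shows "F = G"
  using assms(3) by (rule extensionalityI[OF endo_algebra_carrierD(2)[OF assms(1)] endo_algebra_carrierD(2)[OF assms(2)]])

definition endo_scalar :: "('r, 'v, 'm) module_scheme \<Rightarrow> 'r \<Rightarrow> 'v \<Rightarrow> 'v" where
  "endo_scalar M r = (\<lambda>v\<in>carrier M. r \<odot>\<^bsub>M\<^esub> v)"

locale type_module = module "ring_of_type_algebra :: 'r::comm_ring_1 ring" M
  for M :: "('r::comm_ring_1, 'v, 'm) module_scheme"
begin

lemma smult_simps:
  "v \<in> carrier M \<Longrightarrow> r \<odot>\<^bsub>M\<^esub> v \<in> carrier M"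
  "v \<in> carrier M \<Longrightarrow> (r + s) \<odot>\<^bsub>M\<^esub> v = r \<odot>\<^bsub>M\<^esub> v \<oplus>\<^bsub>M\<^esub> s \<odot>\<^bsub>M\<^esub> v"
  "u \<in> carrier M \<Longrightarrow> v \<in> carrier M \<Longrightarrow> r \<odot>\<^bsub>M\<^esub> (u \<oplus>\<^bsub>M\<^esub> v) = r \<odot>\<^bsub>M\<^esub> u \<oplus>\<^bsub>M\<^esub> r \<odot>\<^bsub>M\<^esub> v"
  "v \<in> carrier M \<Longrightarrow> (r * s) \<odot>\<^bsub>M\<^esub> v = r \<odot>\<^bsub>M\<^esub> (s \<odot>\<^bsub>M\<^esub> v)"
  "v \<in> carrier M \<Longrightarrow> 1 \<odot>\<^bsub>M\<^esub> v = v"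
  using smult_closed[of r v] smult_l_distr[of r s v] smult_r_distr[of r u v]
    smult_assoc1[of r s v] smult_one[of v] by simp_all

abbreviation E where "E \<equiv> endo_algebra M"

lemma endo_closed:
  assumes "F \<in> carrier E" "G \<in> carrier E"
  shows "compose (carrier M) F G \<in> carrier E"
    and "(\<lambda>v\<in>carrier M. F v \<oplus>\<^bsub>M\<^esub> G v) \<in> carrier E"
    and "(\<lambda>v\<in>carrier M. v) \<in> carrier E"
    and "(\<lambda>v\<in>carrier M. \<zero>\<^bsub>M\<^esub>) \<in> carrier E"
    and "(\<lambda>v\<in>carrier M. \<ominus>\<^bsub>M\<^esub> F v) \<in> carrier E"
    and "(\<lambda>v\<in>carrier M. r \<odot>\<^bsub>M\<^esub> F v) \<in> carrier E"
proof -
  note F = endo_algebra_carrierD[OF assms(1)] and G = endo_algebra_carrierD[OF assms(2)]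
  note closed = F(1) G(1) smult_simps(1)
  have smult_zero: "r \<odot>\<^bsub>M\<^esub> \<zero>\<^bsub>M\<^esub> = \<zero>\<^bsub>M\<^esub>" for r
    using smult_r_null by simp
  have smult_minus: "r \<odot>\<^bsub>M\<^esub> (\<ominus>\<^bsub>M\<^esub> v) = \<ominus>\<^bsub>M\<^esub> (r \<odot>\<^bsub>M\<^esub> v)" if "v \<in> carrier M" for r v
    using smult_r_minus that by simp
  have smult_commute: "r \<odot>\<^bsub>M\<^esub> (s \<odot>\<^bsub>M\<^esub> v) = s \<odot>\<^bsub>M\<^esub> (r \<odot>\<^bsub>M\<^esub> v)" if "v \<in> carrier M" for r s v
    using that by (simp add: smult_simps(4)[symmetric] mult.commute)
  show "compose (carrier M) F G \<in> carrier E"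
    by (rule endo_algebra_carrierI) (simp_all add: compose_eq closed F(3,4) G(3,4))
  show "(\<lambda>v\<in>carrier M. F v \<oplus>\<^bsub>M\<^esub> G v) \<in> carrier E"
    by (rule endo_algebra_carrierI) (simp_all add: closed F(3,4) G(3,4) smult_simps(3) M.a_ac)
  show "(\<lambda>v\<in>carrier M. v) \<in> carrier E"
    by (rule endo_algebra_carrierI) (simp_all add: smult_simps(1))
  show "(\<lambda>v\<in>carrier M. \<zero>\<^bsub>M\<^esub>) \<in> carrier E"
    by (rule endo_algebra_carrierI) (simp_all add: smult_simps(1) smult_zero)
  show "(\<lambda>v\<in>carrier M. \<ominus>\<^bsub>M\<^esub> F v) \<in> carrier E"
    by (rule endo_algebra_carrierI) (simp_all add: closed F(3,4) M.minus_add smult_minus)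
  show "(\<lambda>v\<in>carrier M. r \<odot>\<^bsub>M\<^esub> F v) \<in> carrier E"
    by (rule endo_algebra_carrierI) (simp_all add: closed F(3,4) smult_simps(3) smult_commute)
qed

sublocale E: ring "endo_algebra M"
proof (rule ringI)
  note D = endo_algebra_carrierD
  have one: "(\<lambda>v\<in>carrier M. v) \<in> carrier E" and zero: "(\<lambda>v\<in>carrier M. \<zero>\<^bsub>M\<^esub>) \<in> carrier E"
    by (rule endo_algebra_carrierI; use smult_r_null in \<open>simp add: smult_simps(1)\<close>)+
  show "abelian_group E"
  proof (rule abelian_groupI)
    show "\<exists>G\<in>carrier E. G \<oplus>\<^bsub>E\<^esub> F = \<zero>\<^bsub>E\<^esub>" if F: "F \<in> carrier E" for F
    proof
      show "(\<lambda>v\<in>carrier M. \<ominus>\<^bsub>M\<^esub> F v) \<oplus>\<^bsub>E\<^esub> F = \<zero>\<^bsub>E\<^esub>"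
        using D[OF F] by (auto simp: M.l_neg restrict_def fun_eq_iff)
    qed (rule endo_closed(5)[OF F F])
    show "\<zero>\<^bsub>E\<^esub> \<oplus>\<^bsub>E\<^esub> F = F" if F: "F \<in> carrier E" for F
      using endo_closed(2)[OF zero F] D(1)[OF F]
      by (intro endo_algebra_eqI[OF _ F]) (simp_all only: endo_algebra_simps restrict_apply' M.l_zero)
    show "F \<oplus>\<^bsub>E\<^esub> G \<in> carrier E" if "F \<in> carrier E" "G \<in> carrier E" for F G
      using endo_closed(2)[OF that] by simp
    show "\<zero>\<^bsub>E\<^esub> \<in> carrier E"
      using zero by simp
  qed (auto simp: D(1) M.a_ac restrict_def fun_eq_iff)
  show "Group.monoid E"
  proof (rule monoidI)
    show "F \<otimes>\<^bsub>E\<^esub> G \<otimes>\<^bsub>E\<^esub> H = F \<otimes>\<^bsub>E\<^esub> (G \<otimes>\<^bsub>E\<^esub> H)"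
      if "F \<in> carrier E" "G \<in> carrier E" "H \<in> carrier E" for F G H
      using D(1)[OF that(3)] by (simp add: compose_def restrict_def fun_eq_iff)
  next
    fix F assume F: "F \<in> carrier E"
    show "\<one>\<^bsub>E\<^esub> \<otimes>\<^bsub>E\<^esub> F = F" "F \<otimes>\<^bsub>E\<^esub> \<one>\<^bsub>E\<^esub> = F"
      by (rule endo_algebra_eqI[OF _ F]; simp add: endo_closed(1) one F compose_eq D(1)[OF F])+
  qed (simp_all add: one endo_closed)
qed (auto simp: endo_algebra_carrierD compose_def restrict_def fun_eq_iff)

lemma endo_scalar_closed: "endo_scalar M r \<in> carrier E"
  using endo_closed(6)[OF E.one_closed E.one_closed, of r]
  by (simp add: endo_scalar_def restrict_def cong: if_cong)

lemma endo_scalar_hom: "endo_scalar M \<in> ring_hom ring_of_type_algebra E"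
  by (rule ring_hom_memI)
    (simp_all add: endo_scalar_closed, auto simp: endo_scalar_def compose_def restrict_def fun_eq_iff smult_simps)

lemma endo_scalar_mult:
  assumes "F \<in> carrier E"
  shows "endo_scalar M r \<otimes>\<^bsub>E\<^esub> F = r \<odot>\<^bsub>E\<^esub> F"
  using endo_algebra_carrierD[OF assms]
  by (auto simp: endo_scalar_def compose_def restrict_def fun_eq_iff)

text \<open>Scalars are central among linear endomorphisms. This supplies the commutation hypotheses
  of both universal properties.\<close>

lemma endo_scalar_commute:
  assumes "F \<in> carrier E"
  shows "F \<otimes>\<^bsub>E\<^esub> endo_scalar M r = endo_scalar M r \<otimes>\<^bsub>E\<^esub> F"
  using endo_algebra_carrierD[OF assms]
  by (auto simp: endo_scalar_def compose_def restrict_def fun_eq_iff)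

end

section \<open>Representations of the blob algebra\<close>

lemma (in tensor_of_algebras) pure_tensor_right_hom:
  "pure_tensor A B \<one>\<^bsub>A\<^esub> \<in> ring_hom B (tensor_algebra A B)"
  by (rule ring_hom_memI)
    (simp_all add: pure_tensor_closed pure_tensor_mult pure_tensor_add_right pure_tensor_one)

lemma monoid_free_monoid: "Group.monoid (free_monoid G)"
  by (rule monoidI) (auto simp: free_monoid_def)

lemma free_monoid_simps [simp]:
  "carrier (free_monoid G) = lists G"
  "v \<otimes>\<^bsub>free_monoid G\<^esub> w = v @ w"
  "\<one>\<^bsub>free_monoid G\<^esub> = []"
  by (simp_all add: free_monoid_def)

lemma blob_gens_iff [simp]:
  "Gen_e \<in> blob_gens n" "Gen_f \<in> blob_gens n" "Gen_U i \<in> blob_gens n \<longleftrightarrow> i \<in> {1..<n}"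
  by (auto simp: blob_gens_def)

lemma blob_IJ_closed: "set (blob_I n) \<subseteq> blob_gens n" "set (blob_J n) \<subseteq> blob_gens n"
  by (auto simp: blob_I_def blob_J_def)

lemma blob_relations_closed: "blob_relations n \<subseteq> carrier (blob_free n)"
proof
  fix p assume "p \<in> blob_relations n"
  then show "p \<in> carrier (blob_free n)"
    by (induction rule: blob_relations.induct)
      (use blob_IJ_closed[of n] in \<open>auto dest!: subsetD[OF keys_diff] split: if_splits\<close>)
qed

lemma ring_blob_free: "ring (blob_free n :: (blob_gen list \<Rightarrow>\<^sub>0 param_ring) ring)"
  by (rule ring_monoid_algebra[OF monoid_free_monoid])

lemma ideal_blob_ideal: "ideal (blob_ideal n) (blob_free n)"
  unfolding blob_ideal_def
  by (rule ring.genideal_ideal[OF ring_blob_free blob_relations_closed])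

lemma ring_symplectic_blob: "ring (symplectic_blob n)"
  unfolding symplectic_blob_def
  by (rule ring_algebra_via[OF ideal.quotient_is_ring[OF ideal_blob_ideal]])

lemma carrier_symplectic_blob: "carrier (symplectic_blob n) = blob_class n ` carrier (blob_free n)"
  by (simp add: symplectic_blob_def carrier_Quot blob_class_def[abs_def])

lemma blob_class_hom: "blob_class n \<in> ring_hom (blob_free n) (symplectic_blob n)"
  using ideal.rcos_ring_hom[OF ideal_blob_ideal, of n]
  by (simp add: ring_hom_def symplectic_blob_def blob_class_def[abs_def])

lemma smult_symplectic_blob:
  "r \<odot>\<^bsub>symplectic_blob n\<^esub> x = blob_class n (r \<cdot> []) \<otimes>\<^bsub>symplectic_blob n\<^esub> x"
  by (simp add: symplectic_blob_def)

lemma blob_class_scalar_closed: "blob_class n (r \<cdot> []) \<in> carrier (symplectic_blob n)"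
  by (rule ring_hom_closed[OF blob_class_hom]) simp

lemma tensor_ring_via_blob:
  fixes \<theta> :: "param_ring \<Rightarrow> 'a::comm_ring_1"
  shows "tensor_of_algebras (ring_via \<theta>) (symplectic_blob n)"
proof -
  interpret A: ring "ring_via \<theta>"
    by (rule ring_algebra_via) (rule ring_from_type_algebra)
  interpret B: ring "symplectic_blob n"
    by (rule ring_symplectic_blob)
  show ?thesis
    by unfold_locales (simp_all add: smult_symplectic_blob blob_class_scalar_closed)
qed

text \<open>The module and the assignment \<open>R\<close> are arbitrary here: the criterion for
  extending an assignment of the generators does not depend on particular operators. Those of the
  theorem enter in \<open>R_assignment\<close>.\<close>

locale blob_assignment = type_module M
  for M :: "('a::comm_ring_1, 'v, 'm) module_scheme" +
  fixes n :: nat and \<theta> :: "param_ring \<Rightarrow> 'a" and R :: "blob_gen \<Rightarrow> 'v \<Rightarrow> 'v"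
  assumes \<theta>_hom: "\<theta> \<in> ring_hom ring_of_type_algebra ring_of_type_algebra"
    and R_closed: "g \<in> blob_gens n \<Longrightarrow> R g \<in> carrier (endo_algebra M)"
begin

sublocale T: tensor_of_algebras "ring_via \<theta>" "symplectic_blob n"
  by (rule tensor_ring_via_blob)

definition word_op :: "blob_gen list \<Rightarrow> 'v \<Rightarrow> 'v" where
  "word_op w = foldr (\<lambda>g F. R g \<otimes>\<^bsub>E\<^esub> F) w \<one>\<^bsub>E\<^esub>"

lemma word_op_simps: "word_op [] = \<one>\<^bsub>E\<^esub>" "word_op (g # w) = R g \<otimes>\<^bsub>E\<^esub> word_op w"
  by (simp_all add: word_op_def)

lemma word_op_closed: "w \<in> lists (blob_gens n) \<Longrightarrow> word_op w \<in> carrier E"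
  by (induction w) (use E.one_closed E.m_closed R_closed in \<open>auto simp: word_op_simps simp del: endo_algebra_simps\<close>)

lemma word_op_append:
  assumes "v \<in> lists (blob_gens n)" "w \<in> lists (blob_gens n)"
  shows "word_op (v @ w) = word_op v \<otimes>\<^bsub>E\<^esub> word_op w"
  using assms
  by (induction v)
    (simp_all add: word_op_simps word_op_closed E.m_assoc R_closed del: endo_algebra_simps)

definition scalar :: "param_ring \<Rightarrow> 'v \<Rightarrow> 'v" where
  "scalar r = endo_scalar M (\<theta> r)"

lemma scalar_hom: "scalar \<in> ring_hom ring_of_type_algebra E"
  using ring_hom_trans[OF \<theta>_hom endo_scalar_hom] by (simp add: scalar_def[abs_def] comp_def)

lemma scalar_closed: "scalar r \<in> carrier E"
  by (simp add: scalar_def endo_scalar_closed)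

definition free_hom :: "(blob_gen list \<Rightarrow>\<^sub>0 param_ring) \<Rightarrow> 'v \<Rightarrow> 'v" where
  "free_hom = monoid_algebra_ext E scalar word_op"

lemma free_hom: "free_hom \<in> ring_hom (blob_free n) E"
  and free_hom_single: "w \<in> lists (blob_gens n) \<Longrightarrow> free_hom (r \<cdot> w) = scalar r \<otimes>\<^bsub>E\<^esub> word_op w"
proof -
  have comm: "word_op w \<otimes>\<^bsub>E\<^esub> scalar r = scalar r \<otimes>\<^bsub>E\<^esub> word_op w" if "w \<in> lists (blob_gens n)" for w r
    unfolding scalar_def by (rule endo_scalar_commute[OF word_op_closed[OF that]])
  show "free_hom \<in> ring_hom (blob_free n) E"
    unfolding free_hom_def
    by (rule monoid_algebra_ext_hom(1)[OF monoid_free_monoid E.ring_axioms scalar_hom])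
      (simp_all add: word_op_closed word_op_append comm word_op_simps(1) del: endo_algebra_simps)
  show "free_hom (r \<cdot> w) = scalar r \<otimes>\<^bsub>E\<^esub> word_op w" if "w \<in> lists (blob_gens n)"
    unfolding free_hom_def
    by (rule monoid_algebra_ext_hom(2)[OF monoid_free_monoid E.ring_axioms scalar_hom])
      (use that in \<open>simp_all add: word_op_closed word_op_append comm word_op_simps(1) del: endo_algebra_simps\<close>)
qed

abbreviation BC where "BC \<equiv> blob_base_change n \<theta>"

abbreviation embed where
  "embed p \<equiv> pure_tensor (ring_via \<theta>) (symplectic_blob n) 1 (blob_class n p)"

lemma BC_carrier: "carrier BC = carrier (tensor_algebra (ring_via \<theta>) (symplectic_blob n))"
  by (simp add: blob_base_change_def base_change_def)

lemma BC_ring_hom: "ring_hom BC S = ring_hom (tensor_algebra (ring_via \<theta>) (symplectic_blob n)) S"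
  by (simp add: blob_base_change_def base_change_def ring_hom_def)

lemma smult_BC:
  "a \<odot>\<^bsub>BC\<^esub> t = pure_tensor (ring_via \<theta>) (symplectic_blob n) a \<one>\<^bsub>symplectic_blob n\<^esub>
     \<otimes>\<^bsub>tensor_algebra (ring_via \<theta>) (symplectic_blob n)\<^esub> t"
  by (simp add: blob_base_change_def base_change_def)

lemma embed_hom: "(\<lambda>p. embed p) \<in> ring_hom (blob_free n) (tensor_algebra (ring_via \<theta>) (symplectic_blob n))"
  using ring_hom_trans[OF blob_class_hom[of n] T.pure_tensor_right_hom] by (simp add: comp_def)

lemma smult_embed:
  assumes "p \<in> carrier (blob_free n)"
  shows "pure_tensor (ring_via \<theta>) (symplectic_blob n) a (blob_class n p) = a \<odot>\<^bsub>BC\<^esub> embed p"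
  using assms ring_hom_closed[OF blob_class_hom, of p n] T.B.one_closed
  by (simp add: smult_BC T.pure_tensor_mult del: monoid_algebra_simps)

lemma blob_class_one: "blob_class n (1 \<cdot> []) = \<one>\<^bsub>symplectic_blob n\<^esub>"
  using ring_hom_one[OF blob_class_hom[of n]] by simp

text \<open>Balancing moves \<open>r\<close> from the right factor, where it acts through the blob
  algebra, to the left one, where it acts as \<open>\<theta> r\<close>.\<close>

lemma embed_scalar: "embed (r \<cdot> []) = \<theta> r \<odot>\<^bsub>BC\<^esub> embed (1 \<cdot> [])"
proof -
  have "embed (r \<cdot> []) = pure_tensor (ring_via \<theta>) (symplectic_blob n) 1
      (r \<odot>\<^bsub>symplectic_blob n\<^esub> \<one>\<^bsub>symplectic_blob n\<^esub>)"
    by (simp add: smult_symplectic_blob blob_class_scalar_closed)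
  also have "\<dots> = pure_tensor (ring_via \<theta>) (symplectic_blob n) (\<theta> r) \<one>\<^bsub>symplectic_blob n\<^esub>"
    using T.pure_tensor_balanced[of 1 "\<one>\<^bsub>symplectic_blob n\<^esub>" r] by simp
  also have "\<dots> = \<theta> r \<odot>\<^bsub>BC\<^esub> embed (1 \<cdot> [])"
    using smult_embed[of "1 \<cdot> []" "\<theta> r"] by (simp add: blob_class_one)
  finally show ?thesis .
qed

text \<open>On scalars this is \<open>embed_scalar\<close> with the linearity of \<rho>, on letters
  it is \<open>gens\<close>; words and sums follow as both sides are ring homomorphisms. Uniqueness
  and the necessity of the relations both rest on it.\<close>

lemma representation_embed:
  assumes \<rho>: "\<rho> \<in> algebra_hom BC E"
    and gens: "\<And>g. g \<in> blob_gens n \<Longrightarrow> \<rho> (blob_gen_image n \<theta> g) = R g"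
    and p: "p \<in> carrier (blob_free n)"
  shows "\<rho> (embed p) = free_hom p"
proof -
  let ?T = "tensor_algebra (ring_via \<theta>) (symplectic_blob n)"
  have \<rho>_hom: "\<rho> \<in> ring_hom ?T E"
    using \<rho> by (simp add: algebra_hom_def BC_ring_hom)
  have \<rho>_smult: "\<rho> (a \<odot>\<^bsub>BC\<^esub> t) = a \<odot>\<^bsub>E\<^esub> \<rho> t" if "t \<in> carrier ?T" for a t
    using \<rho> that by (simp add: algebra_hom_def BC_carrier del: endo_algebra_simps)
  define h where "h = (\<lambda>p. \<rho> (embed p))"
  have h: "h \<in> ring_hom (blob_free n) E"
    using ring_hom_trans[OF embed_hom \<rho>_hom] by (simp add: comp_def h_def)
  have h_one: "h (1 \<cdot> []) = \<one>\<^bsub>E\<^esub>"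
    using ring_hom_one[OF h] by simp
  have h_scalar: "h (r \<cdot> []) = scalar r" for r
  proof -
    have "h (r \<cdot> []) = \<theta> r \<odot>\<^bsub>E\<^esub> h (1 \<cdot> [])"
      using ring_hom_closed[OF embed_hom, of "1 \<cdot> []"]
      by (simp add: h_def embed_scalar[of r] \<rho>_smult del: endo_algebra_simps)
    then show ?thesis
      using endo_scalar_mult[OF E.one_closed, of "\<theta> r"] E.r_one[OF scalar_closed[of r]]
      by (simp add: h_one scalar_def del: endo_algebra_simps)
  qed
  have h_word: "h (1 \<cdot> w) = word_op w" if "w \<in> lists (blob_gens n)" for w
    using that
  proof (induction w)
    case Nil
    then show ?case by (simp add: h_one word_op_simps del: endo_algebra_simps)
  next
    case (Cons g w)
    have "h (1 \<cdot> [g] \<otimes>\<^bsub>blob_free n\<^esub> 1 \<cdot> w) = h (1 \<cdot> [g]) \<otimes>\<^bsub>E\<^esub> h (1 \<cdot> w)"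
      using Cons by (intro ring_hom_mult[OF h]) auto
    then show ?case
      using Cons gens[of g] by (simp add: word_op_simps h_def blob_gen_image_def del: endo_algebra_simps)
  qed
  have h_single: "h (r \<cdot> w) = free_hom (r \<cdot> w)" if w: "w \<in> lists (blob_gens n)" for r w
  proof -
    have "h (r \<cdot> [] \<otimes>\<^bsub>blob_free n\<^esub> 1 \<cdot> w) = h (r \<cdot> []) \<otimes>\<^bsub>E\<^esub> h (1 \<cdot> w)"
      using w by (intro ring_hom_mult[OF h]) auto
    then show ?thesis
      using w by (simp add: free_hom_single h_scalar h_word del: endo_algebra_simps)
  qed
  interpret F: ring "blob_free n" by (rule ring_blob_free)
  interpret h: ring_hom_ring "blob_free n" E h by (rule ring_hom_ringI2[OF F.ring_axioms E.ring_axioms h])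
  interpret f: ring_hom_ring "blob_free n" E free_hom
    by (rule ring_hom_ringI2[OF F.ring_axioms E.ring_axioms free_hom])
  from p have "Poly_Mapping.keys p \<subseteq> lists (blob_gens n)" by simp
  then have "h p = free_hom p"
  proof (induction p rule: poly_mapping_keys_induct)
    case zero
    then show ?case using h.hom_zero f.hom_zero by simp
  next
    case (single w r)
    then show ?case by (rule h_single)
  next
    case (add p q)
    then show ?case using h.hom_add[of p q] f.hom_add[of p q] by simp
  qed
  then show ?thesis by (simp add: h_def)
qed

lemma representation_unique:
  assumes "\<rho> \<in> representations BC M" "\<And>g. g \<in> blob_gens n \<Longrightarrow> \<rho> (blob_gen_image n \<theta> g) = R g"
    and "\<rho>' \<in> representations BC M" "\<And>g. g \<in> blob_gens n \<Longrightarrow> \<rho>' (blob_gen_image n \<theta> g) = R g"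
  shows "\<rho> = \<rho>'"
proof (rule extensionalityI)
  show "\<rho> \<in> extensional (carrier BC)" "\<rho>' \<in> extensional (carrier BC)"
    using assms by (simp_all add: representations_def)
  let ?T = "tensor_algebra (ring_via \<theta>) (symplectic_blob n)"
  have hom: "\<rho> \<in> algebra_hom BC E" "\<rho>' \<in> algebra_hom BC E"
    using assms by (simp_all add: representations_def)
  then have ring_hom: "\<rho> \<in> ring_hom ?T E" "\<rho>' \<in> ring_hom ?T E"
    by (simp_all add: algebra_hom_def BC_ring_hom)
  fix t assume t: "t \<in> carrier BC"
  show "\<rho> t = \<rho>' t"
  proof (rule T.tensor_algebra_hom_eqI[OF E.ring_axioms ring_hom])
    show "t \<in> carrier ?T" using t by (simp add: BC_carrier)
    fix a b assume "b \<in> carrier (symplectic_blob n)"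
    then obtain p where p: "p \<in> carrier (blob_free n)" "b = blob_class n p"
      unfolding carrier_symplectic_blob by blast
    have "embed p \<in> carrier BC"
      using ring_hom_closed[OF embed_hom p(1)] by (simp add: BC_carrier)
    then have "\<sigma> (pure_tensor (ring_via \<theta>) (symplectic_blob n) a b) = a \<odot>\<^bsub>E\<^esub> \<sigma> (embed p)"
      if "\<sigma> \<in> algebra_hom BC E" for \<sigma>
      using that unfolding p(2) smult_embed[OF p(1), of a]
      by (simp add: algebra_hom_def del: endo_algebra_simps)
    with hom show "\<rho> (pure_tensor (ring_via \<theta>) (symplectic_blob n) a b)
      = \<rho>' (pure_tensor (ring_via \<theta>) (symplectic_blob n) a b)"
      using representation_embed[OF hom(1) assms(2) p(1)] representation_embed[OF hom(2) assms(4) p(1)]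
      by (simp del: endo_algebra_simps)
  qed
qed

lemma representation_relations:
  assumes \<rho>: "\<rho> \<in> representations BC M"
    and gens: "\<And>g. g \<in> blob_gens n \<Longrightarrow> \<rho> (blob_gen_image n \<theta> g) = R g"
    and p: "p \<in> blob_relations n"
  shows "free_hom p = \<zero>\<^bsub>E\<^esub>"
proof -
  interpret F: ring "blob_free n" by (rule ring_blob_free)
  interpret I: ideal "blob_ideal n" "blob_free n" by (rule ideal_blob_ideal)
  interpret f: ring_hom_ring "blob_free n" E free_hom
    by (rule ring_hom_ringI2[OF F.ring_axioms E.ring_axioms free_hom])
  have hom: "\<rho> \<in> algebra_hom BC E"
    using \<rho> by (simp add: representations_def)
  have pc: "p \<in> carrier (blob_free n)"
    using p blob_relations_closed by blast
  have "p \<in> blob_ideal n"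
    using p F.genideal_self[OF blob_relations_closed] by (auto simp: blob_ideal_def)
  then have "blob_class n p = blob_class n \<zero>\<^bsub>blob_free n\<^esub>"
    unfolding blob_class_def using I.a_rcos_const I.zero_closed by metis
  then have "\<rho> (embed p) = \<rho> (embed \<zero>\<^bsub>blob_free n\<^esub>)"
    by simp
  then show ?thesis
    using representation_embed[OF hom gens pc] representation_embed[OF hom gens F.zero_closed]
      f.hom_zero by simp
qed

text \<open>By \<open>rel\<close>, \<open>free_hom\<close> factors through the quotient. The result
  is paired with the scalar endomorphisms; the two commute and agree on the ground ring via
  \<theta>, so they define a homomorphism on the tensor product.\<close>

lemma representation_exists:
  assumes rel: "\<And>p. p \<in> blob_relations n \<Longrightarrow> free_hom p = \<zero>\<^bsub>E\<^esub>"
  obtains \<rho> where "\<rho> \<in> representations BC M" "\<And>g. g \<in> blob_gens n \<Longrightarrow> \<rho> (blob_gen_image n \<theta> g) = R g"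
proof -
  let ?T = "tensor_algebra (ring_via \<theta>) (symplectic_blob n)"
  interpret F: ring "blob_free n" by (rule ring_blob_free)
  obtain k where k: "k \<in> ring_hom (blob_free n Quot blob_ideal n) E"
    and k_class: "\<And>p. p \<in> carrier (blob_free n) \<Longrightarrow> k (blob_class n p) = free_hom p"
    using quotient_hom_ext[OF F.ring_axioms E.ring_axioms free_hom blob_relations_closed rel]
    unfolding blob_ideal_def blob_class_def by metis
  have k: "k \<in> ring_hom (symplectic_blob n) E"
    using k by (simp add: symplectic_blob_def ring_hom_def)
  have \<alpha>: "endo_scalar M \<in> ring_hom (ring_via \<theta>) E"
    using endo_scalar_hom by (simp add: ring_hom_def)
  have k_scalar: "k (blob_class n (r \<cdot> [])) = scalar r" for r
    using free_hom_single[of "[]" r] E.r_one[OF scalar_closed]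
    by (simp add: k_class word_op_simps del: endo_algebra_simps)
  obtain h where h: "h \<in> ring_hom ?T E"
    and h_pure: "\<And>a b. b \<in> carrier (symplectic_blob n) \<Longrightarrow>
      h (pure_tensor (ring_via \<theta>) (symplectic_blob n) a b) = endo_scalar M a \<otimes>\<^bsub>E\<^esub> k b"
  proof (rule T.tensor_algebra_hom_ext[OF E.ring_axioms \<alpha> k])
    fix a b assume b: "b \<in> carrier (symplectic_blob n)"
    show "k b \<otimes>\<^bsub>E\<^esub> endo_scalar M a = endo_scalar M a \<otimes>\<^bsub>E\<^esub> k b"
      by (rule endo_scalar_commute[OF ring_hom_closed[OF k b]])
    fix r
    have "endo_scalar M (\<theta> r * a) = endo_scalar M a \<otimes>\<^bsub>E\<^esub> endo_scalar M (\<theta> r)"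
      using ring_hom_mult[OF endo_scalar_hom, of a "\<theta> r"] by (simp add: mult.commute del: endo_algebra_simps)
    moreover have "k (r \<odot>\<^bsub>symplectic_blob n\<^esub> b) = endo_scalar M (\<theta> r) \<otimes>\<^bsub>E\<^esub> k b"
      using ring_hom_mult[OF k blob_class_scalar_closed b] k_scalar[of r]
      by (simp add: smult_symplectic_blob scalar_def del: endo_algebra_simps)
    ultimately show "endo_scalar M (r \<odot>\<^bsub>ring_via \<theta>\<^esub> a) \<otimes>\<^bsub>E\<^esub> k b
        = endo_scalar M a \<otimes>\<^bsub>E\<^esub> k (r \<odot>\<^bsub>symplectic_blob n\<^esub> b)"
      by (simp add: E.m_assoc endo_scalar_closed ring_hom_closed[OF k b] del: endo_algebra_simps)
  qed (simp_all add: that)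
  \<comment> \<open>\<open>representations\<close> consists of extensional functions, which turns
    uniqueness into an equality of functions.\<close>
  define \<rho> where "\<rho> = restrict h (carrier BC)"
  have BC_ring: "ring BC"
    unfolding blob_base_change_def base_change_def by (rule ring_algebra_via[OF T.ring_tensor_algebra])
  interpret BC: ring BC by (rule BC_ring)
  interpret TT: ring ?T by (rule T.ring_tensor_algebra)
  have h_one: "endo_scalar M 1 = \<one>\<^bsub>E\<^esub>" "k \<one>\<^bsub>symplectic_blob n\<^esub> = \<one>\<^bsub>E\<^esub>"
    using ring_hom_one[OF \<alpha>] ring_hom_one[OF k] by (simp_all del: endo_algebra_simps)
  have smult_closed: "a \<odot>\<^bsub>BC\<^esub> t \<in> carrier BC" if "t \<in> carrier BC" for a t
    using that T.pure_tensor_closed[of a "\<one>\<^bsub>symplectic_blob n\<^esub>"] T.B.one_closed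
    by (simp add: smult_BC BC_carrier)
  have "\<rho> \<in> ring_hom BC E"
    using h BC.m_closed BC.a_closed BC.one_closed
    unfolding \<rho>_def BC_ring_hom[symmetric] by (simp add: ring_hom_def Pi_iff del: endo_algebra_simps)
  moreover have "\<rho> (a \<odot>\<^bsub>BC\<^esub> t) = a \<odot>\<^bsub>E\<^esub> \<rho> t" if t: "t \<in> carrier BC" for a t
  proof -
    have t': "t \<in> carrier ?T" using t by (simp add: BC_carrier)
    have "h (a \<odot>\<^bsub>BC\<^esub> t) = h (pure_tensor (ring_via \<theta>) (symplectic_blob n) a \<one>\<^bsub>symplectic_blob n\<^esub>) \<otimes>\<^bsub>E\<^esub> h t"
      unfolding smult_BC using T.B.one_closed t' by (intro ring_hom_mult[OF h] T.pure_tensor_closed) simp_all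
    also have "\<dots> = endo_scalar M a \<otimes>\<^bsub>E\<^esub> h t"
      using h_one E.r_one[OF endo_scalar_closed] by (simp add: h_pure del: endo_algebra_simps)
    also have "\<dots> = a \<odot>\<^bsub>E\<^esub> h t"
      by (rule endo_scalar_mult[OF ring_hom_closed[OF h t']])
    finally show ?thesis
      using t smult_closed by (simp add: \<rho>_def del: endo_algebra_simps)
  qed
  ultimately have "\<rho> \<in> representations BC M"
    by (simp add: representations_def algebra_hom_def \<rho>_def del: endo_algebra_simps)
  moreover have "\<rho> (blob_gen_image n \<theta> g) = R g" if g: "g \<in> blob_gens n" for g
  proof -
    have p: "1 \<cdot> [g] \<in> carrier (blob_free n)"
      using g by simp
    note c = ring_hom_closed[OF blob_class_hom p]
    have "scalar 1 = \<one>\<^bsub>E\<^esub>"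
      using ring_hom_one[OF scalar_hom] by simp
    then have "free_hom (1 \<cdot> [g]) = R g"
      using free_hom_single[of "[g]" 1] g R_closed[OF g]
      by (simp add: word_op_simps E.r_one E.l_one del: endo_algebra_simps)
    then have "h (embed (1 \<cdot> [g])) = R g"
      using h_pure[OF c, of 1] k_class[OF p] R_closed[OF g] E.l_one
      by (simp add: h_one(1) del: endo_algebra_simps)
    moreover have "embed (1 \<cdot> [g]) \<in> carrier BC"
      using ring_hom_closed[OF embed_hom p] by (simp add: BC_carrier)
    ultimately show ?thesis
      by (simp add: \<rho>_def blob_gen_image_def)
  qed
  ultimately show ?thesis by (rule that)
qed

lemma ex1_representation_iff:
  "(\<exists>!\<rho>. \<rho> \<in> representations BC M \<and> (\<forall>g\<in>blob_gens n. \<rho> (blob_gen_image n \<theta> g) = R g))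
    \<longleftrightarrow> (\<forall>p\<in>blob_relations n. free_hom p = \<zero>\<^bsub>E\<^esub>)"
proof
  assume "\<exists>!\<rho>. \<rho> \<in> representations BC M \<and> (\<forall>g\<in>blob_gens n. \<rho> (blob_gen_image n \<theta> g) = R g)"
  then show "\<forall>p\<in>blob_relations n. free_hom p = \<zero>\<^bsub>E\<^esub>"
    using representation_relations by blast
next
  assume "\<forall>p\<in>blob_relations n. free_hom p = \<zero>\<^bsub>E\<^esub>"
  then obtain \<rho> where "\<rho> \<in> representations BC M" "\<And>g. g \<in> blob_gens n \<Longrightarrow> \<rho> (blob_gen_image n \<theta> g) = R g"
    using representation_exists by blast
  then show "\<exists>!\<rho>. \<rho> \<in> representations BC M \<and> (\<forall>g\<in>blob_gens n. \<rho> (blob_gen_image n \<theta> g) = R g)"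
    using representation_unique by blast
qed

lemma free_hom_relation_iff:
  assumes "v \<in> lists (blob_gens n)" "w \<in> lists (blob_gens n)"
  shows "free_hom (r \<cdot> v - s \<cdot> w) = \<zero>\<^bsub>E\<^esub> \<longleftrightarrow> scalar r \<otimes>\<^bsub>E\<^esub> word_op v = scalar s \<otimes>\<^bsub>E\<^esub> word_op w"
proof -
  interpret F: ring "blob_free n" by (rule ring_blob_free)
  interpret f: ring_hom_ring "blob_free n" E free_hom
    by (rule ring_hom_ringI2[OF F.ring_axioms E.ring_axioms free_hom])
  have eq: "free_hom (r \<cdot> v - s \<cdot> w) = free_hom (r \<cdot> v) \<ominus>\<^bsub>E\<^esub> free_hom (s \<cdot> w)"
    using assms f.hom_minus[of "r \<cdot> v" "s \<cdot> w"]
      monoid_algebra_minus[OF monoid_free_monoid, of "r \<cdot> v" "blob_gens n" "s \<cdot> w"] by simp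
  have "free_hom (r \<cdot> v) \<ominus>\<^bsub>E\<^esub> free_hom (s \<cdot> w) = \<zero>\<^bsub>E\<^esub> \<longleftrightarrow> free_hom (r \<cdot> v) = free_hom (s \<cdot> w)"
    using assms by (intro E.r_right_minus_eq f.hom_closed) auto
  with eq show ?thesis
    using assms by (simp add: free_hom_single del: endo_algebra_simps)
qed

end

section \<open>Operators on pairs of positions\<close>

text \<open>Units come with a named inverse; these rules let the simplifier cancel them inside
  products associated to the right.\<close>

lemma mult_inverse_cancel:
  fixes q q' :: "'a::comm_ring_1"
  assumes "q * q' = 1"
  shows "q' * q = 1" "q * (q' * t) = t" "q' * (q * t) = t"
proof -
  show "q' * q = 1"
    using assms by (simp add: mult.commute)
  then show "q * (q' * t) = t" "q' * (q * t) = t"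
    using assms by (simp_all flip: mult.assoc)
qed

text \<open>A word is encoded by the set of positions carrying the letter \<open>1\<close>, a vector by its
  coefficients. The operator \<open>R\<^sup>q\<close> on the positions \<open>i, j\<close> becomes \<open>pair_op q (1/q) i j\<close>.\<close>

definition pair_op ::
  "'a \<Rightarrow> 'a \<Rightarrow> 'i \<Rightarrow> 'i \<Rightarrow> (('i \<Rightarrow> bool) \<Rightarrow> 'a::comm_ring_1) \<Rightarrow> ('i \<Rightarrow> bool) \<Rightarrow> 'a" where
  "pair_op q q' i j f b =
     (if b i = b j then 0
      else (if b i then q else q') * f b + f (b(i := \<not> b i, j := \<not> b j)))"

lemma pair_op_scale: "pair_op q q' i j (\<lambda>b. c * f b) = (\<lambda>b. c * pair_op q q' i j f b)"
  by (simp add: pair_op_def fun_eq_iff algebra_simps)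

text \<open>On the span of 12 and 21 the matrix is ((q, 1), (1, q')), with determinant 0 and trace q
  + q'.\<close>

lemma pair_op_square:
  assumes "q * q' = 1" "i \<noteq> j"
  shows "pair_op q q' i j (pair_op q q' i j f) = (\<lambda>b. (q + q') * pair_op q q' i j f b)"
proof
  fix b
  show "pair_op q q' i j (pair_op q q' i j f) b = (q + q') * pair_op q q' i j f b"
    using assms
    by (cases "b i"; cases "b j")
      (simp_all add: pair_op_def fun_upd_twist fun_upd_idem algebra_simps mult_inverse_cancel[OF assms(1)])
qed

lemma pair_op_commute:
  assumes "i \<noteq> j" "k \<noteq> l" "{i, j} \<inter> {k, l} = {}"
  shows "pair_op q q' i j (pair_op r r' k l f) = pair_op r r' k l (pair_op q q' i j f)"
proof
  fix b
  have "i \<noteq> k" "i \<noteq> l" "j \<noteq> k" "j \<noteq> l"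
    using assms by auto
  then show "pair_op q q' i j (pair_op r r' k l f) b = pair_op r r' k l (pair_op q q' i j f) b"
    using assms(1,2)
    by (cases "b i"; cases "b j"; cases "b k"; cases "b l")
      (simp_all add: pair_op_def fun_upd_twist fun_upd_idem algebra_simps)
qed

text \<open>This is the Temperley-Lieb relation. Both pairs carry the same parameter: if the letters
  at two overlapping pairs alternate, the diagonal entry q of one meets the entry q' of the other,
  and they cancel.\<close>

lemma pair_op_braid:
  assumes "q * q' = 1" "distinct [i, j, k]"
  shows "pair_op q q' i j (pair_op q q' j k (pair_op q q' i j f)) = pair_op q q' i j f"
    and "pair_op q q' j k (pair_op q q' i j (pair_op q q' j k f)) = pair_op q q' j k f"
proof -
  have ne: "i \<noteq> j" "j \<noteq> i" "i \<noteq> k" "k \<noteq> i" "j \<noteq> k" "k \<noteq> j"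
    using assms(2) by auto
  show "pair_op q q' i j (pair_op q q' j k (pair_op q q' i j f)) = pair_op q q' i j f"
  proof
    fix b
    show "pair_op q q' i j (pair_op q q' j k (pair_op q q' i j f)) b = pair_op q q' i j f b"
      using assms(1) ne
      by (cases "b i"; cases "b j"; cases "b k")
        (simp_all add: pair_op_def fun_upd_twist fun_upd_idem algebra_simps mult_inverse_cancel[OF assms(1)])
  qed
  show "pair_op q q' j k (pair_op q q' i j (pair_op q q' j k f)) = pair_op q q' j k f"
  proof
    fix b
    show "pair_op q q' j k (pair_op q q' i j (pair_op q q' j k f)) b = pair_op q q' j k f b"
      using assms(1) ne
      by (cases "b i"; cases "b j"; cases "b k")
        (simp_all add: pair_op_def fun_upd_twist fun_upd_idem algebra_simps mult_inverse_cancel[OF assms(1)])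
  qed
qed

text \<open>The outer operators have rank one on the four positions together, so the scalar is a
  trace. A flip of \<open>j\<close> and \<open>k\<close> alone breaks both outer pairs, hence only
  diagonal entries of the middle operator count: x' at 1212, against a b, and x at 2121, against a'
  b'.\<close>

lemma pair_op_arc:
  assumes "a * a' = 1" "b * b' = 1" "distinct [i, j, k, l]"
  shows "pair_op a a' i j (pair_op b b' k l (pair_op x x' j k (pair_op a a' i j (pair_op b b' k l f))))
    = (\<lambda>\<beta>. (a * b * x' + x * a' * b') * pair_op a a' i j (pair_op b b' k l f) \<beta>)"
proof
  fix \<beta>
  have ne: "i \<noteq> j" "j \<noteq> i" "i \<noteq> k" "k \<noteq> i" "j \<noteq> k" "k \<noteq> j"
    "i \<noteq> l" "l \<noteq> i" "j \<noteq> l" "l \<noteq> j" "k \<noteq> l" "l \<noteq> k"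
    using assms(3) by auto
  show "pair_op a a' i j (pair_op b b' k l (pair_op x x' j k (pair_op a a' i j (pair_op b b' k l f)))) \<beta>
    = (a * b * x' + x * a' * b') * pair_op a a' i j (pair_op b b' k l f) \<beta>"
    using assms(1,2) ne
    by (cases "\<beta> i"; cases "\<beta> j"; cases "\<beta> k"; cases "\<beta> l")
      (simp_all add: pair_op_def fun_upd_twist fun_upd_idem algebra_simps
        mult_inverse_cancel[OF assms(1)] mult_inverse_cancel[OF assms(2)])
qed

section \<open>Products of pair operators over a matching\<close>

definition pairs_op ::
  "('i \<Rightarrow> 'a) \<Rightarrow> ('i \<Rightarrow> 'a) \<Rightarrow> ('i \<Rightarrow> 'i) \<Rightarrow> 'i list \<Rightarrow> (('i \<Rightarrow> bool) \<Rightarrow> 'a::comm_ring_1) \<Rightarrow> ('i \<Rightarrow> bool) \<Rightarrow> 'a" where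
  "pairs_op q q' s ps = foldr (\<lambda>p. pair_op (q p) (q' p) p (s p)) ps"

lemma pairs_op_simps [simp]:
  "pairs_op q q' s [] f = f"
  "pairs_op q q' s (p # ps) f = pair_op (q p) (q' p) p (s p) (pairs_op q q' s ps f)"
  "pairs_op q q' s (ps @ rs) f = pairs_op q q' s ps (pairs_op q q' s rs f)"
  by (simp_all add: pairs_op_def)

text \<open>Inequality of truth values is exclusive or: exactly the positions in pairs with left end
  in \<open>S\<close> are flipped.\<close>

definition flip_pairs :: "('i \<Rightarrow> 'i) \<Rightarrow> 'i set \<Rightarrow> ('i \<Rightarrow> bool) \<Rightarrow> 'i \<Rightarrow> bool" where
  "flip_pairs s S b k = (b k \<noteq> (k \<in> S \<union> s ` S))"

locale matching =
  fixes s :: "'i \<Rightarrow> 'i" and P :: "'i set"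
  assumes disjoint: "s ` P \<inter> P = {}" and inj: "inj_on s P"
begin

lemma s_notin: "p \<in> P \<Longrightarrow> s p \<notin> P" "p \<in> P \<Longrightarrow> r \<in> P \<Longrightarrow> s p \<noteq> r" "p \<in> P \<Longrightarrow> r \<in> P \<Longrightarrow> r \<noteq> s p"
  using disjoint by auto

lemma flip_empty [simp]: "flip_pairs s {} b = b"
  by (simp add: flip_pairs_def fun_eq_iff)

lemma flip_insert:
  assumes "insert p S \<subseteq> P" "p \<notin> S"
  shows "flip_pairs s S (b(p := \<not> b p, s p := \<not> b (s p))) = flip_pairs s (insert p S) b"
proof
  fix k
  have P: "p \<in> P" "S \<subseteq> P"
    using assms by auto
  then have "s p \<notin> S" "s p \<noteq> p" "p \<notin> s ` S"
    using s_notin(1) by (metis subsetD, metis, metis imageE subsetD)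
  moreover have "s p \<notin> s ` S"
    using P assms(2) inj_on_image_mem_iff[OF inj P] by simp
  ultimately show "flip_pairs s S (b(p := \<not> b p, s p := \<not> b (s p))) k = flip_pairs s (insert p S) b k"
    using assms(2) by (auto simp: flip_pairs_def)
qed

lemma flip_apply:
  assumes "S \<subseteq> P" "p \<in> P"
  shows "flip_pairs s S b p = (b p \<noteq> (p \<in> S))" "flip_pairs s S b (s p) = (b (s p) \<noteq> (p \<in> S))"
proof -
  have "p \<notin> s ` S" "s p \<notin> S"
    using assms s_notin(1) by (metis imageE subsetD, metis subsetD)
  moreover have "s p \<in> s ` S \<longleftrightarrow> p \<in> S"
    by (rule inj_on_image_mem_iff[OF inj assms(2,1)])
  ultimately show "flip_pairs s S b p = (b p \<noteq> (p \<in> S))" "flip_pairs s S b (s p) = (b (s p) \<noteq> (p \<in> S))"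
    by (simp_all add: flip_pairs_def)
qed

text \<open>As \<open>b\<close> alternates on every pair, each factor contributes either a diagonal
  entry or a swap with coefficient 1; \<open>S\<close> collects the swapped pairs.\<close>

lemma pairs_op_expand:
  assumes "distinct ps" "set ps \<subseteq> P" "\<And>p. p \<in> set ps \<Longrightarrow> b p \<noteq> b (s p)"
  shows "pairs_op q q' s ps f b =
    (\<Sum>S\<in>Pow (set ps). (\<Prod>p\<in>set ps - S. if b p then q p else q' p) * f (flip_pairs s S b))"
  using assms
proof (induction ps arbitrary: b)
  case Nil
  then show ?case by simp
next
  case (Cons p ps)
  let ?b = "b(p := \<not> b p, s p := \<not> b (s p))"
  let ?w = "\<lambda>b p. if b p then q p else q' p"
  let ?F = "\<lambda>b S. (\<Prod>r\<in>set ps - S. ?w b r) * f (flip_pairs s S b)"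
  have p: "p \<notin> set ps" "p \<in> P" "set ps \<subseteq> P"
    using Cons.prems by auto
  have b_other: "?b r = b r" "?b (s r) = b (s r)" if "r \<in> set ps" for r
    using that p s_notin inj by (auto simp: inj_on_def)
  have w: "(\<Prod>r\<in>set ps - S. ?w ?b r) = (\<Prod>r\<in>set ps - S. ?w b r)" for S
    by (rule prod.cong) (simp_all add: b_other(1) del: fun_upd_apply)
  have "pairs_op q q' s (p # ps) f b = ?w b p * pairs_op q q' s ps f b + pairs_op q q' s ps f ?b"
    using Cons.prems(3)[of p] by (simp add: pair_op_def)
  also have "pairs_op q q' s ps f b = (\<Sum>S\<in>Pow (set ps). ?F b S)"
    using Cons.prems by (intro Cons.IH) auto
  also have "pairs_op q q' s ps f ?b = (\<Sum>S\<in>Pow (set ps). ?F ?b S)"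
    using Cons.prems b_other by (intro Cons.IH) auto
  also have "?w b p * (\<Sum>S\<in>Pow (set ps). ?F b S)
      = (\<Sum>S\<in>Pow (set ps). (\<Prod>r\<in>set (p # ps) - S. ?w b r) * f (flip_pairs s S b))"
    unfolding sum_distrib_left
  proof (rule sum.cong[OF refl])
    fix S assume "S \<in> Pow (set ps)"
    then have "set (p # ps) - S = insert p (set ps - S)"
      using p by auto
    then show "?w b p * ?F b S = (\<Prod>r\<in>set (p # ps) - S. ?w b r) * f (flip_pairs s S b)"
      using p(1) by (simp add: mult.assoc)
  qed
  \<comment> \<open>The terms in which \<open>p\<close> is swapped: the subsets containing
    \<open>p\<close> are those of \<open>set ps\<close> with \<open>p\<close> inserted, and swapping
    \<open>p\<close> leaves the weights of the other pairs unchanged.\<close>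
  also have "(\<Sum>S\<in>Pow (set ps). ?F ?b S)
      = (\<Sum>S\<in>insert p ` Pow (set ps). (\<Prod>r\<in>set (p # ps) - S. ?w b r) * f (flip_pairs s S b))"
  proof (subst sum.reindex)
    show "inj_on (insert p) (Pow (set ps))"
      using p(1) by (auto simp: inj_on_def)
    show "(\<Sum>S\<in>Pow (set ps). ?F ?b S) =
      (\<Sum>S\<in>Pow (set ps). ((\<lambda>S. (\<Prod>r\<in>set (p # ps) - S. ?w b r) * f (flip_pairs s S b)) \<circ> insert p) S)"
    proof (rule sum.cong[OF refl])
      fix S assume S: "S \<in> Pow (set ps)"
      then have "set (p # ps) - insert p S = set ps - S"
        using p by auto
      then show "?F ?b S = ((\<lambda>S. (\<Prod>r\<in>set (p # ps) - S. ?w b r) * f (flip_pairs s S b)) \<circ> insert p) S"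
        using S p flip_insert[of p S b] 
        by (subst w) (metis (no_types, lifting) PowD comp_apply insert_subset subset_trans subsetD)
    qed
  qed
  also have "(\<Sum>S\<in>Pow (set ps). (\<Prod>r\<in>set (p # ps) - S. ?w b r) * f (flip_pairs s S b)) +
      (\<Sum>S\<in>insert p ` Pow (set ps). (\<Prod>r\<in>set (p # ps) - S. ?w b r) * f (flip_pairs s S b))
    = (\<Sum>S\<in>Pow (set (p # ps)). (\<Prod>r\<in>set (p # ps) - S. ?w b r) * f (flip_pairs s S b))"
    unfolding list.set(2) Pow_insert
    using p(1) by (intro sum.union_disjoint[symmetric]) auto
  finally show ?case .
qed

text \<open>The condition satisfied by the coefficients of a vector in the image of \<open>R\<^sub>p\<close> for all \<open>p \<in> T\<close>.\<close>

definition balanced :: "('i \<Rightarrow> 'a::comm_ring_1) \<Rightarrow> ('i \<Rightarrow> 'a) \<Rightarrow> 'i set \<Rightarrow> (('i \<Rightarrow> bool) \<Rightarrow> 'a) \<Rightarrow> bool" where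
  "balanced q q' T f \<longleftrightarrow> (\<forall>p\<in>T. \<forall>b.
     (b p = b (s p) \<longrightarrow> f b = 0) \<and>
     (b p \<noteq> b (s p) \<longrightarrow> f (b(p := \<not> b p, s p := \<not> b (s p))) = (if b p then q' p else q p) * f b))"

lemma balancedD:
  assumes "balanced q q' T f" "p \<in> T"
  shows "b p = b (s p) \<Longrightarrow> f b = 0"
    and "b p \<noteq> b (s p) \<Longrightarrow> f (b(p := \<not> b p, s p := \<not> b (s p))) = (if b p then q' p else q p) * f b"
proof -
  note D = spec[OF bspec[OF assms(1)[unfolded balanced_def] assms(2)], of b]
  show "b p = b (s p) \<Longrightarrow> f b = 0"
    by (rule mp[OF conjunct1[OF D]])
  show "b p \<noteq> b (s p) \<Longrightarrow> f (b(p := \<not> b p, s p := \<not> b (s p))) = (if b p then q' p else q p) * f b"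
    by (rule mp[OF conjunct2[OF D]])
qed

lemma balanced_insertI: "balanced q q' {p} f \<Longrightarrow> balanced q q' T f \<Longrightarrow> balanced q q' (insert p T) f"
  unfolding balanced_def ball_simps ball_empty simp_thms by (rule conjI)

text \<open>The image of the matrix ((q, 1), (1, q')) is spanned by (q, 1), so the coefficient at 21
  is q' times the one at 12.\<close>

lemma balanced_pair_op:
  assumes "q p * q' p = 1" "p \<in> P"
  shows "balanced q q' {p} (pair_op (q p) (q' p) p (s p) f)"
proof -
  have "s p \<noteq> p" "p \<noteq> s p"
    using assms s_notin by auto
  then show ?thesis
    by (auto simp: balanced_def pair_op_def fun_upd_twist fun_upd_idem algebra_simps
        mult_inverse_cancel[OF assms(1)] assms(1))
qed

text \<open>Flips of disjoint pairs commute, and the operator at \<open>p\<close> neither reads nor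
  changes the letters at the pair of \<open>r\<close>.\<close>

lemma balanced_pair_op_other:
  assumes "balanced q q' T f" "p \<in> P" "T \<subseteq> P" "p \<notin> T"
  shows "balanced q q' T (pair_op c c' p (s p) f)"
  unfolding balanced_def
proof (intro ballI allI)
  fix r b assume r: "r \<in> T"
  then have rP: "r \<in> P" "r \<noteq> p"
    using assms by auto
  then have ne: "r \<noteq> p" "p \<noteq> r" "s r \<noteq> p" "p \<noteq> s r" "s r \<noteq> s p" "s p \<noteq> s r" "r \<noteq> s p" "s p \<noteq> r"
    using s_notin(2)[of r p] s_notin(2)[of p r] inj_on_eq_iff[OF inj rP(1) assms(2)] assms(2) by auto
  note zero = balancedD(1)[OF assms(1) r] and flip = balancedD(2)[OF assms(1) r]
  let ?b = "b(p := \<not> b p, s p := \<not> b (s p))"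
  let ?c = "b(r := \<not> b r, s r := \<not> b (s r))"
  have eq: "?c(p := \<not> b p, s p := \<not> b (s p)) = ?b(r := \<not> b r, s r := \<not> b (s r))"
    using ne by (simp add: fun_upd_twist)
  have vals: "?b r = b r" "?b (s r) = b (s r)" "?c p = b p" "?c (s p) = b (s p)"
    using ne by simp_all
  have zero': "f ?b = 0" if "b r = b (s r)"
    using zero[of ?b] that vals by simp
  have flip': "f (?b(r := \<not> b r, s r := \<not> b (s r))) = (if b r then q' r else q r) * f ?b" if "b r \<noteq> b (s r)"
    using flip[of ?b, unfolded vals] that by simp
  have at_c: "pair_op c c' p (s p) f ?c =
      (if b p = b (s p) then 0 else (if b p then c else c') * f ?c + f (?b(r := \<not> b r, s r := \<not> b (s r))))"
    unfolding pair_op_def vals eq ..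
  show "(b r = b (s r) \<longrightarrow> pair_op c c' p (s p) f b = 0) \<and>
    (b r \<noteq> b (s r) \<longrightarrow> pair_op c c' p (s p) f ?c = (if b r then q' r else q r) * pair_op c c' p (s p) f b)"
  proof (intro conjI impI)
    assume "b r = b (s r)"
    then show "pair_op c c' p (s p) f b = 0"
      unfolding pair_op_def by (simp only: zero zero') simp
  next
    assume br: "b r \<noteq> b (s r)"
    show "pair_op c c' p (s p) f ?c = (if b r then q' r else q r) * pair_op c c' p (s p) f b"
      unfolding at_c flip[OF br] flip'[OF br] by (simp add: pair_op_def algebra_simps)
  qed
qed

lemma balanced_pairs_op:
  assumes "distinct ps" "set ps \<subseteq> P" "\<And>p. p \<in> P \<Longrightarrow> q p * q' p = 1"
  shows "balanced q q' (set ps) (pairs_op q q' s ps f)"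
  using assms(1,2)
proof (induction ps)
  case Nil
  then show ?case by (simp add: balanced_def)
next
  case (Cons p ps)
  then have "balanced q q' (set ps) (pairs_op q q' s (p # ps) f)"
    by (auto intro: balanced_pair_op_other)
  moreover have "balanced q q' {p} (pairs_op q q' s (p # ps) f)"
    using Cons.prems assms(3) by (auto intro: balanced_pair_op)
  ultimately show ?case
    unfolding list.set(2) by (rule balanced_insertI[rotated])
qed

text \<open>The pairs in \<open>S\<close> are flipped one at a time. In this way one coefficient
  determines a balanced vector at all words obtained by such flips.\<close>

lemma balanced_flip:
  assumes bal: "balanced q q' P f" and alt: "\<And>p. p \<in> P \<Longrightarrow> b p \<noteq> b (s p)"
    and "finite S" "S \<subseteq> P"
  shows "f (flip_pairs s S b) = (\<Prod>p\<in>S. if b p then q' p else q p) * f b"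
  using assms(3,4)
proof (induction S rule: finite_induct)
  case empty
  then show ?case by simp
next
  case (insert p S)
  let ?c = "flip_pairs s S b"
  have c: "?c p = b p" "?c (s p) = b (s p)"
    using insert flip_apply[of S p b] by auto
  have "flip_pairs s (insert p S) b = ?c(p := \<not> ?c p, s p := \<not> ?c (s p))"
    using insert flip_apply[of "insert p S" p b] flip_apply[of S p b]
    by (auto simp: flip_pairs_def fun_eq_iff)
  then have "f (flip_pairs s (insert p S) b) = (if b p then q' p else q p) * f ?c"
    using balancedD(2)[OF bal, of p ?c] insert.prems c alt[of p] by simp
  then show ?case
    using insert by (simp add: mult.assoc)
qed

end

text \<open>In the expansion only the term with all pairs swapped survives, and its weight is an
  empty product.\<close>

lemma (in matching) pairs_op_entry:
  assumes "distinct ps" "set ps \<subseteq> P" "\<And>p. p \<in> set ps \<Longrightarrow> b p \<noteq> b (s p)"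
    and "\<And>S. S \<subset> set ps \<Longrightarrow> f (flip_pairs s S b) = 0"
  shows "pairs_op q q' s ps f b = f (flip_pairs s (set ps) b)"
proof -
  have "pairs_op q q' s ps f b =
      (\<Sum>S\<in>Pow (set ps). (\<Prod>p\<in>set ps - S. if b p then q p else q' p) * f (flip_pairs s S b))"
    using assms(1-3) by (rule pairs_op_expand)
  also have "\<dots> = (\<Sum>S\<in>{set ps}. (\<Prod>p\<in>set ps - S. if b p then q p else q' p) * f (flip_pairs s S b))"
  proof (rule sum.mono_neutral_right)
    show "\<forall>S\<in>Pow (set ps) - {set ps}. (\<Prod>p\<in>set ps - S. if b p then q p else q' p) * f (flip_pairs s S b) = 0"
    proof
      fix S assume "S \<in> Pow (set ps) - {set ps}"
      then have "S \<subset> set ps" by blast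
      then show "(\<Prod>p\<in>set ps - S. if b p then q p else q' p) * f (flip_pairs s S b) = 0"
        by (simp add: assms(4))
    qed
  qed auto
  finally show ?thesis by simp
qed

section \<open>Two matchings that form one cycle\<close>

text \<open>\<open>P\<close> and \<open>P'\<close> are the left ends of two matchings of the same
  positions. \<open>cycle\<close> says that two steps of \<open>s\<close> join all of
  \<open>P\<close> into one orbit; with several orbits, a word alternating on both matchings would
  leave a choice for each.\<close>

locale alternating = matching +
  fixes P'
  assumes s_image: "s ` P = P'" "s ` P' = P" and finite_P: "finite P" and nonempty: "P \<noteq> {}"
    and cycle: "\<And>S. S \<subseteq> P \<Longrightarrow> S \<noteq> {} \<Longrightarrow> (\<And>p. p \<in> S \<Longrightarrow> s (s p) \<in> S) \<Longrightarrow> S = P"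
begin

text \<open>If \<open>S\<close> is neither empty nor all of \<open>P\<close>, then by
  \<open>cycle\<close> some \<open>p\<close> in \<open>S\<close> has \<open>s (s p)\<close> outside
  \<open>S\<close>. Flipping \<open>S\<close> then gives equal letters to the pair of
  \<open>s p\<close>, so \<open>f\<close> vanishes there; two terms of the expansion remain.\<close>

lemma pairs_op_base:
  assumes ps: "distinct ps" "set ps = P" and bal: "balanced q q' P' f"
    and b: "\<And>p. p \<in> P \<Longrightarrow> b p" "\<And>p. p \<in> P' \<Longrightarrow> \<not> b p"
  shows "pairs_op q q' s ps f b = (\<Prod>p\<in>P. q p) * f b + f (flip_pairs s P b)"
proof -
  have in': "s p \<in> P'" "s (s p) \<in> P" if "p \<in> P" for p
    using that s_image by auto
  have vanish: "f (flip_pairs s S b) = 0" if S: "S \<subseteq> P" "S \<noteq> {}" "S \<noteq> P" for S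
  proof -
    obtain p where p: "p \<in> S" "s (s p) \<notin> S"
      using cycle[OF S(1,2)] S(3) by blast
    then have "p \<in> P" using S by blast
    then have "flip_pairs s S b (s p) = flip_pairs s S b (s (s p))"
      using p S(1) b in' flip_apply[of S p b] flip_apply[of S "s (s p)" b] by simp
    then show ?thesis
      by (rule balancedD(1)[OF bal in'(1)[OF \<open>p \<in> P\<close>]])
  qed
  have "b p \<noteq> b (s p)" if "p \<in> set ps" for p
    using that ps b in' by auto
  then have "pairs_op q q' s ps f b =
      (\<Sum>S\<in>Pow P. (\<Prod>p\<in>P - S. if b p then q p else q' p) * f (flip_pairs s S b))"
    using pairs_op_expand[of ps b q q' f] ps by simp
  also have "\<dots> = (\<Sum>S\<in>{{}, P}. (\<Prod>p\<in>P - S. if b p then q p else q' p) * f (flip_pairs s S b))"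
    using finite_P vanish by (intro sum.mono_neutral_right) auto
  also have "\<dots> = (\<Prod>p\<in>P. if b p then q p else q' p) * f b + f (flip_pairs s P b)"
    using nonempty by simp
  also have "(\<Prod>p\<in>P. if b p then q p else q' p) = (\<Prod>p\<in>P. q p)"
    using b by (intro prod.cong) auto
  finally show ?thesis .
qed

end

locale alternating_pair = A: alternating s P P' + B: alternating s P' P for s P P' +
  fixes q q' :: "'a \<Rightarrow> 'b::comm_ring_1"
  assumes inverse: "p \<in> P \<union> P' \<Longrightarrow> q p * q' p = 1"
begin

text \<open>A rank-one argument through coefficients: both sides are balanced over \<open>P\<close>,
  so it suffices to compare them at a word with 1 on \<open>P\<close> and 2 on
  \<open>P'\<close>.\<close>

lemma pairs_op_sandwich:
  assumes ps: "distinct ps" "set ps = P" and rs: "distinct rs" "set rs = P'"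
  shows "pairs_op q q' s ps (pairs_op q q' s rs (pairs_op q q' s ps f)) b =
    ((\<Prod>p\<in>P. q p) * (\<Prod>p\<in>P'. q' p) + 2 + (\<Prod>p\<in>P'. q p) * (\<Prod>p\<in>P. q' p))
      * pairs_op q q' s ps f b"
proof -
  define Q Q' R R' where "Q = (\<Prod>p\<in>P. q p)" and "Q' = (\<Prod>p\<in>P. q' p)"
    and "R = (\<Prod>p\<in>P'. q p)" and "R' = (\<Prod>p\<in>P'. q' p)"
  have QQ': "Q * Q' = 1" "R * R' = 1"
    using inverse by (simp_all add: Q_def Q'_def R_def R'_def prod.distrib[symmetric])
  define u where "u = pairs_op q q' s ps f"
  define g where "g = pairs_op q q' s rs u"
  define h where "h = pairs_op q q' s ps g"
  have bal_u: "A.balanced q q' P u" and bal_h: "A.balanced q q' P h"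
    unfolding u_def h_def using A.balanced_pairs_op[of ps q q'] ps inverse by auto
  have bal_g: "A.balanced q q' P' g"
    unfolding g_def using B.balanced_pairs_op[of rs q q'] rs inverse by auto
  have base: "h b = (Q * R' + 2 + R * Q') * u b"
    if b: "\<And>p. p \<in> P \<Longrightarrow> b p" "\<And>p. p \<in> P' \<Longrightarrow> \<not> b p" for b
  proof -
    let ?c = "flip_pairs s P b"
    have c: "\<not> ?c p" if "p \<in> P" for p
      using that b(1) by (simp add: flip_pairs_def)
    have c': "?c p" if "p \<in> P'" for p
      using that b(2) A.s_image by (auto simp: flip_pairs_def)
    have alt_b: "b p \<noteq> b (s p)" if "p \<in> P" for p
    proof -
      have "s p \<in> P'" using that A.s_image by blast
      then show ?thesis using b that by blast
    qed
    have alt_c: "?c p \<noteq> ?c (s p)" if "p \<in> P'" for p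
    proof -
      have "s p \<in> P" using that B.s_image by blast
      then show ?thesis using c c' that by blast
    qed
    have flip_back: "flip_pairs s P' ?c = b"
      using A.s_image B.s_image by (auto simp: flip_pairs_def fun_eq_iff)
    \<comment> \<open>Only \<open>b\<close> and its flip \<open>?c\<close> matter. Each of the two
      outer products gives two terms, and balancedness relates the coefficients at \<open>b\<close>
      and \<open>?c\<close> of the vector it acts on.\<close>
    have "h b = Q * g b + g ?c"
      unfolding h_def Q_def using A.pairs_op_base[OF ps bal_g] b by blast
    moreover have "g ?c = R * u ?c + u b"
      unfolding g_def R_def using B.pairs_op_base[OF rs bal_u, of ?c] c c' flip_back by simp
    moreover have "g b = R' * g ?c"
    proof -
      have "g (flip_pairs s P' ?c) = (\<Prod>p\<in>P'. if ?c p then q' p else q p) * g ?c"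
        using alt_c B.finite_P by (intro B.balanced_flip[OF bal_g]) auto
      also have "(\<Prod>p\<in>P'. if ?c p then q' p else q p) = R'"
        unfolding R'_def using c' by (intro prod.cong) auto
      finally show ?thesis by (simp add: flip_back)
    qed
    moreover have "u ?c = Q' * u b"
    proof -
      have "u (flip_pairs s P b) = (\<Prod>p\<in>P. if b p then q' p else q p) * u b"
        using alt_b A.finite_P by (intro A.balanced_flip[OF bal_u]) auto
      also have "(\<Prod>p\<in>P. if b p then q' p else q p) = Q'"
        unfolding Q'_def using b by (intro prod.cong) auto
      finally show ?thesis .
    qed
    \<comment> \<open>One factor comes from each of these two products. The summand 2 is 1 plus Q Q'
      R R', which is 1 as well.\<close>
    ultimately have "h b = (Q * R' + 1) * (R * Q' + 1) * u b"
      by (simp add: algebra_simps)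
    also have "(Q * R' + 1) * (R * Q' + 1) = (Q * Q') * (R * R') + Q * R' + R * Q' + 1"
      by (simp add: algebra_simps)
    also have "\<dots> = Q * R' + 2 + R * Q'"
      by (simp add: QQ')
    finally show ?thesis .
  qed
  have "h b = (Q * R' + 2 + R * Q') * u b"
  proof (cases "\<exists>p\<in>P. b p = b (s p)")
    case True
    then have "h b = 0" "u b = 0"
      using A.balancedD(1)[OF bal_h] A.balancedD(1)[OF bal_u] by blast+
    then show ?thesis by simp
  next
    case False
    \<comment> \<open>Flipping the pairs on which \<open>b\<close> reads 21 leads to a word covered
      by \<open>base\<close>; \<open>h\<close> and \<open>u\<close> change by the same
      factor.\<close>
    define S where "S = {p \<in> P. \<not> b p}"
    let ?c = "flip_pairs s S b"
    have S: "S \<subseteq> P" "finite S"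
      using A.finite_P by (auto simp: S_def)
    have cp: "?c p" "\<not> ?c (s p)" if "p \<in> P" for p
      using that False A.flip_apply[OF S(1) that, of b] by (auto simp: S_def)
    then have c: "?c p" if "p \<in> P" for p
      using that by blast
    have c': "\<not> ?c p" if "p \<in> P'" for p
      using that cp(2) A.s_image by blast
    have flip_back: "flip_pairs s S ?c = b"
      by (auto simp: flip_pairs_def fun_eq_iff)
    have alt: "?c p \<noteq> ?c (s p)" if "p \<in> P" for p
      using cp[OF that] by blast
    have from_c: "f b = (\<Prod>p\<in>S. if ?c p then q' p else q p) * f ?c" if "A.balanced q q' P f" for f
      using A.balanced_flip[of q q' f ?c S, OF that _ S(2,1)] alt flip_back by simp
    have "h ?c = (Q * R' + 2 + R * Q') * u ?c"
      by (rule base[OF c c'])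
    then show ?thesis
      by (simp only: from_c[OF bal_h] from_c[OF bal_u]) (simp only: ac_simps)
  qed
  then show ?thesis
    unfolding h_def g_def u_def Q_def Q'_def R_def R'_def .
qed

end

section \<open>The operators on tensor space\<close>

lemma inv_type_ring:
  fixes q q' :: "'a::comm_ring_1"
  assumes "q * q' = 1"
  shows "inv\<^bsub>ring_of_type_algebra\<^esub> q = q'"
proof -
  interpret cring "ring_of_type_algebra :: 'a ring" ..
  show ?thesis
    using assms by (intro comm_inv_char) simp_all
qed

lemma unit_div_eq:
  assumes "q * q' = 1"
  shows "p /\<^sub>u q = p * q'"
  by (simp add: unit_div_def inv_type_ring[OF assms])

text \<open>The letters are 1 and 2, so the exponents \<open>2 - \<alpha> i\<close> and
  \<open>1 - \<alpha> i\<close> in \<open>R_op\<close> take only these three values.\<close>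

lemma int_pow_type_ring:
  fixes q q' :: "'a::comm_ring_1"
  assumes "q * q' = 1"
  shows "q [^]\<^bsub>ring_of_type_algebra\<^esub> (0::int) = 1"
    and "q [^]\<^bsub>ring_of_type_algebra\<^esub> (1::int) = q"
    and "q [^]\<^bsub>ring_of_type_algebra\<^esub> (- 1::int) = q'"
proof -
  interpret cring "ring_of_type_algebra :: 'a ring" ..
  show "q [^]\<^bsub>ring_of_type_algebra\<^esub> (0::int) = 1" "q [^]\<^bsub>ring_of_type_algebra\<^esub> (1::int) = q"
    "q [^]\<^bsub>ring_of_type_algebra\<^esub> (- 1::int) = q'"
    by (simp_all add: int_pow_def2 inv_type_ring[OF assms])
qed

lemma tensor_space_simps [simp]:
  "carrier (tensor_space n) = {v. Poly_Mapping.keys v \<subseteq> words n}"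
  "\<zero>\<^bsub>tensor_space n\<^esub> = 0"
  "u \<oplus>\<^bsub>tensor_space n\<^esub> v = u + v"
  by (simp_all add: tensor_space_def)

lemma lookup_smult_tensor_space [simp]:
  "Poly_Mapping.lookup (r \<odot>\<^bsub>tensor_space n\<^esub> v) \<alpha> = r * Poly_Mapping.lookup v \<alpha>"
  by (simp add: tensor_space_def map.rep_eq when_def)

lemma keys_smult_tensor_space: "Poly_Mapping.keys (r \<odot>\<^bsub>tensor_space n\<^esub> v) \<subseteq> Poly_Mapping.keys v"
  by (auto simp: in_keys_iff)

lemma type_module_tensor_space: "type_module (tensor_space n :: ('a::comm_ring_1, _) module)"
proof -
  have neg: "\<exists>y. Poly_Mapping.keys y \<subseteq> words n \<and> y + x = 0"
    if "Poly_Mapping.keys x \<subseteq> words n" for x :: "(int \<Rightarrow> int) \<Rightarrow>\<^sub>0 'a"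
    using that by (intro exI[of _ "- x"]) (auto simp: in_keys_iff)
  have "module ring_of_type_algebra (tensor_space n :: ('a, _) module)"
  proof (rule moduleI)
    show "cring (ring_of_type_algebra :: 'a ring)" ..
    show "abelian_group (tensor_space n :: ('a, _) module)"
    proof (rule abelian_groupI)
      show "u \<oplus>\<^bsub>tensor_space n\<^esub> v \<in> carrier (tensor_space n)"
        if "u \<in> carrier (tensor_space n)" "v \<in> carrier (tensor_space n)" for u v :: "(int \<Rightarrow> int) \<Rightarrow>\<^sub>0 'a"
        using that keys_add[of u v] by auto
    qed (use neg in \<open>auto simp: add.assoc add.commute\<close>)
  qed (use keys_smult_tensor_space in
      \<open>fastforce simp: lookup_add algebra_simps intro!: poly_mapping_eqI\<close>)+
  then show ?thesis
    by (simp add: type_module_def)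
qed

section \<open>Coefficients of tensors at boolean words\<close>

text \<open>Truth values outside \<open>I_idx n\<close> are forgotten, so that
  \<open>pair_op\<close> and \<open>matching\<close> can work with total functions on the
  integers.\<close>

definition word_of :: "nat \<Rightarrow> (int \<Rightarrow> bool) \<Rightarrow> int \<Rightarrow> int" where
  "word_of n b = (\<lambda>k\<in>I_idx n. if b k then 1 else 2)"

definition word_coeff :: "nat \<Rightarrow> ((int \<Rightarrow> int) \<Rightarrow>\<^sub>0 'a::zero) \<Rightarrow> (int \<Rightarrow> bool) \<Rightarrow> 'a" where
  "word_coeff n v b = Poly_Mapping.lookup v (word_of n b)"

lemma word_of_in_words: "word_of n b \<in> words n"
  by (auto simp: word_of_def words_def)

lemma word_of_surj:
  assumes "\<alpha> \<in> words n"
  shows "word_of n (\<lambda>k. \<alpha> k = 1) = \<alpha>"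
proof
  fix k
  have "\<alpha> k = 1 \<or> \<alpha> k = 2" if "k \<in> I_idx n"
    using assms that by (auto simp: words_def PiE_def Pi_def)
  moreover have "\<alpha> k = undefined" if "k \<notin> I_idx n"
    using assms that by (auto simp: words_def PiE_def extensional_def)
  ultimately show "word_of n (\<lambda>k. \<alpha> k = 1) k = \<alpha> k"
    by (auto simp: word_of_def)
qed

lemma word_of_eq_iff: "word_of n b = word_of n c \<longleftrightarrow> (\<forall>k\<in>I_idx n. b k = c k)"
proof
  assume "word_of n b = word_of n c"
  then show "\<forall>k\<in>I_idx n. b k = c k"
    by (auto simp: word_of_def fun_eq_iff split: if_splits)
next
  assume "\<forall>k\<in>I_idx n. b k = c k"
  then show "word_of n b = word_of n c"
    by (auto simp: word_of_def)
qed

lemma finite_words: "finite (words n)"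
  unfolding words_def by (rule finite_PiE) (simp_all add: I_idx_def)

lemma word_coeff_eqI:
  assumes "u \<in> carrier (tensor_space n)" "v \<in> carrier (tensor_space n)" "word_coeff n u = word_coeff n v"
  shows "u = v"
proof (rule poly_mapping_eqI)
  fix \<alpha>
  show "Poly_Mapping.lookup u \<alpha> = Poly_Mapping.lookup v \<alpha>"
  proof (cases "\<alpha> \<in> words n")
    case True
    then show ?thesis
      using fun_cong[OF assms(3), of "\<lambda>k. \<alpha> k = 1"] by (simp add: word_coeff_def word_of_surj)
  next
    case False
    then show ?thesis
      using assms(1,2) by (simp add: in_keys_iff subset_iff) metis
  qed
qed

lemma word_coeff_simps [simp]:
  "word_coeff n (u + v) b = word_coeff n u b + word_coeff n v b"
  "word_coeff n (r \<odot>\<^bsub>tensor_space n\<^esub> v) b = r * word_coeff n v b"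
  by (simp_all add: word_coeff_def lookup_add)

lemma cyc_succ_in:
  assumes "i \<in> I_idx n"
  shows "cyc_succ n i \<in> I_idx n" "cyc_succ n i \<noteq> i"
  using assms by (auto simp: cyc_succ_def I_idx_def) presburger

text \<open>\<open>R_op\<close> is defined on basis words, \<open>pair_op\<close> on coefficients;
  the two descriptions agree without a transposition because the matrix ((q, 1), (1, q')) is
  symmetric.\<close>

lemma R_op_lookup:
  fixes q q' :: "'a::comm_ring_1"
  assumes i: "i \<in> I_idx n" and q: "q * q' = 1" and v: "v \<in> carrier (tensor_space n)"
  shows "R_op n q i v \<in> carrier (tensor_space n)"
    and "word_coeff n (R_op n q i v) = pair_op q q' i (cyc_succ n i) (word_coeff n v)"
proof -
  define j where "j = cyc_succ n i"
  have j: "j \<in> I_idx n" "j \<noteq> i" "i \<noteq> j"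
    using cyc_succ_in[OF i] by (auto simp: j_def)
  define F :: "(int \<Rightarrow> int) \<Rightarrow> ((int \<Rightarrow> int) \<Rightarrow>\<^sub>0 'a)" where
    "F \<alpha> = (if \<alpha> i = \<alpha> j then 0
     else Poly_Mapping.single (\<alpha>(i := 1, j := 2)) (q [^]\<^bsub>ring_of_type_algebra\<^esub> (2 - \<alpha> i))
        + Poly_Mapping.single (\<alpha>(i := 2, j := 1)) (q [^]\<^bsub>ring_of_type_algebra\<^esub> (1 - \<alpha> i)))" for \<alpha>
  have R: "R_op n q i v = (\<Sum>\<alpha>\<in>Poly_Mapping.keys v. Poly_Mapping.lookup v \<alpha> \<odot>\<^bsub>tensor_space n\<^esub> F \<alpha>)"
    using v by (simp add: R_op_def linear_extension_def F_def[abs_def] Let_def flip: j_def)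
  have upd: "\<alpha>(i := x, j := y) \<in> words n" if "\<alpha> \<in> words n" "x \<in> {1, 2}" "y \<in> {1, 2}" for \<alpha> x y
    using that i j unfolding words_def by (auto simp: PiE_def Pi_def extensional_def)
  have "Poly_Mapping.keys (F \<alpha>) \<subseteq> words n" if "\<alpha> \<in> words n" for \<alpha>
    using upd[OF that] by (auto simp: F_def dest!: subsetD[OF keys_add] split: if_splits)
  then show "R_op n q i v \<in> carrier (tensor_space n)"
    using v unfolding R tensor_space_simps mem_Collect_eq
    by (intro order.trans[OF keys_sum] UN_least order.trans[OF keys_smult_tensor_space]) auto
  show "word_coeff n (R_op n q i v) = pair_op q q' i (cyc_succ n i) (word_coeff n v)"
  proof
    fix b
    let ?\<beta> = "word_of n b"
    let ?c = "b(i := \<not> b i, j := \<not> b j)"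
    let ?\<gamma> = "word_of n ?c"
    have \<beta>: "?\<beta> \<in> words n" "?\<gamma> \<in> words n"
      by (rule word_of_in_words)+
    have vals: "?\<beta> i = (if b i then 1 else 2)" "?\<beta> j = (if b j then 1 else 2)"
      using i j by (simp_all add: word_of_def)
    have "word_coeff n (R_op n q i v) b
        = (\<Sum>\<alpha>\<in>Poly_Mapping.keys v. Poly_Mapping.lookup v \<alpha> * Poly_Mapping.lookup (F \<alpha>) ?\<beta>)"
      by (simp add: R word_coeff_def lookup_sum)
    also have "\<dots> = (\<Sum>\<alpha>\<in>words n. Poly_Mapping.lookup v \<alpha> * Poly_Mapping.lookup (F \<alpha>) ?\<beta>)"
      using v finite_words by (intro sum.mono_neutral_left) (auto simp: in_keys_iff)
    finally have sum: "word_coeff n (R_op n q i v) b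
      = (\<Sum>\<alpha>\<in>words n. Poly_Mapping.lookup v \<alpha> * Poly_Mapping.lookup (F \<alpha>) ?\<beta>)" .
    show "word_coeff n (R_op n q i v) b = pair_op q q' i (cyc_succ n i) (word_coeff n v) b"
    proof (cases "b i = b j")
      case True
      have "Poly_Mapping.lookup (F \<alpha>) ?\<beta> = 0" for \<alpha>
      proof -
        have "\<alpha>(i := 1, j := 2) \<noteq> ?\<beta>" "\<alpha>(i := 2, j := 1) \<noteq> ?\<beta>"
          using vals True j by (auto simp: fun_eq_iff split: if_splits)
        then show ?thesis
          by (simp add: F_def lookup_add lookup_single)
      qed
      then show ?thesis
        using True by (simp add: sum pair_op_def j_def)
    next
      case False
      \<comment> \<open>The letters at \<open>i\<close> and \<open>j\<close> differ, so
        complementing both amounts to exchanging them.\<close>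
      have \<gamma>: "?\<gamma> = ?\<beta>(i := ?\<beta> j, j := ?\<beta> i)"
        using False i j by (auto simp: word_of_def fun_eq_iff)
      have ne: "?\<beta> \<noteq> ?\<gamma>"
        using False vals j by (metis \<gamma> fun_upd_same num.distinct(1) one_eq_numeral_iff)
      have off: "Poly_Mapping.lookup (F \<alpha>) ?\<beta> = 0" if \<alpha>: "\<alpha> \<in> words n" "\<alpha> \<noteq> ?\<beta>" "\<alpha> \<noteq> ?\<gamma>" for \<alpha>
      proof (rule ccontr)
        assume nz: "Poly_Mapping.lookup (F \<alpha>) ?\<beta> \<noteq> 0"
        then have "\<alpha> i \<noteq> \<alpha> j" and eq: "\<alpha>(i := 1, j := 2) = ?\<beta> \<or> \<alpha>(i := 2, j := 1) = ?\<beta>"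
          by (auto simp: F_def lookup_add lookup_single when_def split: if_splits)
        have "\<alpha> i \<in> {1, 2}" "\<alpha> j \<in> {1, 2}"
          using \<alpha>(1) i j by (auto simp: words_def PiE_def Pi_def)
        have "\<alpha> k = ?\<beta> k" if "k \<noteq> i" "k \<noteq> j" for k
          using eq that by (metis fun_upd_other)
        then have "\<alpha> = ?\<beta>(i := \<alpha> i, j := \<alpha> j)"
          by auto
        moreover have "?\<beta>(i := ?\<beta> i, j := ?\<beta> j) = ?\<beta>"
          by simp
        ultimately show False
          using \<alpha>(2,3) \<open>\<alpha> i \<noteq> \<alpha> j\<close> \<open>\<alpha> i \<in> {1, 2}\<close> \<open>\<alpha> j \<in> {1, 2}\<close> vals False unfolding \<gamma>
          by (auto split: if_splits)
      qed
      have "(\<Sum>\<alpha>\<in>words n. Poly_Mapping.lookup v \<alpha> * Poly_Mapping.lookup (F \<alpha>) ?\<beta>)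
        = (\<Sum>\<alpha>\<in>{?\<beta>, ?\<gamma>}. Poly_Mapping.lookup v \<alpha> * Poly_Mapping.lookup (F \<alpha>) ?\<beta>)"
        using finite_words \<beta> off by (intro sum.mono_neutral_right) auto
      also have "\<dots> = word_coeff n v b * Poly_Mapping.lookup (F ?\<beta>) ?\<beta> + word_coeff n v ?c * Poly_Mapping.lookup (F ?\<gamma>) ?\<beta>"
        using ne by (simp add: word_coeff_def)
      also have "Poly_Mapping.lookup (F ?\<beta>) ?\<beta> = (if b i then q else q')"
      proof (cases "b i")
        case True
        then have "?\<beta>(i := 1, j := 2) = ?\<beta>" "?\<beta>(i := 2, j := 1) \<noteq> ?\<beta>"
          using vals False j by (auto simp: fun_upd_idem_iff fun_eq_iff)
        then show ?thesis
          using True False vals by (simp add: F_def lookup_add lookup_single int_pow_type_ring[OF q])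
      next
        case f: False
        then have "?\<beta>(i := 2, j := 1) = ?\<beta>" "?\<beta>(i := 1, j := 2) \<noteq> ?\<beta>"
          using vals False j by (auto simp: fun_upd_idem_iff fun_eq_iff)
        then show ?thesis
          using f False vals by (simp add: F_def lookup_add lookup_single int_pow_type_ring[OF q])
      qed
      also have "Poly_Mapping.lookup (F ?\<gamma>) ?\<beta> = 1"
      proof (cases "b i")
        case True
        then have "?\<gamma>(i := 1, j := 2) = ?\<beta>" "?\<gamma>(i := 2, j := 1) \<noteq> ?\<beta>"
          using vals False j unfolding \<gamma> by (auto simp: fun_eq_iff)
        moreover have "?\<gamma> i = 2" "?\<gamma> j = 1"
          using True False i j by (simp_all add: word_of_def)
        ultimately show ?thesis
          by (simp add: F_def lookup_add lookup_single int_pow_type_ring[OF q])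
      next
        case f: False
        then have "?\<gamma>(i := 2, j := 1) = ?\<beta>" "?\<gamma>(i := 1, j := 2) \<noteq> ?\<beta>"
          using vals False j unfolding \<gamma> by (auto simp: fun_eq_iff)
        moreover have "?\<gamma> i = 1" "?\<gamma> j = 2"
          using f False i j by (simp_all add: word_of_def)
        ultimately show ?thesis
          by (simp add: F_def lookup_add lookup_single int_pow_type_ring[OF q])
      qed
      finally show ?thesis
        unfolding sum[symmetric] pair_op_def j_def[symmetric]
        using False by (simp only: if_False mult.commute mult_1)
    qed
  qed
qed

lemma pair_op_add: "pair_op q q' i j (\<lambda>b. f b + g b) b = pair_op q q' i j f b + pair_op q q' i j g b"
  by (simp add: pair_op_def algebra_simps)

lemma R_op_closed:
  fixes q q' :: "'a::comm_ring_1"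
  assumes i: "i \<in> I_idx n" and q: "q * q' = 1"
  shows "R_op n q i \<in> carrier (endo_algebra (tensor_space n))"
proof -
  interpret V: type_module "tensor_space n :: ('a, _) module"
    by (rule type_module_tensor_space)
  note R = R_op_lookup[OF i q]
  have word_coeff_fun: "word_coeff n (u + v) = (\<lambda>b. word_coeff n u b + word_coeff n v b)"
    "word_coeff n (r \<odot>\<^bsub>tensor_space n\<^esub> v) = (\<lambda>b. r * word_coeff n v b)"
    for u v :: "(int \<Rightarrow> int) \<Rightarrow>\<^sub>0 'a" and r
    by (simp_all add: fun_eq_iff)
  show ?thesis
  proof (rule endo_algebra_carrierI)
    show "R_op n q i \<in> extensional (carrier (tensor_space n))"
      by (simp add: R_op_def linear_extension_def)
    fix u v :: "(int \<Rightarrow> int) \<Rightarrow>\<^sub>0 'a" and r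
    assume v: "v \<in> carrier (tensor_space n)"
    show "R_op n q i v \<in> carrier (tensor_space n)"
      by (rule R(1)[OF v])
    note rv = V.smult_simps(1)[OF v, of r]
    show "R_op n q i (r \<odot>\<^bsub>tensor_space n\<^esub> v) = r \<odot>\<^bsub>tensor_space n\<^esub> R_op n q i v"
      by (rule word_coeff_eqI[OF R(1)[OF rv] V.smult_simps(1)[OF R(1)[OF v]]])
        (simp add: fun_eq_iff R(2)[OF rv] R(2)[OF v] word_coeff_fun pair_op_scale del: tensor_space_simps)
    assume u: "u \<in> carrier (tensor_space n)"
    note uv = V.M.a_closed[OF u v]
    show "R_op n q i (u \<oplus>\<^bsub>tensor_space n\<^esub> v) = R_op n q i u \<oplus>\<^bsub>tensor_space n\<^esub> R_op n q i v"
      by (rule word_coeff_eqI[OF R(1)[OF uv] V.M.a_closed[OF R(1)[OF u] R(1)[OF v]]])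
        (use R(2)[OF uv] in \<open>simp add: fun_eq_iff R(2)[OF u] R(2)[OF v] word_coeff_fun pair_op_add\<close>)
  qed
qed

section \<open>Laurent parameters attached to positions\<close>

definition laurent_inv :: "laurent_var \<Rightarrow> laurent" where
  "laurent_inv v = Poly_Mapping.single (Poly_Mapping.single v (- 1)) 1"

lemma laurent_gen_inverse: "laurent_gen v * laurent_inv v = 1"
  by (simp add: laurent_gen_def laurent_inv_def mult_single flip: single_add)

text \<open>Every position occurs in exactly one factor of exactly one generator: -n, n belong to
  \<open>e\<close> and 0, 2n to \<open>f\<close>, and the U_i fill the four gaps that these leave on
  the cycle, one variable for each gap. So the parameter is a function of the position, as
  \<open>pairs_op\<close> requires.\<close>

definition pos_var :: "nat \<Rightarrow> int \<Rightarrow> laurent_var" where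
  "pos_var n p =
     (if p < - int n then Var_a else if p = - int n then Var_x
      else if p < 0 then Var_b else if p = 0 then Var_z
      else if p < int n then Var_c else if p = int n then Var_y
      else if p < 2 * int n then Var_d else Var_w)"

abbreviation pos_par :: "nat \<Rightarrow> int \<Rightarrow> laurent" where
  "pos_par n p \<equiv> laurent_gen (pos_var n p)"

abbreviation pos_inv :: "nat \<Rightarrow> int \<Rightarrow> laurent" where
  "pos_inv n p \<equiv> laurent_inv (pos_var n p)"

fun gen_pos :: "nat \<Rightarrow> blob_gen \<Rightarrow> int list" where
  "gen_pos n (Gen_U i) = [- int n - int i, - int n + int i, int n - int i, int n + int i]"
| "gen_pos n Gen_e = [- int n, int n]"
| "gen_pos n Gen_f = [0, 2 * int n]"

definition word_pos :: "nat \<Rightarrow> blob_gen list \<Rightarrow> int list" where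
  "word_pos n w = concat (map (gen_pos n) w)"

lemma word_pos_simps [simp]:
  "word_pos n [] = []" "word_pos n (g # w) = gen_pos n g @ word_pos n w"
  "word_pos n (v @ w) = word_pos n v @ word_pos n w"
  by (simp_all add: word_pos_def)

abbreviation pos_op :: "nat \<Rightarrow> int list \<Rightarrow> ((int \<Rightarrow> bool) \<Rightarrow> laurent) \<Rightarrow> (int \<Rightarrow> bool) \<Rightarrow> laurent" where
  "pos_op n \<equiv> pairs_op (pos_par n) (pos_inv n) (cyc_succ n)"

lemma gen_pos_in:
  assumes "n \<ge> 1" "g \<in> blob_gens n"
  shows "set (gen_pos n g) \<subseteq> I_idx n"
  using assms by (cases g) (auto simp: I_idx_def)

lemma R_gen_eq:
  assumes "n \<ge> 1" "g \<in> blob_gens n"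
  shows "R_gen n g = (case g of
      Gen_U i \<Rightarrow> R_op n (pos_par n (- int n - int i)) (- int n - int i)
        \<otimes>\<^bsub>End_V n\<^esub> R_op n (pos_par n (- int n + int i)) (- int n + int i)
        \<otimes>\<^bsub>End_V n\<^esub> R_op n (pos_par n (int n - int i)) (int n - int i)
        \<otimes>\<^bsub>End_V n\<^esub> R_op n (pos_par n (int n + int i)) (int n + int i)
    | Gen_e \<Rightarrow> R_op n (pos_par n (- int n)) (- int n) \<otimes>\<^bsub>End_V n\<^esub> R_op n (pos_par n (int n)) (int n)
    | Gen_f \<Rightarrow> R_op n (pos_par n 0) 0 \<otimes>\<^bsub>End_V n\<^esub> R_op n (pos_par n (2 * int n)) (2 * int n))"
  using assms
  by (cases g)
    (auto simp: pos_var_def \<a>_def \<b>_def \<c>_def \<d>_def \<x>_def \<y>_def \<z>_def \<w>_def simp del: endo_algebra_simps)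

lemma R_gen_coeff:
  assumes n: "n \<ge> 1" and g: "g \<in> blob_gens n"
  shows "R_gen n g \<in> carrier (End_V n)"
    and "v \<in> carrier (tensor_space n) \<Longrightarrow>
      word_coeff n (R_gen n g v) = pos_op n (gen_pos n g) (word_coeff n v)"
proof -
  interpret V: type_module "tensor_space n :: (laurent, _) module"
    by (rule type_module_tensor_space)
  note closed = R_op_closed[OF _ laurent_gen_inverse]
  note lookup = R_op_lookup[OF _ laurent_gen_inverse]
  have pos: "p \<in> set (gen_pos n g) \<Longrightarrow> p \<in> I_idx n" for p
    using gen_pos_in[OF n g] by blast
  show "R_gen n g \<in> carrier (End_V n)"
    unfolding R_gen_eq[OF n g]
    by (cases g; use pos in \<open>simp del: endo_algebra_simps tensor_space_simps\<close>)
      (intro V.E.m_closed closed; simp)+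
  show "word_coeff n (R_gen n g v) = pos_op n (gen_pos n g) (word_coeff n v)"
    if v: "v \<in> carrier (tensor_space n)"
    unfolding R_gen_eq[OF n g] using pos v
    by (cases g) (simp_all add: compose_eq lookup del: tensor_space_simps)
qed

lemma blob_assignment_R_gen:
  assumes "n \<ge> 1" "\<theta> \<in> ring_hom ring_of_type_algebra ring_of_type_algebra"
  shows "blob_assignment (tensor_space n) n \<theta> (R_gen n)"
proof -
  interpret V: type_module "tensor_space n :: (laurent, _) module"
    by (rule type_module_tensor_space)
  show ?thesis
    by unfold_locales (use assms R_gen_coeff(1)[OF assms(1)] in auto)
qed

lemma inj_on_cyc_succ: "inj_on (cyc_succ n) (I_idx n)"
  by (auto simp: inj_on_def cyc_succ_def I_idx_def split: if_splits)

locale R_assignment =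
  fixes n :: nat and \<theta> :: "param_ring \<Rightarrow> laurent"
  assumes n: "n \<ge> 1"
    and \<theta>: "\<theta> \<in> ring_hom ring_of_type_algebra ring_of_type_algebra"
begin

sublocale blob_assignment "tensor_space n" n \<theta> "R_gen n"
  by (rule blob_assignment_R_gen[OF n \<theta>])

lemma word_op_coeff:
  assumes "w \<in> lists (blob_gens n)" "v \<in> carrier (tensor_space n)"
  shows "word_coeff n (word_op w v) = pos_op n (word_pos n w) (word_coeff n v)"
  using assms(1)
proof (induction w)
  case Nil
  then show ?case using assms(2) by (simp add: word_op_simps)
next
  case (Cons g w)
  have "word_op w v \<in> carrier (tensor_space n)"
    using endo_algebra_carrierD(1)[OF word_op_closed assms(2), of w] Cons by simp
  then show ?case
    using Cons R_gen_coeff(2)[OF n, of g "word_op w v"] assms(2)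
    by (simp add: word_op_simps compose_eq del: tensor_space_simps)
qed

lemma relation_iff:
  assumes "v \<in> lists (blob_gens n)" "w \<in> lists (blob_gens n)"
  shows "free_hom (r \<cdot> v - s \<cdot> w) = \<zero>\<^bsub>End_V n\<^esub> \<longleftrightarrow>
    (\<forall>u\<in>carrier (tensor_space n). \<forall>b. \<theta> r * pos_op n (word_pos n v) (word_coeff n u) b
      = \<theta> s * pos_op n (word_pos n w) (word_coeff n u) b)"
proof -
  have term_closed: "scalar r \<otimes>\<^bsub>End_V n\<^esub> word_op v \<in> carrier (End_V n)"
    if "v \<in> lists (blob_gens n)" for r v
    by (rule E.m_closed[OF scalar_closed word_op_closed[OF that]])
  have coeff: "word_coeff n ((scalar r \<otimes>\<^bsub>End_V n\<^esub> word_op v) u) b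
      = \<theta> r * pos_op n (word_pos n v) (word_coeff n u) b"
    if v: "v \<in> lists (blob_gens n)" and u: "u \<in> carrier (tensor_space n)" for r v u b
    using endo_algebra_carrierD(1)[OF word_op_closed[OF v] u] u
    by (simp add: scalar_def endo_scalar_mult[OF word_op_closed[OF v]] word_op_coeff[OF v u]
        del: tensor_space_simps endo_algebra_simps(1))
  have eq_iff: "f = g \<longleftrightarrow> (\<forall>u\<in>carrier (tensor_space n). \<forall>b. word_coeff n (f u) b = word_coeff n (g u) b)"
    if f: "f \<in> carrier (End_V n)" and g: "g \<in> carrier (End_V n)" for f g
  proof
    assume eq: "\<forall>u\<in>carrier (tensor_space n). \<forall>b. word_coeff n (f u) b = word_coeff n (g u) b"
    show "f = g"
    proof (rule endo_algebra_eqI[OF f g])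
      fix u assume u: "u \<in> carrier (tensor_space n :: (laurent, _) module)"
      show "f u = g u"
        by (rule word_coeff_eqI[OF endo_algebra_carrierD(1)[OF f u] endo_algebra_carrierD(1)[OF g u]])
          (use eq u in \<open>simp add: fun_eq_iff\<close>)
    qed
  qed simp
  show ?thesis
    unfolding free_hom_relation_iff[OF assms] eq_iff[OF term_closed[OF assms(1)] term_closed[OF assms(2)]]
    using coeff[OF assms(1)] coeff[OF assms(2)] by (simp del: tensor_space_simps endo_algebra_simps)
qed

text \<open>The basis word with 2 on \<open>ps\<close> and 1 on the successors reaches the word with
  1 on \<open>ps\<close> and 2 on the successors only by swapping every pair, and swaps have
  coefficient 1.\<close>

lemma pos_op_entry:
  assumes ps: "distinct ps" "set ps \<subseteq> I_idx n" "cyc_succ n ` set ps \<inter> set ps = {}"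
  obtains u b where "u \<in> carrier (tensor_space n)" "pos_op n ps (word_coeff n u) b = 1"
proof -
  interpret matching "cyc_succ n" "set ps"
    using ps inj_on_subset[OF inj_on_cyc_succ ps(2)] by unfold_locales
  define b where "b = (\<lambda>k. k \<in> set ps)"
  let ?c = "flip_pairs (cyc_succ n) (set ps) b"
  define u :: "(int \<Rightarrow> int) \<Rightarrow>\<^sub>0 laurent" where "u = Poly_Mapping.single (word_of n ?c) 1"
  have u: "u \<in> carrier (tensor_space n)"
    by (simp add: u_def word_of_in_words)
  have "word_coeff n u (flip_pairs (cyc_succ n) S b) = 0" if S: "S \<subset> set ps" for S
  proof -
    obtain p where p: "p \<in> set ps" "p \<notin> S"
      using S by blast
    then have "flip_pairs (cyc_succ n) S b p \<noteq> ?c p"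
      using flip_apply[of S p b] flip_apply[of "set ps" p b] S by auto
    then have "word_of n ?c \<noteq> word_of n (flip_pairs (cyc_succ n) S b)"
      using p ps(2) unfolding word_of_eq_iff by blast
    then show ?thesis
      by (simp add: word_coeff_def u_def lookup_single)
  qed
  moreover have "b p \<noteq> b (cyc_succ n p)" if "p \<in> set ps" for p
    using that ps(3) by (auto simp: b_def)
  ultimately have "pos_op n ps (word_coeff n u) b = word_coeff n u ?c"
    using ps by (intro pairs_op_entry) auto
  also have "\<dots> = 1"
    by (simp add: word_coeff_def u_def)
  finally show ?thesis
    using u by (rule that[rotated])
qed

lemma \<theta>_one: "\<theta> 1 = 1"
  using ring_hom_one[OF \<theta>] by simp

text \<open>Given the operator identity, the relation equates two multiples of the operator of
  \<open>w\<close>; at an entry 1 of that operator this becomes an equation of scalars, with nothing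
  left to cancel.\<close>

lemma relation_scalar_iff:
  assumes "v \<in> lists (blob_gens n)" "w \<in> lists (blob_gens n)"
    and "\<And>f b. pos_op n (word_pos n v) f b = \<kappa> * pos_op n (word_pos n w) f b"
    and "distinct (word_pos n w)" "set (word_pos n w) \<subseteq> I_idx n"
      "cyc_succ n ` set (word_pos n w) \<inter> set (word_pos n w) = {}"
  shows "free_hom (1 \<cdot> v - s \<cdot> w) = \<zero>\<^bsub>End_V n\<^esub> \<longleftrightarrow> \<theta> s = \<kappa>"
proof -
  obtain u b where "u \<in> carrier (tensor_space n)" "pos_op n (word_pos n w) (word_coeff n u) b = 1"
    using pos_op_entry[OF assms(4-6)] by blast
  then show ?thesis
    unfolding relation_iff[OF assms(1,2)] assms(3) \<theta>_one by (metis mult_1 mult_1_right)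
qed

lemma relation_holds:
  assumes "v \<in> lists (blob_gens n)" "w \<in> lists (blob_gens n)"
    and "\<And>f. pos_op n (word_pos n v) f = pos_op n (word_pos n w) f"
  shows "free_hom (1 \<cdot> v - 1 \<cdot> w) = \<zero>\<^bsub>End_V n\<^esub>"
  unfolding relation_iff[OF assms(1,2)] assms(3) by simp

end

section \<open>The relations\<close>

definition far :: "nat \<Rightarrow> int list \<Rightarrow> int list \<Rightarrow> bool" where
  "far n ps rs \<longleftrightarrow> (\<forall>p\<in>set ps. \<forall>r\<in>set rs. {p, cyc_succ n p} \<inter> {r, cyc_succ n r} = {})"

lemma pos_op_commute:
  assumes "n \<ge> 1" "set ps \<subseteq> I_idx n" "set rs \<subseteq> I_idx n" "far n ps rs"
  shows "pos_op n ps (pos_op n rs f) = pos_op n rs (pos_op n ps f)"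
proof -
  have single: "pos_op n [p] (pos_op n rs f) = pos_op n rs (pos_op n [p] f)" if p: "p \<in> set ps" for p f
    using assms(3,4)
  proof (induction rs)
    case Nil
    then show ?case by simp
  next
    case (Cons r rs)
    have ne: "p \<noteq> cyc_succ n p" "r \<noteq> cyc_succ n r"
      using cyc_succ_in(2) Cons.prems p assms(2) by (metis subsetD, metis list.set_intros(1) subsetD)
    have disj: "{p, cyc_succ n p} \<inter> {r, cyc_succ n r} = {}"
      using Cons.prems(2) p unfolding far_def by simp
    have "pos_op n [p] (pos_op n rs f) = pos_op n rs (pos_op n [p] f)"
      using Cons by (simp add: far_def)
    then show ?case
      by (simp add: pair_op_commute[OF ne disj])
  qed
  have "pos_op n ps' (pos_op n rs f) = pos_op n rs (pos_op n ps' f)" if "set ps' \<subseteq> set ps" for ps'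
    using that
  proof (induction ps')
    case Nil
    then show ?case by simp
  next
    case (Cons p ps')
    then show ?case
      using single[of p "pos_op n ps' f"] by simp
  qed
  then show ?thesis by simp
qed

text \<open>Sorts a triple product into two independent blocks; repeated use separates the relations
  into checks on neighbouring positions.\<close>

lemma pos_op_interleave:
  assumes "n \<ge> 1" "set (p1 @ p2 @ r1 @ r2) \<subseteq> I_idx n" "far n p2 r1" "far n p2 p1" "far n r2 p1"
  shows "pos_op n (p1 @ p2) (pos_op n (r1 @ r2) (pos_op n (p1 @ p2) f)) =
    pos_op n (p1 @ r1 @ p1) (pos_op n (p2 @ r2 @ p2) f)"
  using assms by (simp add: pos_op_commute[of n p2 r1] pos_op_commute[of n p2 p1] pos_op_commute[of n r2 p1])

lemma pos_op_interleave2: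
  assumes "n \<ge> 1" "set (p1 @ p2) \<subseteq> I_idx n" "far n p2 p1"
  shows "pos_op n (p1 @ p2) (pos_op n (p1 @ p2) f) = pos_op n (p1 @ p1) (pos_op n (p2 @ p2) f)"
  using assms by (simp add: pos_op_commute[of n p2 p1])

lemma pos_op_scale: "pos_op n ps (\<lambda>b. c * f b) = (\<lambda>b. c * pos_op n ps f b)"
  by (induction ps) (simp_all add: pair_op_scale)

lemma pos_op_double:
  assumes "p \<in> I_idx n"
  shows "pos_op n [p, p] f = (\<lambda>b. (pos_par n p + pos_inv n p) * pos_op n [p] f b)"
  using pair_op_square[OF laurent_gen_inverse cyc_succ_in(2)[OF assms, symmetric]] by simp

text \<open>The two orders of the neighbours correspond to the two halves of
  \<open>pair_op_braid\<close>. The three positions involved are distinct because the cycle has at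
  least four.\<close>

lemma pos_op_braid:
  assumes "n \<ge> 1" "p \<in> I_idx n" "r = cyc_succ n p \<or> p = cyc_succ n r" "r \<in> I_idx n" "pos_var n p = pos_var n r"
  shows "pos_op n [p, r, p] f = pos_op n [p] f"
proof -
  have ne: "cyc_succ n q \<noteq> q" "cyc_succ n (cyc_succ n q) \<noteq> q" if "q \<in> I_idx n" for q
    using assms(1) that by (auto simp: cyc_succ_def I_idx_def split: if_splits) presburger+
  from assms(3) show ?thesis
  proof
    assume r: "r = cyc_succ n p"
    have "distinct [p, r, cyc_succ n r]"
      using ne[OF assms(2)] ne[OF assms(4)] r by auto
    from pair_op_braid(1)[OF laurent_gen_inverse this] show ?thesis
      using assms(5) r by simp
  next
    assume p: "p = cyc_succ n r"
    have "distinct [r, p, cyc_succ n p]"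
      using ne[OF assms(2)] ne[OF assms(4)] p by auto
    from pair_op_braid(2)[OF laurent_gen_inverse this] show ?thesis
      using assms(5) p by simp
  qed
qed

lemma pos_op_arc:
  assumes "distinct [p, r, k, cyc_succ n k]" "r = cyc_succ n p" "k = cyc_succ n r"
  shows "pos_op n [p, k, r, p, k] f =
    (\<lambda>b. (pos_par n p * pos_par n k * pos_inv n r + pos_par n r * pos_inv n p * pos_inv n k) * pos_op n [p, k] f b)"
  using pair_op_arc[OF laurent_gen_inverse laurent_gen_inverse assms(1)] assms(2,3) by simp

lemma far_gen_pos:
  assumes "n \<ge> 1" "i \<in> {1..<n}" "j \<in> {1..<n}"
  shows "\<bar>int i - int j\<bar> \<ge> 2 \<Longrightarrow> far n (gen_pos n (Gen_U i)) (gen_pos n (Gen_U j))"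
    and "i \<noteq> 1 \<Longrightarrow> far n (gen_pos n Gen_e) (gen_pos n (Gen_U i))"
    and "i \<noteq> n - 1 \<Longrightarrow> far n (gen_pos n Gen_f) (gen_pos n (Gen_U i))"
  using assms by (auto simp: far_def cyc_succ_def)

lemma far_ef: "n > 1 \<Longrightarrow> far n (gen_pos n Gen_e) (gen_pos n Gen_f)"
  by (auto simp: far_def cyc_succ_def)

section \<open>Relations checked on neighbouring positions\<close>

lemma pos_op_U_square:
  assumes "n \<ge> 1" "i \<in> {1..<n}"
  shows "pos_op n (word_pos n [Gen_U i, Gen_U i]) f b =
    ((\<a> + laurent_inv Var_a) * (\<b> + laurent_inv Var_b) * (\<c> + laurent_inv Var_c) * (\<d> + laurent_inv Var_d))
      * pos_op n (word_pos n [Gen_U i]) f b"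
proof -
  let ?p1 = "- int n - int i" and ?p2 = "- int n + int i" and ?p3 = "int n - int i" and ?p4 = "int n + int i"
  have p_in: "?p1 \<in> I_idx n" "?p2 \<in> I_idx n" "?p3 \<in> I_idx n" "?p4 \<in> I_idx n"
    using assms by (auto simp: I_idx_def)
  have far: "far n [?p2, ?p3, ?p4] [?p1]" "far n [?p3, ?p4] [?p2]" "far n [?p4] [?p3]"
    using assms by (auto simp: far_def cyc_succ_def)
  have var: "pos_var n ?p1 = Var_a" "pos_var n ?p2 = Var_b" "pos_var n ?p3 = Var_c" "pos_var n ?p4 = Var_d"
    using assms by (auto simp: pos_var_def)
  have "pos_op n (word_pos n [Gen_U i, Gen_U i]) f =
      pos_op n [?p1, ?p1] (pos_op n [?p2, ?p2] (pos_op n [?p3, ?p3] (pos_op n [?p4, ?p4] f)))"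
    using pos_op_interleave2[OF assms(1) _ far(1), of f] pos_op_interleave2[OF assms(1) _ far(2), of f]
      pos_op_interleave2[OF assms(1) _ far(3), of f] p_in by simp
  then show ?thesis
    unfolding pos_op_double[OF p_in(1)] pos_op_double[OF p_in(2)] pos_op_double[OF p_in(3)]
      pos_op_double[OF p_in(4)] pos_op_scale var
    by (simp add: \<a>_def \<b>_def \<c>_def \<d>_def mult.assoc)
qed

lemma pos_op_e_square:
  assumes "n \<ge> 1"
  shows "pos_op n (word_pos n [Gen_e, Gen_e]) f b =
    ((\<x> + laurent_inv Var_x) * (\<y> + laurent_inv Var_y)) * pos_op n (word_pos n [Gen_e]) f b"
proof -
  have p_in: "- int n \<in> I_idx n" "int n \<in> I_idx n"
    using assms by (auto simp: I_idx_def)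
  have far: "far n [int n] [- int n]"
    using assms by (auto simp: far_def cyc_succ_def)
  have var: "pos_var n (- int n) = Var_x" "pos_var n (int n) = Var_y"
    using assms by (auto simp: pos_var_def)
  have "pos_op n (word_pos n [Gen_e, Gen_e]) f = pos_op n [- int n, - int n] (pos_op n [int n, int n] f)"
    using pos_op_interleave2[OF assms(1) _ far, of f] p_in by simp
  then show ?thesis
    unfolding pos_op_double[OF p_in(1)] pos_op_double[OF p_in(2)] pos_op_scale var
    by (simp add: \<x>_def \<y>_def mult.assoc)
qed

lemma pos_op_f_square:
  assumes "n \<ge> 1"
  shows "pos_op n (word_pos n [Gen_f, Gen_f]) f b =
    ((\<z> + laurent_inv Var_z) * (\<w> + laurent_inv Var_w)) * pos_op n (word_pos n [Gen_f]) f b"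
proof -
  have p_in: "0 \<in> I_idx n" "2 * int n \<in> I_idx n"
    using assms by (auto simp: I_idx_def)
  have far: "far n [2 * int n] [0]"
    using assms by (auto simp: far_def cyc_succ_def)
  have var: "pos_var n 0 = Var_z" "pos_var n (2 * int n) = Var_w"
    using assms by (auto simp: pos_var_def)
  have "pos_op n (word_pos n [Gen_f, Gen_f]) f = pos_op n [0, 0] (pos_op n [2 * int n, 2 * int n] f)"
    using pos_op_interleave2[OF assms(1) _ far, of f] p_in by simp
  then show ?thesis
    unfolding pos_op_double[OF p_in(1)] pos_op_double[OF p_in(2)] pos_op_scale var
    by (simp add: \<z>_def \<w>_def mult.assoc)
qed

text \<open>Passing from i to j moves each of the four positions by one, inside a gap with a
  constant variable; the relation splits into four independent Temperley-Lieb relations.\<close>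

lemma pos_op_UUU:
  assumes "n \<ge> 1" "i \<in> {1..<n}" "j \<in> {1..<n}" "\<bar>int i - int j\<bar> = 1"
  shows "pos_op n (word_pos n [Gen_U i, Gen_U j, Gen_U i]) f = pos_op n (word_pos n [Gen_U i]) f"
proof -
  let ?p1 = "- int n - int i" and ?p2 = "- int n + int i" and ?p3 = "int n - int i" and ?p4 = "int n + int i"
  let ?r1 = "- int n - int j" and ?r2 = "- int n + int j" and ?r3 = "int n - int j" and ?r4 = "int n + int j"
  have p_in: "?p1 \<in> I_idx n" "?p2 \<in> I_idx n" "?p3 \<in> I_idx n" "?p4 \<in> I_idx n"
    "?r1 \<in> I_idx n" "?r2 \<in> I_idx n" "?r3 \<in> I_idx n" "?r4 \<in> I_idx n"
    using assms(1-3) by (auto simp: I_idx_def)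
  have bounds: "int i \<ge> 1" "int j \<ge> 1" "int i \<le> int n - 1" "int j \<le> int n - 1"
      "int i \<le> int j + 1" "int j \<le> int i + 1"
    using assms by auto
  have far: "far n [?p2, ?p3, ?p4] [?r1]" "far n [?p2, ?p3, ?p4] [?p1]" "far n [?r2, ?r3, ?r4] [?p1]"
    "far n [?p3, ?p4] [?r2]" "far n [?p3, ?p4] [?p2]" "far n [?r3, ?r4] [?p2]"
    "far n [?p4] [?r3]" "far n [?p4] [?p3]" "far n [?r4] [?p3]"
    using bounds by (auto simp: far_def cyc_succ_def)
  have braid: "pos_op n [?p1, ?r1, ?p1] f = pos_op n [?p1] f" "pos_op n [?p2, ?r2, ?p2] f = pos_op n [?p2] f"
    "pos_op n [?p3, ?r3, ?p3] f = pos_op n [?p3] f" "pos_op n [?p4, ?r4, ?p4] f = pos_op n [?p4] f" for f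
    using assms p_in by (intro pos_op_braid; auto simp: cyc_succ_def pos_var_def)+
  have "pos_op n (word_pos n [Gen_U i, Gen_U j, Gen_U i]) f =
    pos_op n [?p1, ?r1, ?p1] (pos_op n [?p2, ?r2, ?p2] (pos_op n [?p3, ?r3, ?p3] (pos_op n [?p4, ?r4, ?p4] f)))"
    using pos_op_interleave[OF assms(1) _ far(1-3), of f] pos_op_interleave[OF assms(1) _ far(4-6), of f]
      pos_op_interleave[OF assms(1) _ far(7-9), of f] p_in by simp
  then show ?thesis
    unfolding braid by simp
qed

text \<open>\<open>e\<close> acts at -n, between the positions -n - 1 and -n + 1 of U_1, and at n,
  between n - 1 and n + 1. Each of these two arcs yields one factor of the scalar.\<close>

lemma pos_op_UeU:
  assumes "n > 1"
  shows "pos_op n (word_pos n [Gen_U 1, Gen_e, Gen_U 1]) f b =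
    ((\<a> * \<b> * laurent_inv Var_x + \<x> * (laurent_inv Var_a * laurent_inv Var_b))
      * (\<c> * \<d> * laurent_inv Var_y + \<y> * (laurent_inv Var_c * laurent_inv Var_d)))
      * pos_op n (word_pos n [Gen_U 1]) f b"
proof -
  let ?p1 = "- int n - 1" and ?p2 = "- int n + 1" and ?p3 = "int n - 1" and ?p4 = "int n + 1"
  have n: "n \<ge> 1" using assms by simp
  have p_in: "?p1 \<in> I_idx n" "?p2 \<in> I_idx n" "?p3 \<in> I_idx n" "?p4 \<in> I_idx n" "- int n \<in> I_idx n" "int n \<in> I_idx n"
    using assms by (auto simp: I_idx_def)
  have far: "far n [?p3, ?p4] [- int n]" "far n [?p3, ?p4] [?p1, ?p2]" "far n [int n] [?p1, ?p2]"
    using assms by (auto simp: far_def cyc_succ_def)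
  have var: "pos_var n ?p1 = Var_a" "pos_var n ?p2 = Var_b" "pos_var n ?p3 = Var_c" "pos_var n ?p4 = Var_d"
    "pos_var n (- int n) = Var_x" "pos_var n (int n) = Var_y"
    using assms by (auto simp: pos_var_def)
  have arc: "pos_op n [?p1, ?p2, - int n, ?p1, ?p2] f = (\<lambda>b. (pos_par n ?p1 * pos_par n ?p2 * pos_inv n (- int n)
        + pos_par n (- int n) * pos_inv n ?p1 * pos_inv n ?p2) * pos_op n [?p1, ?p2] f b)"
      "pos_op n [?p3, ?p4, int n, ?p3, ?p4] f = (\<lambda>b. (pos_par n ?p3 * pos_par n ?p4 * pos_inv n (int n)
        + pos_par n (int n) * pos_inv n ?p3 * pos_inv n ?p4) * pos_op n [?p3, ?p4] f b)" for f
    using assms by (intro pos_op_arc; auto simp: cyc_succ_def)+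
  have "pos_op n (word_pos n [Gen_U 1, Gen_e, Gen_U 1]) f
      = pos_op n [?p1, ?p2, - int n, ?p1, ?p2] (pos_op n [?p3, ?p4, int n, ?p3, ?p4] f)"
    using pos_op_interleave[OF n _ far, of f] p_in by simp
  then show ?thesis
    unfolding arc pos_op_scale var
    by (simp add: \<a>_def \<b>_def \<c>_def \<d>_def \<x>_def \<y>_def mult.assoc)
qed

text \<open>The arcs are now centred at 0 and at 2n. The second crosses the end of the index range,
  from 2n - 1 with variable a d-type parameter to -2n + 1 with parameter a; this is why a and d are
  combined with w.\<close>

lemma pos_op_UfU:
  assumes "n > 1"
  shows "pos_op n (word_pos n [Gen_U (n - 1), Gen_f, Gen_U (n - 1)]) f b =
    ((\<a> * \<d> * laurent_inv Var_w + \<w> * (laurent_inv Var_a * laurent_inv Var_d))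
      * (\<b> * \<c> * laurent_inv Var_z + \<z> * (laurent_inv Var_b * laurent_inv Var_c)))
      * pos_op n (word_pos n [Gen_U (n - 1)]) f b"
proof -
  let ?p1 = "- 2 * int n + 1" and ?p2 = "- 1 :: int" and ?p3 = "1 :: int" and ?p4 = "2 * int n - 1"
  have n: "n \<ge> 1" using assms by simp
  have p_in: "?p1 \<in> I_idx n" "?p2 \<in> I_idx n" "?p3 \<in> I_idx n" "?p4 \<in> I_idx n" "0 \<in> I_idx n" "2 * int n \<in> I_idx n"
    using assms by (auto simp: I_idx_def)
  have far: "far n [?p4, ?p1] [0]" "far n [?p4, ?p1] [?p2, ?p3]" "far n [2 * int n] [?p2, ?p3]"
      "far n [?p1] [?p2, ?p3, ?p4]"
    using assms by (auto simp: far_def cyc_succ_def)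
  have var: "pos_var n ?p1 = Var_a" "pos_var n ?p2 = Var_b" "pos_var n ?p3 = Var_c" "pos_var n ?p4 = Var_d"
    "pos_var n 0 = Var_z" "pos_var n (2 * int n) = Var_w"
    using assms by (auto simp: pos_var_def)
  have arc: "pos_op n [?p2, ?p3, 0, ?p2, ?p3] f = (\<lambda>b. (pos_par n ?p2 * pos_par n ?p3 * pos_inv n 0
        + pos_par n 0 * pos_inv n ?p2 * pos_inv n ?p3) * pos_op n [?p2, ?p3] f b)"
      "pos_op n [?p4, ?p1, 2 * int n, ?p4, ?p1] f = (\<lambda>b. (pos_par n ?p4 * pos_par n ?p1 * pos_inv n (2 * int n)
        + pos_par n (2 * int n) * pos_inv n ?p4 * pos_inv n ?p1) * pos_op n [?p4, ?p1] f b)" for f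
    using assms by (intro pos_op_arc; auto simp: cyc_succ_def)+
  have gen: "gen_pos n (Gen_U (n - 1)) = [?p1] @ [?p2, ?p3, ?p4]"
    using assms by (simp add: of_nat_diff)
  \<comment> \<open>\<open>gen_pos\<close> lists \<open>?p1\<close> first; it is moved to the end
    because on the cycle it comes after \<open>?p4\<close> and 2n.\<close>
  have rotate: "pos_op n (gen_pos n (Gen_U (n - 1))) f = pos_op n ([?p2, ?p3] @ [?p4, ?p1]) f" for f
    unfolding gen using pos_op_commute[OF n _ _ far(4), of f] p_in by simp
  have "pos_op n (word_pos n [Gen_U (n - 1), Gen_f, Gen_U (n - 1)]) f =
      pos_op n ([?p2, ?p3] @ [?p4, ?p1]) (pos_op n ([0] @ [2 * int n]) (pos_op n ([?p2, ?p3] @ [?p4, ?p1]) f))"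
    unfolding rotate[symmetric] by (simp del: gen_pos.simps(1))
  also have "\<dots> = pos_op n [?p2, ?p3, 0, ?p2, ?p3] (pos_op n [?p4, ?p1, 2 * int n, ?p4, ?p1] f)"
    using pos_op_interleave[OF n _ far(1-3), of f] p_in by simp
  finally have eq: "pos_op n (word_pos n [Gen_U (n - 1), Gen_f, Gen_U (n - 1)]) f = \<dots>" .
  have "pos_op n (word_pos n [Gen_U (n - 1)]) f = pos_op n [?p2, ?p3] (pos_op n [?p4, ?p1] f)"
    using rotate[of f] by (simp del: gen_pos.simps)
  then show ?thesis
    unfolding eq arc pos_op_scale var
    by (simp add: \<a>_def \<b>_def \<c>_def \<d>_def \<z>_def \<w>_def ac_simps)
qed

section \<open>The parity classes and the relations for IJI and JIJ\<close>

definition parity_class :: "nat \<Rightarrow> int \<Rightarrow> int set" where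
  "parity_class n c = {p \<in> I_idx n. even (p - c)}"

text \<open>The parity also changes at the step from 2n to -2n + 1, because the cycle has even
  length.\<close>

lemma cyc_succ_parity: "even (cyc_succ n p - c) \<longleftrightarrow> odd (p - c)"
  by (auto simp: cyc_succ_def)

lemma cyc_succ_surj:
  assumes "p \<in> I_idx n"
  obtains r where "r \<in> I_idx n" "p = cyc_succ n r"
proof (cases "p = - 2 * int n + 1")
  case True
  then show ?thesis
    using assms by (intro that[of "2 * int n"]) (auto simp: I_idx_def cyc_succ_def)
next
  case False
  then show ?thesis
    using assms by (intro that[of "p - 1"]) (auto simp: I_idx_def cyc_succ_def)
qed

lemma parity_class_image: "cyc_succ n ` parity_class n c = parity_class n (c + 1)"
proof
  have parity: "even (cyc_succ n p - (c + 1)) \<longleftrightarrow> even (p - c)" for p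
    using cyc_succ_parity[of n p "c + 1"] by presburger
  show "cyc_succ n ` parity_class n c \<subseteq> parity_class n (c + 1)"
    unfolding parity_class_def using parity cyc_succ_in(1) by blast
  show "parity_class n (c + 1) \<subseteq> cyc_succ n ` parity_class n c"
  proof
    fix p assume p: "p \<in> parity_class n (c + 1)"
    then obtain r where "r \<in> I_idx n" "p = cyc_succ n r"
      using cyc_succ_surj unfolding parity_class_def by blast
    with p parity show "p \<in> cyc_succ n ` parity_class n c"
      unfolding parity_class_def by blast
  qed
qed

lemma parity_class_add_2: "parity_class n (c + 1 + 1) = parity_class n c"
  by (auto simp: parity_class_def)

text \<open>Steps of two lead from any point of \<open>S\<close> to the top, then around to the
  bottom, and from there up through the whole class.\<close>

lemma parity_class_cycle:
  assumes n: "n \<ge> 1" and S: "S \<subseteq> parity_class n c" "S \<noteq> {}"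
    and closed: "\<And>p. p \<in> S \<Longrightarrow> cyc_succ n (cyc_succ n p) \<in> S"
  shows "S = parity_class n c"
proof
  have S_I: "p \<in> I_idx n" "even (p - c)" if "p \<in> S" for p
    using that S(1) by (auto simp: parity_class_def)
  have up: "p + 2 * int k \<in> S" if "p \<in> S" "p + 2 * int k \<le> 2 * int n" for p k
    using that(2)
  proof (induction k)
    case 0
    then show ?case using that(1) by simp
  next
    case (Suc k)
    then have "p + 2 * int k \<in> S" "p + 2 * int k + 2 \<le> 2 * int n" by auto
    then show ?case
      using closed[of "p + 2 * int k"] by (auto simp: cyc_succ_def algebra_simps split: if_splits)
  qed
  show "parity_class n c \<subseteq> S"
  proof
    fix r assume "r \<in> parity_class n c"
    then have r: "r \<in> I_idx n" "even (r - c)"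
      by (auto simp: parity_class_def)
    obtain p where p: "p \<in> S"
      using S(2) by blast
    have p_range: "- 2 * int n + 1 \<le> p" "p \<le> 2 * int n"
      using S_I(1)[OF p] by (auto simp: I_idx_def)
    have "\<exists>t\<in>S. 2 * int n - 1 \<le> t"
      using up[OF p, of "nat ((2 * int n - p) div 2)"] p_range by (intro bexI[of _ "p + 2 * ((2 * int n - p) div 2)"]) auto
    then obtain t where t: "t \<in> S" "2 * int n - 1 \<le> t"
      by blast
    then have "t = 2 * int n - 1 \<or> t = 2 * int n"
      using S_I(1)[OF t(1)] by (auto simp: I_idx_def)
    \<comment> \<open>Both possible top values wrap to the least element of the class: 2n to -2n +
      2, and 2n - 1 to -2n + 1.\<close>
    then have low: "t - 4 * int n + 2 \<in> S"
      using closed[OF t(1)] n by (auto simp: cyc_succ_def)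
    have even_diff: "even (r - (t - 4 * int n + 2))"
      using S_I(2)[OF low] r(2) by presburger
    \<comment> \<open>The range gives only r \<ge> -2n + 1, whereas the least element may be -2n +
      2; the common parity then removes the 1.\<close>
    have "t - 4 * int n + 2 \<le> r + 1"
      using t S_I(1)[OF t(1)] r(1) by (auto simp: I_idx_def)
    then have "t - 4 * int n + 2 \<le> r"
      using even_diff by presburger
    then have "(t - 4 * int n + 2) + 2 * int (nat ((r - (t - 4 * int n + 2)) div 2)) = r"
      using even_diff by simp
    then show "r \<in> S"
      using up[OF low, of "nat ((r - (t - 4 * int n + 2)) div 2)"] r(1) by (simp add: I_idx_def)
  qed
qed (rule S(1))

lemma matching_parity_class: "matching (cyc_succ n) (parity_class n c)"
proof
  show "cyc_succ n ` parity_class n c \<inter> parity_class n c = {}"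
    unfolding parity_class_image by (auto simp: parity_class_def)
  show "inj_on (cyc_succ n) (parity_class n c)"
    by (rule inj_on_subset[OF inj_on_cyc_succ]) (auto simp: parity_class_def)
qed

lemma alternating_parity_class:
  assumes "n \<ge> 1"
  shows "alternating (cyc_succ n) (parity_class n c) (parity_class n (c + 1))"
proof -
  interpret matching "cyc_succ n" "parity_class n c"
    by (rule matching_parity_class)
  show ?thesis
  proof
    show "cyc_succ n ` parity_class n c = parity_class n (c + 1)"
      by (rule parity_class_image)
    show "cyc_succ n ` parity_class n (c + 1) = parity_class n c"
      unfolding parity_class_image parity_class_add_2 ..
    show "finite (parity_class n c)"
      by (rule finite_subset[of _ "I_idx n"]) (auto simp: parity_class_def I_idx_def)
    have "2 * int n \<in> parity_class n c \<or> 2 * int n - 1 \<in> parity_class n c"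
      using assms by (auto simp: parity_class_def I_idx_def)
    then show "parity_class n c \<noteq> {}"
      by blast
  qed (rule parity_class_cycle[OF assms])
qed

lemma alternating_pair_parity_class:
  assumes "n \<ge> 1"
  shows "alternating_pair (cyc_succ n) (parity_class n (c + 1)) (parity_class n c) (pos_par n) (pos_inv n)"
proof -
  interpret A: alternating "cyc_succ n" "parity_class n (c + 1)" "parity_class n c"
    using alternating_parity_class[OF assms, of "c + 1"] by (simp only: parity_class_add_2)
  interpret B: alternating "cyc_succ n" "parity_class n c" "parity_class n (c + 1)"
    by (rule alternating_parity_class[OF assms])
  show ?thesis
    by unfold_locales (rule laurent_gen_inverse)
qed

lemma word_pos_distinct:
  assumes "distinct w" "set w \<subseteq> blob_gens n" "n \<ge> 1"
  shows "distinct (word_pos n w)"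
  using assms(1,2)
proof (induction w)
  case Nil
  then show ?case by simp
next
  case (Cons g w)
  have "distinct (gen_pos n g)"
    using Cons.prems assms(3) by (cases g) auto
  moreover have "set (gen_pos n g) \<inter> set (gen_pos n h) = {}" if h: "h \<in> set w" for h
  proof -
    have "g \<noteq> h" "g \<in> blob_gens n" "h \<in> blob_gens n"
      using h Cons.prems by auto
    then show ?thesis
      using assms(3) by (cases g; cases h) auto
  qed
  ultimately show ?case
    using Cons by (auto simp: word_pos_def)
qed

lemma distinct_blob_IJ: "distinct (blob_I n)" "distinct (blob_J n)"
  by (auto simp: blob_I_def blob_J_def distinct_map inj_on_def)

text \<open>A position away from those of \<open>e\<close> and \<open>f\<close> lies at a distance i
  from -n or n with 1 \<le> i < n, so it belongs to U_i. The parity of i is that of p - n, which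
  separates I from J.\<close>

lemma word_pos_blob_I:
  assumes "n \<ge> 1"
  shows "set (word_pos n (blob_I n)) = parity_class n (int n + 1)"
proof
  show "set (word_pos n (blob_I n)) \<subseteq> parity_class n (int n + 1)"
    using assms by (auto simp: word_pos_def blob_I_def parity_class_def I_idx_def split: if_splits)
  show "parity_class n (int n + 1) \<subseteq> set (word_pos n (blob_I n))"
  proof
    fix p assume "p \<in> parity_class n (int n + 1)"
    then have p: "- 2 * int n + 1 \<le> p" "p \<le> 2 * int n" "odd (p - int n)"
      by (auto simp: parity_class_def I_idx_def)
    have U: "p \<in> set (word_pos n (blob_I n))"
      if "i \<in> {1..<n}" "odd i" "p \<in> set (gen_pos n (Gen_U i))" for i
      using that by (auto simp: word_pos_def blob_I_def simp del: gen_pos.simps)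
    have ne: "p \<noteq> - int n" "p \<noteq> int n"
      using p(3) by auto
    consider "p < - int n" | "- int n < p" "p < 0" | "p = 0" | "0 < p" "p < int n"
      | "int n < p" "p < 2 * int n" | "p = 2 * int n"
      using p ne by linarith
    then show "p \<in> set (word_pos n (blob_I n))"
    proof cases
      case 1
      then show ?thesis using p by (intro U[of "nat (- int n - p)"]) (auto simp: even_nat_iff)
    next
      case 2
      then show ?thesis using p by (intro U[of "nat (p + int n)"]) (auto simp: even_nat_iff)
    next
      case 4
      then show ?thesis using p by (intro U[of "nat (int n - p)"]) (auto simp: even_nat_iff)
    next
      case 5
      then show ?thesis using p by (intro U[of "nat (p - int n)"]) (auto simp: even_nat_iff)
    qed (use p in \<open>auto simp: word_pos_def blob_I_def\<close>)
  qed
qed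

lemma word_pos_blob_J:
  assumes "n \<ge> 1"
  shows "set (word_pos n (blob_J n)) = parity_class n (int n)"
proof
  show "set (word_pos n (blob_J n)) \<subseteq> parity_class n (int n)"
    using assms by (auto simp: word_pos_def blob_J_def parity_class_def I_idx_def split: if_splits)
  show "parity_class n (int n) \<subseteq> set (word_pos n (blob_J n))"
  proof
    fix p assume "p \<in> parity_class n (int n)"
    then have p: "- 2 * int n + 1 \<le> p" "p \<le> 2 * int n" "even (p - int n)"
      by (auto simp: parity_class_def I_idx_def)
    have U: "p \<in> set (word_pos n (blob_J n))"
      if "i \<in> {1..<n}" "even i" "p \<in> set (gen_pos n (Gen_U i))" for i
      using that by (auto simp: word_pos_def blob_J_def simp del: gen_pos.simps)
    consider "p < - int n" | "p = - int n \<or> p = int n" | "- int n < p" "p < 0" | "p = 0" | "0 < p" "p < int n"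
      | "int n < p" "p < 2 * int n" | "p = 2 * int n"
      using p by linarith
    then show "p \<in> set (word_pos n (blob_J n))"
    proof cases
      case 1
      then show ?thesis using p by (intro U[of "nat (- int n - p)"]) (auto simp: even_nat_iff)
    next
      case 3
      then show ?thesis using p by (intro U[of "nat (p + int n)"]) (auto simp: even_nat_iff)
    next
      case 5
      then show ?thesis using p by (intro U[of "nat (int n - p)"]) (auto simp: even_nat_iff)
    next
      case 6
      then show ?thesis using p by (intro U[of "nat (p - int n)"]) (auto simp: even_nat_iff)
    qed (use p in \<open>auto simp: word_pos_def blob_J_def\<close>)
  qed
qed

lemma length_filter_parity:
  "length (filter odd [1..<n]) = n div 2" "length (filter even [1..<n]) = (n - 1) div 2"
proof -
  have "length (filter odd [1..<n]) = n div 2 \<and> length (filter even [1..<n]) = (n - 1) div 2"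
  proof (induction n)
    case (Suc n)
    then show ?case by (cases n) auto
  qed simp
  then show "length (filter odd [1..<n]) = n div 2" "length (filter even [1..<n]) = (n - 1) div 2"
    by auto
qed

lemma prod_list_gens_U:
  fixes h :: "laurent_var \<Rightarrow> laurent"
  assumes "set is \<subseteq> {1..<n}"
  shows "(\<Prod>p\<leftarrow>word_pos n (map Gen_U is). h (pos_var n p)) = (h Var_a * h Var_b * h Var_c * h Var_d) ^ length is"
  using assms by (induction "is") (auto simp: pos_var_def mult.assoc)

text \<open>The map \<open>h\<close> is left open so that one computation serves for the variables
  and for their inverses.\<close>

lemma prod_word_pos:
  fixes h :: "laurent_var \<Rightarrow> laurent"
  assumes "n \<ge> 1"
  shows "(\<Prod>p\<in>parity_class n (int n + 1). h (pos_var n p)) =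
      (h Var_a * h Var_b * h Var_c * h Var_d) ^ (n div 2) * (if odd n then h Var_z * h Var_w else 1)"
    and "(\<Prod>p\<in>parity_class n (int n). h (pos_var n p)) =
      h Var_x * h Var_y * (h Var_a * h Var_b * h Var_c * h Var_d) ^ ((n - 1) div 2)
        * (if even n then h Var_z * h Var_w else 1)"
proof -
  have f: "(\<Prod>p\<leftarrow>gen_pos n Gen_f. h (pos_var n p)) = h Var_z * h Var_w"
    and e: "(\<Prod>p\<leftarrow>gen_pos n Gen_e. h (pos_var n p)) = h Var_x * h Var_y"
    using assms by (auto simp: pos_var_def)
  have U: "(\<Prod>p\<leftarrow>word_pos n (map Gen_U (filter P [1..<n])). h (pos_var n p))
    = (h Var_a * h Var_b * h Var_c * h Var_d) ^ length (filter P [1..<n])" for P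
    by (rule prod_list_gens_U) auto
  show "(\<Prod>p\<in>parity_class n (int n + 1). h (pos_var n p)) =
      (h Var_a * h Var_b * h Var_c * h Var_d) ^ (n div 2) * (if odd n then h Var_z * h Var_w else 1)"
    unfolding word_pos_blob_I[OF assms, symmetric]
      prod.distinct_set_conv_list[OF word_pos_distinct[OF distinct_blob_IJ(1) blob_IJ_closed(1) assms]]
    by (simp add: blob_I_def U f length_filter_parity del: gen_pos.simps One_nat_def)
  show "(\<Prod>p\<in>parity_class n (int n). h (pos_var n p)) =
      h Var_x * h Var_y * (h Var_a * h Var_b * h Var_c * h Var_d) ^ ((n - 1) div 2)
        * (if even n then h Var_z * h Var_w else 1)"
    unfolding word_pos_blob_J[OF assms, symmetric]
      prod.distinct_set_conv_list[OF word_pos_distinct[OF distinct_blob_IJ(2) blob_IJ_closed(2) assms]]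
    by (simp add: blob_J_def U f e length_filter_parity mult.assoc del: gen_pos.simps One_nat_def)
qed

text \<open>The inverses are written out and bracketed as \<open>unit_div_eq\<close> produces them
  from the fractions of the theorem.\<close>

definition K_value :: "nat \<Rightarrow> laurent" where
  "K_value n =
     (if odd n
      then \<x> * \<y> * (laurent_inv Var_z * laurent_inv Var_w) + 2 + \<z> * \<w> * (laurent_inv Var_x * laurent_inv Var_y)
      else \<a> * \<b> * \<c> * \<d> * (laurent_inv Var_x * laurent_inv Var_y * laurent_inv Var_z * laurent_inv Var_w) + 2
         + \<x> * \<y> * \<z> * \<w> * (laurent_inv Var_a * laurent_inv Var_b * laurent_inv Var_c * laurent_inv Var_d))"

text \<open>I contains n div 2 of the U_i and J contains (n - 1) div 2, each contributing a b c d.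
  For odd n these powers cancel, and for even n one factor a b c d remains.\<close>

lemma K_value_eq:
  assumes "n \<ge> 1"
  shows "(\<Prod>p\<in>parity_class n (int n + 1). pos_par n p) * (\<Prod>p\<in>parity_class n (int n). pos_inv n p) + 2
    + (\<Prod>p\<in>parity_class n (int n). pos_par n p) * (\<Prod>p\<in>parity_class n (int n + 1). pos_inv n p) = K_value n"
proof -
  define g where "g = laurent_gen Var_a * laurent_gen Var_b * laurent_gen Var_c * laurent_gen Var_d"
  define h where "h = laurent_inv Var_a * laurent_inv Var_b * laurent_inv Var_c * laurent_inv Var_d"
  have "g * h = (laurent_gen Var_a * laurent_inv Var_a) * (laurent_gen Var_b * laurent_inv Var_b)
      * (laurent_gen Var_c * laurent_inv Var_c) * (laurent_gen Var_d * laurent_inv Var_d)"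
    unfolding g_def h_def by (simp only: ac_simps)
  then have "g * h = 1"
    by (simp add: laurent_gen_inverse)
  then have gh: "g ^ m * h ^ m = 1" for m
    by (simp flip: power_mult_distrib)
  note prods = prod_word_pos[OF assms, of laurent_gen, folded g_def] prod_word_pos[OF assms, of laurent_inv, folded h_def]
  show ?thesis
  proof (cases "odd n")
    case True
    then have "(n - 1) div 2 = n div 2" by (metis odd_two_times_div_two_nat nonzero_mult_div_cancel_left zero_neq_numeral)
    define m where "m = n div 2"
    have "g ^ m * (laurent_gen Var_z * laurent_gen Var_w) * (laurent_inv Var_x * laurent_inv Var_y * h ^ m)
        = (g ^ m * h ^ m) * (\<z> * \<w> * (laurent_inv Var_x * laurent_inv Var_y))"
      unfolding \<z>_def \<w>_def by (simp only: ac_simps)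
    moreover have "laurent_gen Var_x * laurent_gen Var_y * g ^ m * (h ^ m * (laurent_inv Var_z * laurent_inv Var_w))
        = (g ^ m * h ^ m) * (\<x> * \<y> * (laurent_inv Var_z * laurent_inv Var_w))"
      unfolding \<x>_def \<y>_def by (simp only: ac_simps)
    ultimately show ?thesis
      using True \<open>(n - 1) div 2 = n div 2\<close>
      unfolding prods K_value_def by (simp add: gh m_def[symmetric])
  next
    case False
    define m where "m = (n - 1) div 2"
    have m: "n div 2 = Suc m"
      using False assms unfolding m_def by presburger
    have "g ^ Suc m * (laurent_inv Var_x * laurent_inv Var_y * h ^ m * (laurent_inv Var_z * laurent_inv Var_w))
        = (g ^ m * h ^ m) * (g * (laurent_inv Var_x * laurent_inv Var_y * laurent_inv Var_z * laurent_inv Var_w))"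
      by (simp only: ac_simps power_Suc)
    moreover have "laurent_gen Var_x * laurent_gen Var_y * g ^ m * (laurent_gen Var_z * laurent_gen Var_w) * h ^ Suc m
        = (g ^ m * h ^ m) * (\<x> * \<y> * \<z> * \<w> * h)"
      unfolding \<x>_def \<y>_def \<z>_def \<w>_def by (simp only: ac_simps power_Suc)
    ultimately show ?thesis
      using False
      unfolding prods K_value_def m m_def[symmetric]
      by (simp add: gh del: power_Suc) (simp add: g_def h_def \<a>_def \<b>_def \<c>_def \<d>_def)
  qed
qed

lemma pos_op_IJI:
  assumes "n \<ge> 1"
  shows "pos_op n (word_pos n (blob_I n @ blob_J n @ blob_I n)) f b = K_value n * pos_op n (word_pos n (blob_I n)) f b"
    and "pos_op n (word_pos n (blob_J n @ blob_I n @ blob_J n)) f b = K_value n * pos_op n (word_pos n (blob_J n)) f b"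
proof -
  note I = word_pos_distinct[OF distinct_blob_IJ(1) blob_IJ_closed(1) assms] word_pos_blob_I[OF assms]
  note J = word_pos_distinct[OF distinct_blob_IJ(2) blob_IJ_closed(2) assms] word_pos_blob_J[OF assms]
  interpret A: alternating_pair "cyc_succ n" "parity_class n (int n + 1)" "parity_class n (int n)"
    "pos_par n" "pos_inv n"
    by (rule alternating_pair_parity_class[OF assms])
  interpret B: alternating_pair "cyc_succ n" "parity_class n (int n)" "parity_class n (int n + 1)"
    "pos_par n" "pos_inv n"
    using alternating_pair_parity_class[OF assms, of "int n + 1"] by (simp only: parity_class_add_2)
  show "pos_op n (word_pos n (blob_I n @ blob_J n @ blob_I n)) f b = K_value n * pos_op n (word_pos n (blob_I n)) f b"
    using A.pairs_op_sandwich[OF I J, of f b] K_value_eq[OF assms] by simp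
  have "(\<Prod>p\<in>parity_class n (int n). pos_par n p) * (\<Prod>p\<in>parity_class n (int n + 1). pos_inv n p) + 2
    + (\<Prod>p\<in>parity_class n (int n + 1). pos_par n p) * (\<Prod>p\<in>parity_class n (int n). pos_inv n p) = K_value n"
    unfolding K_value_eq[OF assms, symmetric] by (simp only: ac_simps)
  then show "pos_op n (word_pos n (blob_J n @ blob_I n @ blob_J n)) f b = K_value n * pos_op n (word_pos n (blob_J n)) f b"
    using B.pairs_op_sandwich[OF J I, of f b] by simp
qed

section \<open>Conditions on the parameters\<close>

context R_assignment
begin

lemma relation_word_scalar_iff:
  assumes "distinct w" "set w \<subseteq> blob_gens n"
    and "\<And>p r. p \<in> set (word_pos n w) \<Longrightarrow> r \<in> set (word_pos n w) \<Longrightarrow> cyc_succ n p \<noteq> r"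
    and "\<And>f b. pos_op n (word_pos n v) f b = \<kappa> * pos_op n (word_pos n w) f b" "v \<in> lists (blob_gens n)"
  shows "free_hom (1 \<cdot> v - s \<cdot> w) = \<zero>\<^bsub>End_V n\<^esub> \<longleftrightarrow> \<theta> s = \<kappa>"
proof (rule relation_scalar_iff)
  show "set (word_pos n w) \<subseteq> I_idx n"
    using gen_pos_in[OF n] assms(2) by (fastforce simp: word_pos_def)
  show "cyc_succ n ` set (word_pos n w) \<inter> set (word_pos n w) = {}"
    using assms(3) by blast
qed (use assms word_pos_distinct n in auto)

text \<open>Relations without parameters hold identically, the others give one condition each, the
  same for IJI and JIJ. The parameters \<D>, \<open>\<K>\<^sub>L\<close> and
  \<open>\<K>\<^sub>R\<close> occur only in relations with some U_i, which exist for n \<ge>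
  2.\<close>

lemma relations_iff:
  "(\<forall>p\<in>blob_relations n. free_hom p = \<zero>\<^bsub>End_V n\<^esub>) \<longleftrightarrow>
    (n \<ge> 2 \<longrightarrow> \<theta> (par \<D>) =
      (\<a> + laurent_inv Var_a) * (\<b> + laurent_inv Var_b) * (\<c> + laurent_inv Var_c) * (\<d> + laurent_inv Var_d)) \<and>
    \<theta> (par \<D>\<^sub>L) = (\<x> + laurent_inv Var_x) * (\<y> + laurent_inv Var_y) \<and>
    \<theta> (par \<D>\<^sub>R) = (\<z> + laurent_inv Var_z) * (\<w> + laurent_inv Var_w) \<and>
    (n \<ge> 2 \<longrightarrow> \<theta> (par \<K>\<^sub>L) =
      (\<a> * \<b> * laurent_inv Var_x + \<x> * (laurent_inv Var_a * laurent_inv Var_b))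
        * (\<c> * \<d> * laurent_inv Var_y + \<y> * (laurent_inv Var_c * laurent_inv Var_d))) \<and>
    (n \<ge> 2 \<longrightarrow> \<theta> (par \<K>\<^sub>R) =
      (\<a> * \<d> * laurent_inv Var_w + \<w> * (laurent_inv Var_a * laurent_inv Var_d))
        * (\<b> * \<c> * laurent_inv Var_z + \<z> * (laurent_inv Var_b * laurent_inv Var_c))) \<and>
    \<theta> (par \<K>) = K_value n" (is "?rel \<longleftrightarrow> ?D \<and> ?DL \<and> ?DR \<and> ?KL \<and> ?KR \<and> ?K")
proof -
  have U: "free_hom (1 \<cdot> [Gen_U i, Gen_U i] - par \<D> \<cdot> [Gen_U i]) = \<zero>\<^bsub>End_V n\<^esub> \<longleftrightarrow> \<theta> (par \<D>) =
      (\<a> + laurent_inv Var_a) * (\<b> + laurent_inv Var_b) * (\<c> + laurent_inv Var_c) * (\<d> + laurent_inv Var_d)"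
    if "i \<in> {1..<n}" for i
    using that by (intro relation_word_scalar_iff pos_op_U_square[OF n]) (auto simp: cyc_succ_def split: if_splits, presburger+)
  have e: "free_hom (1 \<cdot> [Gen_e, Gen_e] - par \<D>\<^sub>L \<cdot> [Gen_e]) = \<zero>\<^bsub>End_V n\<^esub> \<longleftrightarrow> ?DL"
    using n by (intro relation_word_scalar_iff pos_op_e_square[OF n]) (auto simp: cyc_succ_def split: if_splits, presburger+)
  have f: "free_hom (1 \<cdot> [Gen_f, Gen_f] - par \<D>\<^sub>R \<cdot> [Gen_f]) = \<zero>\<^bsub>End_V n\<^esub> \<longleftrightarrow> ?DR"
    using n by (intro relation_word_scalar_iff pos_op_f_square[OF n]) (auto simp: cyc_succ_def split: if_splits, presburger+)
  have L: "free_hom (1 \<cdot> [Gen_U 1, Gen_e, Gen_U 1] - par \<K>\<^sub>L \<cdot> [Gen_U 1]) = \<zero>\<^bsub>End_V n\<^esub> \<longleftrightarrow> \<theta> (par \<K>\<^sub>L) =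
      (\<a> * \<b> * laurent_inv Var_x + \<x> * (laurent_inv Var_a * laurent_inv Var_b))
        * (\<c> * \<d> * laurent_inv Var_y + \<y> * (laurent_inv Var_c * laurent_inv Var_d))" if "n > 1"
    using that by (intro relation_word_scalar_iff pos_op_UeU) (auto simp: cyc_succ_def split: if_splits, presburger+)
  have R: "free_hom (1 \<cdot> [Gen_U (n - 1), Gen_f, Gen_U (n - 1)] - par \<K>\<^sub>R \<cdot> [Gen_U (n - 1)]) = \<zero>\<^bsub>End_V n\<^esub> \<longleftrightarrow> \<theta> (par \<K>\<^sub>R) =
      (\<a> * \<d> * laurent_inv Var_w + \<w> * (laurent_inv Var_a * laurent_inv Var_d))
        * (\<b> * \<c> * laurent_inv Var_z + \<z> * (laurent_inv Var_b * laurent_inv Var_c))" if "n > 1"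
    using that by (intro relation_word_scalar_iff pos_op_UfU) (auto simp: cyc_succ_def split: if_splits, presburger+)
  have IJ: "blob_I n \<in> lists (blob_gens n)" "blob_J n \<in> lists (blob_gens n)"
    using blob_IJ_closed[of n] by auto
  have I: "free_hom (1 \<cdot> (blob_I n @ blob_J n @ blob_I n) - par \<K> \<cdot> blob_I n) = \<zero>\<^bsub>End_V n\<^esub> \<longleftrightarrow> ?K"
  proof (intro relation_word_scalar_iff pos_op_IJI[OF n] distinct_blob_IJ blob_IJ_closed)
    show "cyc_succ n p \<noteq> r" if "p \<in> set (word_pos n (blob_I n))" "r \<in> set (word_pos n (blob_I n))" for p r
      using that unfolding word_pos_blob_I[OF n] by (rule matching.s_notin(2)[OF matching_parity_class])
  qed (use IJ in auto)
  have J: "free_hom (1 \<cdot> (blob_J n @ blob_I n @ blob_J n) - par \<K> \<cdot> blob_J n) = \<zero>\<^bsub>End_V n\<^esub> \<longleftrightarrow> ?K"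
  proof (intro relation_word_scalar_iff pos_op_IJI[OF n] distinct_blob_IJ blob_IJ_closed)
    show "cyc_succ n p \<noteq> r" if "p \<in> set (word_pos n (blob_J n))" "r \<in> set (word_pos n (blob_J n))" for p r
      using that unfolding word_pos_blob_J[OF n] by (rule matching.s_notin(2)[OF matching_parity_class])
  qed (use IJ in auto)
  have commute: "free_hom (1 \<cdot> [g, h] - 1 \<cdot> [h, g]) = \<zero>\<^bsub>End_V n\<^esub>"
    if "g \<in> blob_gens n" "h \<in> blob_gens n" "far n (gen_pos n g) (gen_pos n h)" for g h
    using that pos_op_commute[OF n gen_pos_in[OF n] gen_pos_in[OF n] that(3)]
    by (intro relation_holds) simp_all
  show ?thesis
  proof
    assume rel: ?rel
    have gt: "n \<ge> 2 \<longleftrightarrow> n > 1" by auto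
    show "?D \<and> ?DL \<and> ?DR \<and> ?KL \<and> ?KR \<and> ?K"
      unfolding gt
    proof (intro conjI impI)
      assume n1: "n > 1"
      then have i: "1 \<in> {1..<n}" by simp
      show "\<theta> (par \<D>) = (\<a> + laurent_inv Var_a) * (\<b> + laurent_inv Var_b)
          * (\<c> + laurent_inv Var_c) * (\<d> + laurent_inv Var_d)"
        using rel blob_relations.intros(1)[OF i] unfolding U[OF i, symmetric] by blast
      show "\<theta> (par \<K>\<^sub>L) = (\<a> * \<b> * laurent_inv Var_x + \<x> * (laurent_inv Var_a * laurent_inv Var_b))
          * (\<c> * \<d> * laurent_inv Var_y + \<y> * (laurent_inv Var_c * laurent_inv Var_d))"
        using rel blob_relations.intros(6)[OF n1] unfolding L[OF n1, symmetric] by blast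
      show "\<theta> (par \<K>\<^sub>R) = (\<a> * \<d> * laurent_inv Var_w + \<w> * (laurent_inv Var_a * laurent_inv Var_d))
          * (\<b> * \<c> * laurent_inv Var_z + \<z> * (laurent_inv Var_b * laurent_inv Var_c))"
        using rel blob_relations.intros(7)[OF n1] unfolding R[OF n1, symmetric] by blast
    next
      show ?DL using rel blob_relations.intros(4) unfolding e[symmetric] by blast
      show ?DR using rel blob_relations.intros(5) unfolding f[symmetric] by blast
      show ?K using rel blob_relations.intros(11) unfolding I[symmetric] by blast
    qed
  next
    assume conds: "?D \<and> ?DL \<and> ?DR \<and> ?KL \<and> ?KR \<and> ?K"
    show ?rel
    proof
      fix p assume "p \<in> blob_relations n"
      then show "free_hom p = \<zero>\<^bsub>End_V n\<^esub>"
      proof (cases rule: blob_relations.cases)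
        case (1 i)
        then have "n \<ge> 2" by simp
        then show ?thesis using 1 U[of i] conds by blast
      next
        case (2 i j)
        then show ?thesis
          by (simp only:) (rule relation_holds; use pos_op_UUU[OF n 2(2,3,4)] in simp)
      next
        case (3 i j)
        show ?thesis
        \<comment> \<open>The commutation relation includes i = j, where the positions are not
          \<open>far\<close> apart but both sides are the same word.\<close>
        proof (cases "i = j")
          case True
          then show ?thesis using 3 relation_holds[of "[Gen_U i, Gen_U i]" "[Gen_U i, Gen_U i]"] by simp
        next
          case False
          then have "\<bar>int i - int j\<bar> \<ge> 2" using 3 by linarith
          then show ?thesis
            using 3 commute[of "Gen_U i" "Gen_U j"] far_gen_pos(1)[OF n 3(2,3)] by simp
        qed
      next
        case 4
        then show ?thesis using e conds by blast
      next
        case 5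
        then show ?thesis using f conds by blast
      next
        case 6
        then have "n \<ge> 2" by simp
        then show ?thesis using 6 L conds by blast
      next
        case 7
        then have "n \<ge> 2" by simp
        then show ?thesis using 7 R conds by blast
      next
        case (8 i)
        then show ?thesis using commute[of Gen_e "Gen_U i"] far_gen_pos(2)[OF n 8(2,2)] by simp
      next
        case (9 i)
        then show ?thesis using commute[of Gen_f "Gen_U i"] far_gen_pos(3)[OF n 9(2,2)] by simp
      next
        case 10
        then show ?thesis using commute[of Gen_e Gen_f] far_ef[of n] by simp
      next
        case 11
        then show ?thesis using I conds by blast
      next
        case 12
        then show ?thesis using J conds by blast
      qed
    qed
  qed
qed

end

text \<open>For n = 1 there is no U_i, so no relation constrains \<theta> at \<D>,
  \<open>\<K>\<^sub>L\<close> and \<open>\<K>\<^sub>R\<close>; without the guards the equivalence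
  would fail there. For n = 0 the set \<open>I_idx n\<close> is empty and the operators have no
  positions to act on.\<close>

theorem theorem2p5:
  fixes n :: nat and \<theta> :: "param_ring \<Rightarrow> laurent"
  assumes "n \<ge> 1"
    and "\<theta> \<in> ring_hom ring_of_type_algebra ring_of_type_algebra"
  shows "(\<exists>!\<rho>. \<rho> \<in> representations (blob_base_change n \<theta>) (tensor_space n) \<and>
             (\<forall>g \<in> blob_gens n. \<rho> (blob_gen_image n \<theta> g) = R_gen n g))
    \<longleftrightarrow>
      (n \<ge> 2 \<longrightarrow> \<theta> (par \<D>) =
         (\<a> + 1 /\<^sub>u \<a>) * (\<b> + 1 /\<^sub>u \<b>) * (\<c> + 1 /\<^sub>u \<c>) * (\<d> + 1 /\<^sub>u \<d>)) \<and>
      \<theta> (par \<D>\<^sub>L) = (\<x> + 1 /\<^sub>u \<x>) * (\<y> + 1 /\<^sub>u \<y>) \<and>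
      \<theta> (par \<D>\<^sub>R) = (\<z> + 1 /\<^sub>u \<z>) * (\<w> + 1 /\<^sub>u \<w>) \<and>
      (n \<ge> 2 \<longrightarrow> \<theta> (par \<K>\<^sub>L) =
         ((\<a> * \<b>) /\<^sub>u \<x> + \<x> /\<^sub>u (\<a> * \<b>)) * ((\<c> * \<d>) /\<^sub>u \<y> + \<y> /\<^sub>u (\<c> * \<d>))) \<and>
      (n \<ge> 2 \<longrightarrow> \<theta> (par \<K>\<^sub>R) =
         ((\<a> * \<d>) /\<^sub>u \<w> + \<w> /\<^sub>u (\<a> * \<d>)) * ((\<b> * \<c>) /\<^sub>u \<z> + \<z> /\<^sub>u (\<b> * \<c>))) \<and>
      \<theta> (par \<K>) =
        (if odd n
         then (\<x> * \<y>) /\<^sub>u (\<z> * \<w>) + 2 + (\<z> * \<w>) /\<^sub>u (\<x> * \<y>)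
         else (\<a> * \<b> * \<c> * \<d>) /\<^sub>u (\<x> * \<y> * \<z> * \<w>) + 2
              + (\<x> * \<y> * \<z> * \<w>) /\<^sub>u (\<a> * \<b> * \<c> * \<d>))"
proof -
  interpret R_assignment n \<theta>
    using assms by unfold_locales
  have inv: "\<a> * laurent_inv Var_a = 1" "\<b> * laurent_inv Var_b = 1" "\<c> * laurent_inv Var_c = 1"
    "\<d> * laurent_inv Var_d = 1" "\<x> * laurent_inv Var_x = 1" "\<y> * laurent_inv Var_y = 1"
    "\<z> * laurent_inv Var_z = 1" "\<w> * laurent_inv Var_w = 1"
    by (simp_all add: \<a>_def \<b>_def \<c>_def \<d>_def \<x>_def \<y>_def \<z>_def \<w>_def laurent_gen_inverse)
  have mult_inverse: "(q * r) * (q' * r') = 1" if "q * q' = 1" "r * r' = 1" for q q' r r' :: laurent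
  proof -
    have "(q * r) * (q' * r') = (q * q') * (r * r')"
      by (simp only: ac_simps)
    then show ?thesis using that by simp
  qed
  \<comment> \<open>The denominators are products of variables, inverted factor by factor. The
    nesting follows the bracketing of the statement, so that the rewritten fractions agree literally
    with \<open>relations_iff\<close> and \<open>K_value\<close>.\<close>
  note div = inv[THEN unit_div_eq]
    unit_div_eq[OF mult_inverse[OF inv(1,2)]] unit_div_eq[OF mult_inverse[OF inv(3,4)]]
    unit_div_eq[OF mult_inverse[OF inv(1,4)]] unit_div_eq[OF mult_inverse[OF inv(2,3)]]
    unit_div_eq[OF mult_inverse[OF inv(7,8)]] unit_div_eq[OF mult_inverse[OF inv(5,6)]]
    unit_div_eq[OF mult_inverse[OF mult_inverse[OF mult_inverse[OF inv(5,6)] inv(7)] inv(8)]]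
    unit_div_eq[OF mult_inverse[OF mult_inverse[OF mult_inverse[OF inv(1,2)] inv(3)] inv(4)]]
  show ?thesis
    unfolding ex1_representation_iff relations_iff div K_value_def mult_1 ..
qed

end
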